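(* Let $X$ be an Asplund space, let $A,B\subset X$ be closed, and let $\bar x\in A\cap B$. Suppose there exist numbers $\alpha\in]0,1[$ and $\delta>0$ such that, for all $a\in(A\setminus B)\cap\mathbb{B}_\delta(\bar x)$, $b\in(B\setminus A)\cap\mathbb{B}_\delta(\bar x)$ and $x\in\mathbb{B}_\delta(\bar x)$ with $\|x-a\|=\|x-b\|$, there exists an $\varepsilon>0$ such that $\|x_1^*+x_2^*\|>\alpha$ for all $a'\in A\cap\mathbb{B}_\varepsilon(a)$, $b'\in B\cap\mathbb{B}_\varepsilon(b)$, $x_1'\in\mathbb{B}_\varepsilon(a)$, $x_2'\in\mathbb{B}_\varepsilon(b)$ with $\|x-x_1'\|=\|x-x_2'\|$, and all $x_1^*,x_2^*\in X^*$ satisfying $$d(x_1^*,N_A(a'))<\delta,\quad d(x_2^*,N_B(b'))<\delta,$$ $$\|x_1^*\|+\|x_2^*\|=1,\quad \langle x_1^*,x-x_1'\rangle=\|x_1^*\|\,\|x-x_1'\|,\quad \langle x_2^*,x-x_2'\rangle=\|x_2^*\|\,\|x-x_2'\|.$$ Then $\{A,B\}$ is subtransversal at $\bar x$. Moreover, $\mathrm{str}[A,B](\bar x)\ge\alpha$.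
   Context: $\mathbb{B}_r(x)$ is the open ball with centre $x$ and radius $r$; $d(\cdot,\cdot)$ is the distance from a point to a set in the norm. A Banach space is Asplund if every continuous convex function on an open convex set is Fréchet differentiable on a dense subset of it (equivalently, the dual of each separable subspace is separable). Fréchet normal cone to $A$ at $x\in A$: $N_A(x)=\{x^*\in X^*\mid \limsup_{a\to x,\,a\in A\setminus\{x\}}\langle x^*,a-x\rangle/\|a-x\|\le 0\}$ (all of $X^*$ if $x$ is isolated in $A$). Subtransversality: $\{A,B\}$ is subtransversal at $\bar x\in A\cap B$ if there exist $\alpha\in]0,1[$ and $\delta>0$ such that $\alpha\, d(x,A\cap B)\le\max\{d(x,A),d(x,B)\}$ for all $x\in\mathbb{B}_\delta(\bar x)$. The number $\mathrm{str}[A,B](\bar x)$ is the supremum of all $\alpha\in]0,1[$ for which this holds for some $\delta>0$ (with $\sup\emptyset=0$). *)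

theory Defs
  imports "HOL-Analysis.Analysis"
begin

definition asplund_space :: "'a::banach itself \<Rightarrow> bool" where
  "asplund_space _ \<longleftrightarrow>
     (\<forall>(U :: 'a set) (f :: 'a \<Rightarrow> real).
        open U \<and> convex U \<and> continuous_on U f \<and> convex_on U f \<longrightarrow>
        (\<exists>D. D \<subseteq> U \<and> U \<subseteq> closure D \<and> (\<forall>x\<in>D. f differentiable (at x))))"

text \<open>The upper limit is taken in the extended reals. If \<open>x\<close> is isolated in \<open>A\<close>, the filter
  \<open>at x within A\<close> is trivial, the upper limit is \<open>-\<infinity>\<close>, and the cone is the whole dual space.
  Only meaningful for \<open>x \<in> A\<close>.\<close>

definition frechet_normal_cone :: "'a::real_normed_vector set \<Rightarrow> 'a \<Rightarrow> ('a \<Rightarrow>\<^sub>L real) set" where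
  "frechet_normal_cone A x =
     {f. Limsup (at x within A) (\<lambda>a. ereal (blinfun_apply f (a - x) / norm (a - x))) \<le> 0}"

text \<open>The three notions below are meant for a base point \<open>x0 \<in> A \<inter> B\<close>, so that all sets whose
  distance is taken are nonempty (\<open>infdist x {} = 0\<close> by convention in the library).\<close>

definition subtransversal_with ::
    "'a::real_normed_vector set \<Rightarrow> 'a set \<Rightarrow> 'a \<Rightarrow> real \<Rightarrow> real \<Rightarrow> bool" where
  "subtransversal_with A B x0 \<alpha> \<delta> \<longleftrightarrow>
     (\<forall>x\<in>ball x0 \<delta>. \<alpha> * infdist x (A \<inter> B) \<le> max (infdist x A) (infdist x B))"

definition subtransversal :: "'a::real_normed_vector set \<Rightarrow> 'a set \<Rightarrow> 'a \<Rightarrow> bool" where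
  "subtransversal A B x0 \<longleftrightarrow> (\<exists>\<alpha>\<in>{0<..<1}. \<exists>\<delta>>0. subtransversal_with A B x0 \<alpha> \<delta>)"

definition str :: "'a::real_normed_vector set \<Rightarrow> 'a set \<Rightarrow> 'a \<Rightarrow> real" where
  "str A B x0 =
     (let S = {\<alpha> \<in> {0<..<1}. \<exists>\<delta>>0. subtransversal_with A B x0 \<alpha> \<delta>}
      in if S = {} then 0 else Sup S)"

end

theory Submission
  imports Defs
begin

text \<open>
  If the conclusion fails for some \<open>\<alpha>' < \<alpha>\<close>, Ekeland's principle applied to
  \<open>(a, b, x) \<mapsto> max \<parallel>x - a\<parallel> \<parallel>x - b\<parallel>\<close> on \<open>A \<times> B \<times> X\<close> gives a point \<open>(a, b, x)\<close>, with
  \<open>\<parallel>x - a\<parallel> = \<parallel>x - b\<parallel> > 0\<close>, at which the function decreases with slope less than \<open>\<alpha>\<close>. A fuzzy sum rule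
  at this point yields the functionals excluded by the hypothesis.

  The sum rule is proved by separable reduction. A separable closed subspace \<open>Y\<close> is chosen so
  that every finite configuration in \<open>X\<close> has almost isometric copies in \<open>Y\<close>, with points of
  \<open>A\<close> and \<open>B\<close> going to points of \<open>A\<close> and \<open>B\<close>; Frechet normals along \<open>Y\<close>, with all the
  inequalities relating them, then pass to \<open>X\<close> as weak* limits along these copies, so no
  Hahn-Banach extension is needed. On \<open>Y\<close> the dual is separable because \<open>X\<close> is Asplund, hence the norm is
  uniformly approximated by convex functions that are Frechet differentiable along \<open>Y\<close>, and a
  smooth variational principle gives an exact minimiser of a decoupled, mostly smooth problem.
\<close>

section \<open>Separability of the dual along separable subspaces\<close>

text \<open>The Asplund property is available only as dense Frechet differentiability of convex
  functions on the whole space, so separability of duals has to be derived from it, and every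
  functional that occurs is defined on all of \<open>X\<close> even when only its values on
  \<open>Y\<close> matter. Norming functionals, too, are obtained as derivatives of the norm near a
  given point, with an error that is absorbed later. A derivative along \<open>Y\<close> says
  nothing about directions outside \<open>Y\<close>, so the difficulty lies in returning to
  \<open>X\<close>. What makes this possible is that Frechet normality, for fixed \<open>e\<close>
  and radius \<open>r\<close>, is a family of inequalities at single points: a test point is
  replaced by its copy in \<open>Y\<close>, and the inequality survives in the limit. At the Ekeland
  point the variables are charged differently: the slope \<open>\<beta>\<close> in \<open>x\<close>
  bounds the norm of the sum of the multipliers, while a small extra weight \<open>\<gamma>\<close>
  on \<open>a\<close> and \<open>b\<close> keeps their distances to the normal cones below
  \<open>\<delta>\<close>.\<close>

lemma compact_box: "compact {F :: 'i \<Rightarrow> real. \<forall>i. \<bar>F i\<bar> \<le> b i}"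
proof -
  have "compactin (product_topology (\<lambda>i. euclidean) UNIV) (\<Pi>\<^sub>E i\<in>UNIV. {- b i..b i})"
    by (subst compactin_PiE) auto
  then have "compact (\<Pi>\<^sub>E i\<in>UNIV. {- b i..b i})"
    by (simp add: euclidean_product_topology)
  also have "(\<Pi>\<^sub>E i\<in>UNIV. {- b i..b i}) = {F. \<forall>i. \<bar>F i\<bar> \<le> b i}"
    by (auto simp: PiE_iff abs_le_iff minus_le_iff)
  finally show ?thesis .
qed

lemma continuous_on_eval: "continuous_on S (\<lambda>F :: 'i \<Rightarrow> real. F i)"
  by (rule continuous_on_product_then_coordinatewise) (rule continuous_on_id)

text \<open>Functionals are kept as bare functions because the function type carries the product
  topology, that is, pointwise convergence. On this set it is the weak* topology, and
  \<open>compact_dual_ball\<close> is the Banach-Alaoglu theorem.\<close>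

definition dual_ball :: "('a::real_normed_vector \<Rightarrow> real) set" where
  "dual_ball = {F. linear F \<and> (\<forall>x. \<bar>F x\<bar> \<le> norm x)}"

lemma dual_ballD:
  assumes "F \<in> dual_ball"
  shows "F (x + y) = F x + F y" "F (c *\<^sub>R x) = c * F x" "\<bar>F x\<bar> \<le> norm x"
    "F (x - y) = F x - F y" "F 0 = 0" "F (- x) = - F x"
  using assms by (auto simp: dual_ball_def linear_add linear_scale linear_diff linear_0 linear_neg)

lemma closed_dual_ball: "closed (dual_ball :: ('a::real_normed_vector \<Rightarrow> real) set)"
proof -
  have eq: "dual_ball = (\<Inter>x. {F :: 'a \<Rightarrow> real. \<bar>F x\<bar> \<le> norm x}) \<inter>
      ((\<Inter>x y. {F. F (x + y) = F x + F y}) \<inter> (\<Inter>c x. {F. F (c *\<^sub>R x) = c * F x}))"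
    by (auto simp: dual_ball_def linear_iff)
  show ?thesis
    unfolding eq
    by (intro closed_Int closed_INT ballI closed_Collect_eq closed_Collect_le continuous_on_rabs
        continuous_on_add continuous_on_mult continuous_on_const continuous_on_eval)
qed

lemma compact_dual_ball: "compact (dual_ball :: ('a::real_normed_vector \<Rightarrow> real) set)"
proof -
  have "dual_ball = {F :: 'a \<Rightarrow> real. \<forall>x. \<bar>F x\<bar> \<le> norm x} \<inter> dual_ball"
    by (auto simp: dual_ball_def)
  then show ?thesis
    using compact_Int_closed[OF compact_box closed_dual_ball] by metis
qed

lemma dual_ball_obtain:
  assumes "F \<in> dual_ball"
  obtains f where "blinfun_apply f = F" "norm f \<le> 1"
proof
  have bl: "bounded_linear F"
    by (rule bounded_linear_intro[of _ 1]) (use dual_ballD[OF assms] in auto)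
  then show *: "blinfun_apply (Blinfun F) = F"
    by (rule bounded_linear_Blinfun_apply)
  show "norm (Blinfun F) \<le> 1"
    by (rule norm_blinfun_bound) (use assms in \<open>auto simp: * dual_ball_def\<close>)
qed

lemma convex_on_has_dense_derivatives:
  fixes f :: "'a::banach \<Rightarrow> real"
  assumes "asplund_space TYPE('a)" "continuous_on UNIV f" "convex_on UNIV f" "e > 0"
  obtains y D where "norm (y - x) < e" "(f has_derivative D) (at y)"
proof -
  have "open (UNIV :: 'a set) \<and> convex (UNIV :: 'a set) \<and> continuous_on UNIV f \<and> convex_on UNIV f"
    using assms by simp
  then obtain E where E: "UNIV \<subseteq> closure E" "\<forall>x\<in>E. f differentiable (at x)"
    using assms(1) unfolding asplund_space_def by meson
  then have "x \<in> closure E" by auto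
  then obtain y where "y \<in> E" "dist y x < e"
    using \<open>e > 0\<close> by (meson closure_approachable)
  with E that show ?thesis
    by (auto simp: differentiable_def dist_norm)
qed

text \<open>Near \<open>x\<close> there is a point \<open>y\<close> where the norm has a derivative
  \<open>D\<close>. The norm is 1-Lipschitz, so \<open>D\<close> lies in the dual ball, and positive
  homogeneity gives \<open>D y = norm y\<close>. This stands in for a Hahn-Banach norming
  functional; the error \<open>e\<close> covers twice the distance from \<open>x\<close> to
  \<open>y\<close>.\<close>

lemma norming_functional:
  fixes x :: "'a::banach"
  assumes "asplund_space TYPE('a)" "e > 0"
  obtains f where "f \<in> dual_ball" "f x \<ge> norm x - e"
proof -
  have "convex_on UNIV (norm :: 'a \<Rightarrow> real)"
    using convex_on_dist[of UNIV 0] by simp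
  then obtain y D where y: "norm (y - x) < e/2" and D: "(norm has_derivative D) (at y)"
    using convex_on_has_dense_derivatives[OF assms(1), of norm "e/2" x] \<open>e > 0\<close>
    by (auto intro: continuous_intros)
  have lin: "linear D" using D by (simp add: has_derivative_linear)
  have lim: "((\<lambda>t. (norm (y + t *\<^sub>R h) - norm y) / t) \<longlongrightarrow> D h) (at_right 0)" for h
  proof -
    have "((\<lambda>t. norm (y + t *\<^sub>R h)) has_derivative (\<lambda>t. D (t *\<^sub>R h))) (at 0)"
      by (rule has_derivative_compose[of "\<lambda>t. y + t *\<^sub>R h" "\<lambda>t. t *\<^sub>R h" 0 UNIV norm D])
         (auto intro!: derivative_eq_intros simp: D)
    then have "((\<lambda>t. norm (y + t *\<^sub>R h)) has_real_derivative D h) (at 0)"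
      by (simp add: has_field_derivative_def linear_scale[OF lin] mult.commute[of _ "D h"])
    then show ?thesis
      unfolding has_field_derivative_iff by (auto simp: intro: tendsto_within_subset)
  qed
  have le: "D h \<le> norm h" for h
  proof (rule tendsto_upperbound[OF lim])
    show "\<forall>\<^sub>F t in at_right 0. (norm (y + t *\<^sub>R h) - norm y) / t \<le> norm h"
      using eventually_at_right_less[of "0::real"]
    proof (eventually_elim)
      case (elim t)
      have "norm (y + t *\<^sub>R h) \<le> norm y + t * norm h"
        using norm_triangle_ineq[of y "t *\<^sub>R h"] elim by simp
      then show ?case using elim by (simp add: field_simps)
    qed
  qed simp
  have eq: "D y = norm y"
  proof (rule tendsto_unique[OF _ lim])
    show "((\<lambda>t. (norm (y + t *\<^sub>R y) - norm y) / t) \<longlongrightarrow> norm y) (at_right 0)"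
    proof (rule tendsto_eventually)
      show "\<forall>\<^sub>F t in at_right 0. (norm (y + t *\<^sub>R y) - norm y) / t = norm y"
        using eventually_at_right_less[of "0::real"]
      proof (eventually_elim)
        case (elim t)
        have "y + t *\<^sub>R y = (1 + t) *\<^sub>R y" by (simp add: algebra_simps)
        then have "norm (y + t *\<^sub>R y) = (1 + t) * norm y" using elim by simp
        then show ?case using elim by (simp add: field_simps)
      qed
    qed
  qed simp
  have mem: "D \<in> dual_ball"
    unfolding dual_ball_def using lin le le[of "- _"] by (auto simp: abs_le_iff linear_neg[OF lin])
  have "D x = D y - D (y - x)" by (simp add: linear_diff[OF lin])
  also have "\<dots> \<ge> norm x - e"
    using eq le[of "y - x"] y norm_triangle_ineq2[of x y] by (simp add: norm_minus_commute)
  finally show ?thesis using that mem by blast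
qed

lemma dual_ball_abs_diff_le:
  assumes "f \<in> dual_ball"
  shows "\<bar>f x - f y\<bar> \<le> norm (x - y)"
  using dual_ballD(3)[OF assms, of "x - y"] by (simp add: dual_ballD(4)[OF assms])

lemma support_function:
  assumes L: "L \<subseteq> dual_ball" "L \<noteq> {}"
  defines "\<sigma> \<equiv> \<lambda>x :: 'a::real_normed_vector. SUP f\<in>L. (f x :: real)"
  shows "convex_on UNIV \<sigma>" "continuous_on UNIV \<sigma>" "\<And>f x. f \<in> L \<Longrightarrow> f x \<le> \<sigma> x"
proof -
  have bdd: "bdd_above ((\<lambda>f. f x) ` L)" for x
    using L(1) dual_ballD(3) by (intro bdd_aboveI[of _ "norm x"]) (fastforce dest: abs_le_D1)
  have eq: "\<sigma> x = (SUP f\<in>L. f x)" for x by (simp add: \<sigma>_def)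
  show up: "\<And>f x. f \<in> L \<Longrightarrow> f x \<le> \<sigma> x"
    unfolding \<sigma>_def by (rule cSUP_upper[OF _ bdd])
  show "convex_on UNIV \<sigma>"
  proof (rule convex_onI)
    fix t :: real and x y :: 'a assume t: "0 < t" "t < 1"
    show "\<sigma> ((1 - t) *\<^sub>R x + t *\<^sub>R y) \<le> (1 - t) * \<sigma> x + t * \<sigma> y"
      unfolding eq[of "_ + _"]
    proof (rule cSUP_least[OF L(2)])
      fix f assume f: "f \<in> L"
      then have "f ((1 - t) *\<^sub>R x + t *\<^sub>R y) = (1 - t) * f x + t * f y"
        using L(1) by (auto simp: dual_ballD)
      also have "\<dots> \<le> (1 - t) * \<sigma> x + t * \<sigma> y"
        using up[OF f] t by (intro add_mono mult_left_mono) auto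
      finally show "f ((1 - t) *\<^sub>R x + t *\<^sub>R y) \<le> (1 - t) * \<sigma> x + t * \<sigma> y" .
    qed
  qed simp
  have "\<sigma> x \<le> \<sigma> y + norm (x - y)" for x y
    unfolding eq[of x]
  proof (rule cSUP_least[OF L(2)])
    fix f assume f: "f \<in> L"
    show "f x \<le> \<sigma> y + norm (x - y)"
      using up[OF f, of y] dual_ball_abs_diff_le[of f x y] f L(1) by (auto simp: abs_le_iff)
  qed
  then have "\<bar>\<sigma> x - \<sigma> y\<bar> \<le> norm (x - y)" for x y
    by (simp add: abs_le_iff diff_le_eq) (metis add.commute norm_minus_commute)
  then show "continuous_on UNIV \<sigma>"
    unfolding continuous_on_iff dist_norm real_norm_def
    by (meson order_le_less_trans)
qed

text \<open>Smulian's argument: if the support function of \<open>L\<close> is Frechet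
  differentiable at \<open>x\<close> with derivative \<open>D\<close>, then every member of
  \<open>L\<close> that nearly attains the supremum at \<open>x\<close> is close to \<open>D\<close>
  in norm, so a thin enough slice at \<open>x\<close> has small diameter.\<close>

lemma asplund_small_slice:
  fixes L :: "('a::banach \<Rightarrow> real) set"
  assumes "asplund_space TYPE('a)" and L: "L \<subseteq> dual_ball" "L \<noteq> {}" and "e > 0"
  obtains x c where "\<exists>f\<in>L. f x > c"
    "\<And>f g y. f \<in> L \<Longrightarrow> g \<in> L \<Longrightarrow> f x > c \<Longrightarrow> g x > c \<Longrightarrow> \<bar>f y - g y\<bar> \<le> e * norm y"
proof -
  define \<sigma> where "\<sigma> = (\<lambda>x :: 'a. SUP f\<in>L. f x)"
  note sf = support_function(1,2)[OF L, folded \<sigma>_def]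
  have up: "f y \<le> \<sigma> y" if "f \<in> L" for f y
    using support_function(3)[OF L that] by (simp add: \<sigma>_def)
  obtain x D where D: "(\<sigma> has_derivative D) (at x)"
    using convex_on_has_dense_derivatives[OF assms(1) sf(2,1) zero_less_one] by blast
  have lin: "linear D" using D by (simp add: has_derivative_linear)
  obtain d where d: "d > 0"
    "\<And>z. norm (z - x) < d \<Longrightarrow> \<bar>\<sigma> z - \<sigma> x - D (z - x)\<bar> \<le> e/16 * norm (z - x)"
  proof -
    have "e/16 > 0" using \<open>e > 0\<close> by simp
    with D[unfolded has_derivative_at_alt] that show ?thesis
      unfolding real_norm_def by blast
  qed
  define t where "t = d/2"
  have t: "t > 0" "t < d" using d by (auto simp: t_def)
  \<comment> \<open>Differentiability costs at most \<open>e/16 * t\<close> on the sphere of radius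
    \<open>t\<close>. Giving the slice the same depth makes the two errors add up to the
    \<open>e * t / 8\<close> in \<open>le\<close>.\<close>
  define c where "c = \<sigma> x - e * t / 16"
  have bdd: "bdd_above ((\<lambda>f. f x) ` L)"
    using L(1) dual_ballD(3) by (intro bdd_aboveI[of _ "norm x"]) (fastforce dest: abs_le_D1)
  have "c < \<sigma> x" using t \<open>e > 0\<close> by (simp add: c_def)
  then have ex: "\<exists>f\<in>L. f x > c"
    unfolding \<sigma>_def by (simp add: less_cSUP_iff[OF L(2) bdd])
  have le: "f h \<le> D h + e * t / 8" if f: "f \<in> L" "f x > c" and h: "norm h = t" for f h
  proof -
    have "f (x + h) \<le> \<sigma> (x + h)" by (rule up[OF f(1)])
    also have "\<dots> \<le> \<sigma> x + D h + e/16 * t" using abs_le_D1[OF d(2)[of "x + h"]] h t by simp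
    finally show ?thesis using f L(1) dual_ballD(1)[of f x h] by (auto simp: c_def)
  qed
  have half: "f y - g y \<le> e * norm y"
    if f: "f \<in> L" "f x > c" and g: "g \<in> L" "g x > c" for f g y
  proof (cases "y = 0")
    case True
    have "f \<in> dual_ball" "g \<in> dual_ball" using f g L(1) by auto
    then show ?thesis using True by (simp add: dual_ballD)
  next
    case False
    define h where "h = (t / norm y) *\<^sub>R y"
    have h: "norm h = t" using False t by (simp add: h_def)
    have fg: "f \<in> dual_ball" "g \<in> dual_ball" using f g L by auto
    \<comment> \<open>Using \<open>le\<close> for \<open>f\<close> at \<open>h\<close> and for
      \<open>g\<close> at \<open>- h\<close> cancels the derivative \<open>D\<close>.\<close>
    have "f h + g (- h) \<le> e * t / 4"
      using le[OF f h] le[OF g, of "- h"] h by (simp add: linear_neg[OF lin])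
    then have "(t / norm y) * (f y - g y) \<le> e * t / 4"
      by (simp add: h_def dual_ballD(2,6)[OF fg(1)] dual_ballD(2,6)[OF fg(2)] right_diff_distrib)
    then have "t * (f y - g y) \<le> t * (e / 4 * norm y)" using False by (simp add: field_simps)
    then have "f y - g y \<le> e / 4 * norm y" using t by (simp only: mult_le_cancel_left_pos)
    also have "\<dots> \<le> e * norm y" using \<open>e > 0\<close> by (intro mult_right_mono) auto
    finally show ?thesis .
  qed
  show ?thesis
  proof (rule that[OF ex])
    fix f g y assume "f \<in> L" "g \<in> L" "f x > c" "g x > c"
    then show "\<bar>f y - g y\<bar> \<le> e * norm y"
      using half[of f g y] half[of g f y] by simp
  qed
qed

text \<open>Zorn's lemma is applied to the open complements of the representing sets.\<close>

lemma minimal_representing_set: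
  fixes E :: "('a::real_normed_vector \<Rightarrow> real) set" and M :: "'a set"
  assumes E: "E \<subseteq> dual_ball"
  defines "R \<equiv> \<lambda>U. \<forall>e\<in>E. \<exists>f\<in>dual_ball - U. \<forall>y\<in>M. f y = e y"
  obtains U where "open U" "R U" "\<And>V. open V \<Longrightarrow> R V \<Longrightarrow> U \<subseteq> V \<Longrightarrow> V = U"
proof -
  have "\<exists>U\<in>{U. open U \<and> R U}. \<forall>V\<in>{U. open U \<and> R U}. U \<subseteq> V \<longrightarrow> V = U"
  proof (rule subset_Zorn')
    fix C assume C: "subset.chain {U. open U \<and> R U} C"
    then have C1: "\<And>U. U \<in> C \<Longrightarrow> open U \<and> R U" unfolding subset_chain_def by blast
    have "R (\<Union>C)"
      unfolding R_def
    proof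
      fix e assume e: "e \<in> E"
      let ?K = "dual_ball \<inter> (\<Inter>y\<in>M. {f. f y = e y})"
      have "compact ?K"
        by (intro compact_Int_closed compact_dual_ball closed_INT ballI closed_Collect_eq
            continuous_on_const continuous_on_eval)
      \<comment> \<open>\<open>?K\<close> collects the members of the dual ball that agree with
        \<open>e\<close> on \<open>M\<close>. By compactness a cover by the chain reduces to
        finitely many members, hence to a single largest one, and no representative of
        \<open>e\<close> would be left outside it.\<close>
      have "\<not> ?K \<subseteq> \<Union>C"
      proof
        assume "?K \<subseteq> \<Union>C"
        then obtain C' where C': "C' \<subseteq> C" "finite C'" "?K \<subseteq> \<Union>C'"
          by (rule compactE[OF \<open>compact ?K\<close>]) (use C1 in blast)
        have "e \<in> ?K" using e E by blast
        then have "C' \<noteq> {}" using C' by auto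
        have "subset.chain {U. open U \<and> R U} C'" using C C'(1)
          unfolding subset_chain_def by (meson subset_trans subsetD)
        then have "\<Union>C' \<in> C'"
          using \<open>C' \<noteq> {}\<close> C'(2) by (intro Union_in_chain)
        then have "R (\<Union>C')" using C1 C'(1) by (metis subsetD)
        then show False using C'(3) e unfolding R_def by blast
      qed
      then show "\<exists>f\<in>dual_ball - \<Union>C. \<forall>y\<in>M. f y = e y" by blast
    qed
    moreover have "open (\<Union>C)" using C1 by (intro open_Union) simp
    ultimately show "\<Union>C \<in> {U. open U \<and> R U}" by simp
  qed
  then obtain U where U: "U \<in> {U. open U \<and> R U}" "\<forall>V\<in>{U. open U \<and> R U}. U \<subseteq> V \<longrightarrow> V = U" ..
  then have "open U" "R U" "V = U" if "open V" "R V" "U \<subseteq> V" for V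
    using that by blast+
  moreover have "open U" "R U" using U(1) by blast+
  ultimately show ?thesis by (intro that)
qed

text \<open>The points to drop are those whose image has a neighbourhood with only countably many
  members of \<open>E\<close> above it. By Lindelof countably many such neighbourhoods suffice, so
  only countably many points are dropped, and uncountable sets stay uncountable.\<close>

lemma condensation_points:
  fixes T :: "'b \<Rightarrow> 'c::second_countable_topology"
  assumes "uncountable E"
  obtains E' where "E' \<subseteq> E" "E' \<noteq> {}"
    "\<And>e V. e \<in> E' \<Longrightarrow> open V \<Longrightarrow> T e \<in> V \<Longrightarrow> uncountable {d\<in>E'. T d \<in> V}"
proof -
  define \<U> where "\<U> = {U. open U \<and> countable {e\<in>E. T e \<in> U}}"
  obtain \<U>' where U': "\<U>' \<subseteq> \<U>" "countable \<U>'" "\<Union>\<U>' = \<Union>\<U>"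
    using Lindelof[of \<U>] by (auto simp: \<U>_def)
  define N where "N = {e\<in>E. T e \<in> \<Union>\<U>}"
  have "N = (\<Union>U\<in>\<U>'. {e\<in>E. T e \<in> U})" using U'(3) by (auto simp: N_def)
  then have N: "countable N" using U'(1,2) by (auto simp: \<U>_def intro!: countable_UN)
  show ?thesis
  proof (rule that[of "E - N"])
    show "E - N \<noteq> {}" using N assms by (metis countable_empty uncountable_minus_countable)
    fix e V assume e: "e \<in> E - N" and V: "open V" "T e \<in> V"
    have "uncountable {d\<in>E. T d \<in> V}" using e V by (auto simp: N_def \<U>_def)
    moreover have "{d\<in>E - N. T d \<in> V} = {d\<in>E. T d \<in> V} - N" by auto
    ultimately show "uncountable {d\<in>E - N. T d \<in> V}"
      using N by (simp add: uncountable_minus_countable)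
  qed auto
qed

text \<open>This is where the Asplund property makes duals of separable subspaces separable. Pass to
  condensation points of \<open>E\<close> for pointwise convergence on \<open>M\<close>, and
  represent them by a minimal compact subset of the dual ball. That set has a slice of diameter at
  most \<open>e\<close>. By minimality, removing the slice leaves some \<open>f\<close>
  unrepresented, and by compactness this persists for all members near \<open>f\<close>. Two
  distinct such members have both representatives in the slice, so they cannot be separated by more
  than \<open>e\<close> on \<open>M\<close>.\<close>

lemma separated_countable:
  fixes M :: "'a::banach set"
  assumes "asplund_space TYPE('a)" "countable M" "e > 0" and E: "E \<subseteq> dual_ball"
    and far: "\<And>f g. f \<in> E \<Longrightarrow> g \<in> E \<Longrightarrow> f \<noteq> g \<Longrightarrow> \<exists>y\<in>M. \<bar>f y - g y\<bar> > e * norm y"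
  shows "countable E"
proof (rule ccontr)
  assume unc: "uncountable E"
  \<comment> \<open>Restriction to \<open>M\<close>, listed as a sequence: countability of
    \<open>M\<close> gives a second countable target, as condensation points require. The listing is
    meaningful only for nonempty \<open>M\<close>, which is established below.\<close>
  define T where "T = (\<lambda>(f :: 'a \<Rightarrow> real) (n::nat). f (from_nat_into M n))"
  have T_eq: "T f = T g \<longleftrightarrow> (\<forall>y\<in>M. f y = g y)" if "M \<noteq> {}" for f g
  proof
    assume *: "T f = T g"
    show "\<forall>y\<in>M. f y = g y"
      using fun_cong[OF *] from_nat_into_surj[OF \<open>countable M\<close>] by (fastforce simp: T_def)
  next
    assume "\<forall>y\<in>M. f y = g y"
    then show "T f = T g" using from_nat_into[OF that] by (auto simp: T_def)
  qed
  have contT: "continuous_on S T" for S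
    unfolding T_def by (intro continuous_on_coordinatewise_then_product continuous_on_eval)
  obtain E' where E': "E' \<subseteq> E" "E' \<noteq> {}"
    "\<And>f V. f \<in> E' \<Longrightarrow> open V \<Longrightarrow> T f \<in> V \<Longrightarrow> uncountable {d\<in>E'. T d \<in> V}"
    by (rule condensation_points[OF unc, of T]) blast
  have two: "\<exists>a\<in>E'. \<exists>b\<in>E'. a \<noteq> b \<and> T a \<in> V \<and> T b \<in> V" if "f \<in> E'" "open V" "T f \<in> V" for f V
  proof -
    let ?S = "{d\<in>E'. T d \<in> V}"
    have "uncountable (?S - {f})"
      using E'(3)[OF that] by (simp add: uncountable_minus_countable)
    then have "?S - {f} \<noteq> {}" by (metis countable_empty)
    then show ?thesis using that by blast
  qed
  obtain f0 where "f0 \<in> E'" using E'(2) by blast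
  with two[OF this open_UNIV] obtain a b where "a \<in> E'" "b \<in> E'" "a \<noteq> b" by auto
  then have M: "M \<noteq> {}" using far[of a b] E'(1) by auto
  have "E' \<subseteq> dual_ball" using E E' by auto
  then obtain U where U: "open U"
    "\<forall>f\<in>E'. \<exists>g\<in>dual_ball - U. \<forall>y\<in>M. g y = f y"
    "\<And>V. open V \<Longrightarrow> \<forall>f\<in>E'. \<exists>g\<in>dual_ball - V. \<forall>y\<in>M. g y = f y \<Longrightarrow> U \<subseteq> V \<Longrightarrow> V = U"
    by (rule minimal_representing_set[of E' M]) (rule that)
  have "dual_ball - U \<subseteq> dual_ball" "dual_ball - U \<noteq> {}" using U(2) E'(2) by auto
  then obtain x c where
    S: "\<exists>f\<in>dual_ball - U. f x > c"
    "\<And>f g y. f \<in> dual_ball - U \<Longrightarrow> g \<in> dual_ball - U \<Longrightarrow> f x > c \<Longrightarrow> g x > c \<Longrightarrow> \<bar>f y - g y\<bar> \<le> e * norm y"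
    by (rule asplund_small_slice[OF assms(1) _ _ \<open>e > 0\<close>]) (rule that)
  \<comment> \<open>Enlarging \<open>U\<close> by the open half-space that cuts out the slice
    removes the slice from the representing set. Maximality of \<open>U\<close> then produces an
    \<open>f\<close> without a representative outside \<open>V\<close>.\<close>
  define V where "V = U \<union> {f. f x > c}"
  have "open V" unfolding V_def
    by (intro open_Un U open_Collect_less continuous_on_const continuous_on_eval)
  moreover have "V \<noteq> U" using S(1) by (auto simp: V_def)
  ultimately have "\<not> (\<forall>f\<in>E'. \<exists>g\<in>dual_ball - V. \<forall>y\<in>M. g y = f y)"
    using U(3)[of V] unfolding V_def by blast
  then obtain f where f: "f \<in> E'" "\<forall>g\<in>dual_ball - V. \<exists>y\<in>M. g y \<noteq> f y" by blast
  have "compact (dual_ball - V)"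
    using compact_Int_closed[OF compact_dual_ball, of "- V"] \<open>open V\<close> by (simp add: Diff_eq closed_Compl)
  then have "compact (T ` (dual_ball - V))"
    by (rule compact_continuous_image[OF contT])
  then have op: "open (- T ` (dual_ball - V))" by (simp add: compact_imp_closed open_Compl)
  have "T f \<notin> T ` (dual_ball - V)"
  proof
    assume "T f \<in> T ` (dual_ball - V)"
    then obtain g where g: "T f = T g" "g \<in> dual_ball - V" by (rule imageE)
    then show False using bspec[OF f(2) g(2)] T_eq[OF M, of f g] by auto
  qed
  then have "T f \<in> - T ` (dual_ball - V)" by simp
  from two[OF f(1) op this] obtain a b where ab: "a \<in> E'" "b \<in> E'" "a \<noteq> b"
    "T a \<notin> T ` (dual_ball - V)" "T b \<notin> T ` (dual_ball - V)" by auto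
  obtain a' b' where a': "a' \<in> dual_ball - U" "\<forall>y\<in>M. a' y = a y"
    and b': "b' \<in> dual_ball - U" "\<forall>y\<in>M. b' y = b y"
    using U(2) ab(1,2) by blast
  have "T a' = T a" "T b' = T b" unfolding T_eq[OF M] by (fact a'(2) b'(2))+
  then have "T a' \<notin> T ` (dual_ball - V)" "T b' \<notin> T ` (dual_ball - V)" using ab(4,5) by simp_all
  then have "a' \<notin> dual_ball - V" "b' \<notin> dual_ball - V" by blast+
  then have "a' \<in> V" "b' \<in> V" using a'(1) b'(1) by blast+
  then have close: "\<bar>a' y - b' y\<bar> \<le> e * norm y" for y
    using S(2)[of a' b' y] a'(1) b'(1) unfolding V_def by blast
  obtain y where "y \<in> M" "\<bar>a y - b y\<bar> > e * norm y"
    using far[of a b] ab(1-3) E'(1) by blast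
  then show False using close[of y] bspec[OF a'(2), of y] bspec[OF b'(2), of y] by simp
qed

text \<open>A maximal \<open>e\<close>-separated subset of the dual ball, with separation measured
  on \<open>M\<close>, is countable by \<open>separated_countable\<close> and is an
  \<open>e\<close>-net by maximality. The sequence enumerates the union of such nets for
  \<open>e = 1 / Suc n\<close>; the estimates extend to the closure of \<open>M\<close> by
  continuity.\<close>

lemma dual_ball_separable_on:
  fixes M :: "'a::banach set"
  assumes "asplund_space TYPE('a)" "countable M"
  obtains f :: "nat \<Rightarrow> 'a \<Rightarrow> real" where "\<And>n. f n \<in> dual_ball"
    "\<And>g e. g \<in> dual_ball \<Longrightarrow> e > 0 \<Longrightarrow> \<exists>n. \<forall>y\<in>closure M. \<bar>g y - f n y\<bar> \<le> e * norm y"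
proof -
  define sep where "sep = (\<lambda>e E. E \<subseteq> dual_ball \<and>
    (\<forall>f\<in>E. \<forall>g\<in>E. f \<noteq> g \<longrightarrow> (\<exists>y\<in>M. \<bar>f y - g y\<bar> > e * norm y)))"
  have "\<exists>E. countable E \<and> E \<subseteq> dual_ball \<and> (\<forall>g\<in>dual_ball. \<exists>f\<in>E. \<forall>y\<in>M. \<bar>g y - f y\<bar> \<le> e * norm y)"
    if e: "e > 0" for e
  proof -
    have "\<exists>E\<in>{E. sep e E}. \<forall>F\<in>{E. sep e E}. E \<subseteq> F \<longrightarrow> F = E"
    proof (rule subset_Zorn')
      fix C assume C: "subset.chain {E. sep e E} C"
      then have sep: "\<And>E. E \<in> C \<Longrightarrow> sep e E" unfolding subset_chain_def by blast
      have pair: "\<exists>E\<in>C. f \<in> E \<and> g \<in> E" if fg: "f \<in> \<Union>C" "g \<in> \<Union>C" for f g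
      proof -
        obtain F G where FG: "F \<in> C" "f \<in> F" "G \<in> C" "g \<in> G" using fg by blast
        then have "F \<subseteq> G \<or> G \<subseteq> F" using C unfolding subset_chain_def by blast
        then show ?thesis using FG by blast
      qed
      have "sep e (\<Union>C)"
        unfolding sep_def
      proof (intro conjI ballI impI)
        show "\<Union>C \<subseteq> dual_ball" using sep unfolding sep_def by blast
        fix f g assume "f \<in> \<Union>C" "g \<in> \<Union>C" "f \<noteq> g"
        then obtain E where "E \<in> C" "f \<in> E" "g \<in> E" using pair by blast
        then show "\<exists>y\<in>M. \<bar>f y - g y\<bar> > e * norm y"
          using sep[of E] \<open>f \<noteq> g\<close> unfolding sep_def by blast
      qed
      then show "\<Union>C \<in> {E. sep e E}" by simp
    qed
    then obtain E where E: "sep e E" "\<And>F. sep e F \<Longrightarrow> E \<subseteq> F \<Longrightarrow> F = E" by blast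
    have "countable E"
      using E(1) by (intro separated_countable[OF assms \<open>e > 0\<close>]) (auto simp: sep_def)
    moreover have "\<exists>f\<in>E. \<forall>y\<in>M. \<bar>g y - f y\<bar> \<le> e * norm y" if g: "g \<in> dual_ball" for g
    proof (rule ccontr)
      assume far: "\<not> ?thesis"
      then have far': "\<And>f. f \<in> E \<Longrightarrow> \<exists>y\<in>M. \<bar>g y - f y\<bar> > e * norm y" by (auto simp: not_le)
      then have far'': "\<And>f. f \<in> E \<Longrightarrow> \<exists>y\<in>M. \<bar>f y - g y\<bar> > e * norm y"
        by (simp add: abs_minus_commute)
      have "sep e (insert g E)" using E(1) g far' far'' unfolding sep_def by blast
      then have "g \<in> E" using E(2) by blast
      from far'[OF this] obtain y where "y \<in> M" "e * norm y < 0" by auto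
      with e show False by (simp add: mult_less_0_iff)
    qed
    ultimately show ?thesis using E(1) by (auto simp: sep_def)
  qed
  then have "\<forall>e\<in>{0<..}. \<exists>E. countable E \<and> E \<subseteq> dual_ball \<and>
      (\<forall>g\<in>dual_ball. \<exists>f\<in>E. \<forall>y\<in>M. \<bar>g y - f y\<bar> \<le> e * norm y)" by simp
  from bchoice[OF this] obtain E where "\<forall>e\<in>{0<..}. countable (E e) \<and> E e \<subseteq> dual_ball \<and>
      (\<forall>g\<in>dual_ball. \<exists>f\<in>E e. \<forall>y\<in>M. \<bar>g y - f y\<bar> \<le> e * norm y)" ..
  then have E: "\<And>e. e > 0 \<Longrightarrow> countable (E e)" "\<And>e. e > 0 \<Longrightarrow> E e \<subseteq> dual_ball"
    "\<And>e g. e > 0 \<Longrightarrow> g \<in> dual_ball \<Longrightarrow> \<exists>f\<in>E e. \<forall>y\<in>M. \<bar>g y - f y\<bar> \<le> e * norm y"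
    by simp_all
  define A where "A = (\<Union>n. E (1 / real (Suc n)))"
  have "countable A" unfolding A_def using E(1) by (intro countable_UN) simp_all
  have "A \<subseteq> dual_ball" unfolding A_def using E(2) by (intro UN_least) simp
  note A = \<open>countable A\<close> \<open>A \<subseteq> dual_ball\<close>
  have "(\<lambda>_. 0) \<in> (dual_ball :: ('a \<Rightarrow> real) set)" by (simp add: dual_ball_def linear_iff)
  then have "\<exists>f. f \<in> E (1 / real (Suc 0))" using E(3)[of "1 / real (Suc 0)"] by fastforce
  then have "A \<noteq> {}" unfolding A_def by blast
  show ?thesis
  proof (rule that[of "from_nat_into A"])
    show "from_nat_into A n \<in> dual_ball" for n using A(2) from_nat_into[OF \<open>A \<noteq> {}\<close>] by auto
    fix g :: "'a \<Rightarrow> real" and e :: real assume g: "g \<in> dual_ball" and e: "e > 0"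
    obtain k where k: "1 / real (Suc k) < e" using e by (rule nat_approx_posE)
    obtain f where f: "f \<in> E (1 / real (Suc k))" "\<forall>y\<in>M. \<bar>g y - f y\<bar> \<le> 1 / real (Suc k) * norm y"
      using E(3)[OF _ g, of "1 / real (Suc k)"] by fastforce
    then have "f \<in> A" unfolding A_def by blast
    then obtain n where n: "from_nat_into A n = f" using from_nat_into_surj[OF A(1)] by blast
    have fd: "f \<in> dual_ball" using \<open>f \<in> A\<close> A by auto
    have cont: "continuous_on UNIV h" if "h \<in> dual_ball" for h :: "'a \<Rightarrow> real"
      unfolding continuous_on_iff dist_norm real_norm_def
      using dual_ball_abs_diff_le[OF that] by (meson order_le_less_trans)
    then have "closed {y. \<bar>g y - f y\<bar> \<le> e * norm y}"
      by (intro closed_Collect_le continuous_on_rabs continuous_on_diff continuous_on_mult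
          continuous_on_const continuous_on_norm continuous_on_id cont g fd)
    moreover have "M \<subseteq> {y. \<bar>g y - f y\<bar> \<le> e * norm y}"
    proof
      fix y assume "y \<in> M"
      then have "\<bar>g y - f y\<bar> \<le> 1 / real (Suc k) * norm y" using f by auto
      also have "\<dots> \<le> e * norm y" using k by (intro mult_right_mono) auto
      finally show "y \<in> {y. \<bar>g y - f y\<bar> \<le> e * norm y}" by simp
    qed
    ultimately have "closure M \<subseteq> {y. \<bar>g y - f y\<bar> \<le> e * norm y}" by (rule closure_minimal[rotated])
    then show "\<exists>n. \<forall>y\<in>closure M. \<bar>g y - from_nat_into A n y\<bar> \<le> e * norm y"
      using n by blast
  qed
qed

section \<open>Smooth approximation of the norm\<close>

text \<open>For linear \<open>g\<close> this is the dual norm of the restriction of \<open>g\<close>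
  to \<open>Y\<close>. As a real supremum it is meaningful only for bounded families, hence the
  bound \<open>c\<close> carried by the lemmas below.\<close>

definition seminorm_on :: "'a::real_normed_vector set \<Rightarrow> ('a \<Rightarrow> real) \<Rightarrow> real" where
  "seminorm_on Y g = (SUP y\<in>Y \<inter> cball 0 1. \<bar>g y\<bar>)"

lemma seminorm_on_le:
  assumes "0 \<in> Y" "c \<ge> 0" "\<And>y. y \<in> Y \<Longrightarrow> \<bar>g y\<bar> \<le> c * norm y"
  shows "seminorm_on Y g \<le> c"
  unfolding seminorm_on_def
proof (rule cSUP_least)
  fix y assume y: "y \<in> Y \<inter> cball 0 1"
  then have "\<bar>g y\<bar> \<le> c * norm y" using assms(3) by simp
  also have "\<dots> \<le> c * 1" using y \<open>c \<ge> 0\<close> by (intro mult_left_mono) auto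
  finally show "\<bar>g y\<bar> \<le> c" by simp
qed (use \<open>0 \<in> Y\<close> in auto)

lemma seminorm_on_bdd:
  assumes "\<And>y. y \<in> Y \<Longrightarrow> \<bar>g y\<bar> \<le> c * norm y" "c \<ge> 0"
  shows "bdd_above ((\<lambda>y. \<bar>g y\<bar>) ` (Y \<inter> cball 0 1))"
proof (rule bdd_aboveI[of _ c])
  fix v assume "v \<in> (\<lambda>y. \<bar>g y\<bar>) ` (Y \<inter> cball 0 1)"
  then obtain y where y: "v = \<bar>g y\<bar>" "y \<in> Y" "norm y \<le> 1" by auto
  have "c * norm y \<le> c * 1" using y \<open>c \<ge> 0\<close> by (intro mult_left_mono) auto
  then show "v \<le> c" using assms(1)[OF y(2)] y(1) by simp
qed

lemma abs_le_seminorm_on: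
  assumes Y: "subspace Y" and g: "linear g"
    and c: "\<And>y. y \<in> Y \<Longrightarrow> \<bar>g y\<bar> \<le> c * norm y" "c \<ge> 0" and y: "y \<in> Y"
  shows "\<bar>g y\<bar> \<le> seminorm_on Y g * norm y"
proof (cases "y = 0")
  case True
  then show ?thesis by (simp add: linear_0[OF g])
next
  case False
  have "(1 / norm y) *\<^sub>R y \<in> Y \<inter> cball 0 1"
    using Y y False by (auto intro: subspace_scale)
  then have "\<bar>g ((1 / norm y) *\<^sub>R y)\<bar> \<le> seminorm_on Y g"
    unfolding seminorm_on_def by (rule cSUP_upper[OF _ seminorm_on_bdd[OF c]])
  then show ?thesis
    using False by (simp add: linear_scale[OF g] abs_mult field_simps)
qed

lemma seminorm_on_nonneg:
  assumes "0 \<in> Y" "\<And>y. y \<in> Y \<Longrightarrow> \<bar>g y\<bar> \<le> c * norm y" "c \<ge> 0"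
  shows "seminorm_on Y g \<ge> 0"
proof -
  have "0 \<in> Y \<inter> cball 0 1" using assms(1) by simp
  then have "\<bar>g 0\<bar> \<le> seminorm_on Y g"
    unfolding seminorm_on_def by (rule cSUP_upper[OF _ seminorm_on_bdd[OF assms(2,3)]])
  then show ?thesis by simp
qed

lemma seminorm_on_sequence:
  assumes "0 \<in> Y" "\<And>y. y \<in> Y \<Longrightarrow> \<bar>g y\<bar> \<le> c * norm y" "c \<ge> 0"
  obtains s :: "nat \<Rightarrow> 'a::real_normed_vector" where "\<And>k. s k \<in> Y \<inter> cball 0 1"
    "(\<lambda>k. \<bar>g (s k)\<bar>) \<longlonglongrightarrow> seminorm_on Y g"
proof -
  let ?S = "Y \<inter> cball 0 1"
  have ne: "?S \<noteq> {}" using assms(1) by auto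
  note bdd = seminorm_on_bdd[OF assms(2,3)]
  have "\<forall>k. \<exists>y. y \<in> ?S \<and> seminorm_on Y g - inverse (real (Suc k)) < \<bar>g y\<bar>"
  proof
    fix k
    have "seminorm_on Y g - inverse (real (Suc k)) < (SUP y\<in>?S. \<bar>g y\<bar>)"
      unfolding seminorm_on_def by simp
    then show "\<exists>y. y \<in> ?S \<and> seminorm_on Y g - inverse (real (Suc k)) < \<bar>g y\<bar>"
      using less_cSUP_iff[OF ne bdd, of "seminorm_on Y g - inverse (real (Suc k))"] by blast
  qed
  from choice[OF this] obtain s where
    s: "\<forall>k. s k \<in> ?S \<and> seminorm_on Y g - inverse (real (Suc k)) < \<bar>g (s k)\<bar>" ..
  have "(\<lambda>k. \<bar>g (s k)\<bar>) \<longlonglongrightarrow> seminorm_on Y g"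
  proof (rule tendsto_sandwich)
    show "\<forall>\<^sub>F k in sequentially. seminorm_on Y g - inverse (real (Suc k)) \<le> \<bar>g (s k)\<bar>"
      using s by (simp add: less_imp_le)
    show "\<forall>\<^sub>F k in sequentially. \<bar>g (s k)\<bar> \<le> seminorm_on Y g"
      using s unfolding seminorm_on_def by (auto intro!: always_eventually cSUP_upper[OF _ bdd])
    show "(\<lambda>k. seminorm_on Y g - inverse (real (Suc k))) \<longlonglongrightarrow> seminorm_on Y g"
      using tendsto_diff[OF tendsto_const LIMSEQ_inverse_real_of_nat] by simp
  qed simp
  with s that show ?thesis by blast
qed

text \<open>The condition on superlevel sets is upper semicontinuity. Without a maximum, the open
  sets cut out on \<open>K\<close> by \<open>J F < J G\<close>, for \<open>G\<close> in
  \<open>K\<close>, would cover \<open>K\<close>, and the \<open>G\<close> with the largest value in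
  a finite subcover could not itself be covered.\<close>

lemma compact_attains_sup_usc:
  fixes J :: "'b::topological_space \<Rightarrow> real"
  assumes "compact K" "K \<noteq> {}" "\<And>c. closed {F \<in> K. J F \<ge> c}"
  obtains F where "F \<in> K" "\<And>G. G \<in> K \<Longrightarrow> J G \<le> J F"
proof (rule ccontr)
  assume "\<not> thesis"
  with that have "\<And>F. F \<in> K \<Longrightarrow> \<exists>G\<in>K. J G > J F" by (meson not_le)
  then have cover: "K \<subseteq> (\<Union>G\<in>K. - {F \<in> K. J F \<ge> J G})" by fastforce
  obtain K' where K': "K' \<subseteq> K" "finite K'" "K \<subseteq> (\<Union>G\<in>K'. - {F \<in> K. J F \<ge> J G})"
    by (rule compactE_image[OF \<open>compact K\<close> _ cover]) (use assms(3) in \<open>auto simp: open_Compl\<close>)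
  then have "K' \<noteq> {}" using \<open>K \<noteq> {}\<close> by auto
  define m where "m = Max (J ` K')"
  have "m \<in> J ` K'" unfolding m_def using K' \<open>K' \<noteq> {}\<close> by (intro Max_in) auto
  then obtain F where F: "F \<in> K'" "J F = m" by auto
  have "J G \<le> J F" if "G \<in> K'" for G
    unfolding F(2) m_def using K' that by (intro Max_ge) auto
  moreover obtain G where "G \<in> K'" "\<not> J F \<ge> J G" using K'(1,3) F(1) by blast
  ultimately show False by blast
qed

text \<open>
  The smooth approximation is \<open>\<theta> x = sup {F x - t * Q F}\<close> over the dual ball. The squared distances to
  a dense sequence in the penalty \<open>Q\<close> play the role of a dual locally uniformly rotund norm:
  near maximisers have nearly the same distance to every \<open>f n\<close> as the maximiser has, hence are
  norm close to it.
\<close>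

locale dense_functionals =
  fixes Y :: "'a::banach set" and f :: "nat \<Rightarrow> 'a \<Rightarrow> real" and t :: real
  assumes Y: "subspace Y" and f: "\<And>n. f n \<in> dual_ball" and t: "t > 0"
    and dense: "\<And>g e. g \<in> dual_ball \<Longrightarrow> e > 0 \<Longrightarrow> \<exists>n. \<forall>y\<in>Y. \<bar>g y - f n y\<bar> \<le> e * norm y"
begin

definition a :: "('a \<Rightarrow> real) \<Rightarrow> nat \<Rightarrow> real" where
  "a F n = seminorm_on Y (\<lambda>y. F y - f n y)"

definition Q :: "('a \<Rightarrow> real) \<Rightarrow> real" where
  "Q F = (\<Sum>n. (1/2)^n * (a F n)\<^sup>2)"

definition J :: "'a \<Rightarrow> ('a \<Rightarrow> real) \<Rightarrow> real" where
  "J x F = F x - t * Q F"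

lemma zero_in: "0 \<in> Y" using Y by (rule subspace_0)

lemma diff_bound: "F \<in> dual_ball \<Longrightarrow> \<bar>F y - f n y\<bar> \<le> 2 * norm y"
  using dual_ballD(3)[of F y] dual_ballD(3)[OF f, of n y] by linarith

lemma a_bounds: assumes "F \<in> dual_ball" shows "0 \<le> a F n" "a F n \<le> 2"
  unfolding a_def using diff_bound[OF assms]
  by (auto intro!: seminorm_on_nonneg[OF zero_in, of _ 2] seminorm_on_le[OF zero_in])

lemma a_upper: assumes "F \<in> dual_ball" "y \<in> Y" shows "\<bar>F y - f n y\<bar> \<le> a F n * norm y"
  unfolding a_def
proof (rule abs_le_seminorm_on[OF Y _ diff_bound[OF assms(1)] _ assms(2)])
  show "linear (\<lambda>y. F y - f n y)"
    using assms(1) f[of n] by (auto simp: dual_ball_def intro: linear_compose_sub)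
qed simp

lemma summable_Q: assumes "F \<in> dual_ball" shows "summable (\<lambda>n. (1/2)^n * (a F n)\<^sup>2)"
proof (rule summable_comparison_test')
  show "summable (\<lambda>n. (1/2::real)^n * 4)" by (intro summable_mult2 summable_geometric) simp
  have "(a F n)\<^sup>2 \<le> 2\<^sup>2" for n using a_bounds[OF assms] by (intro power_mono)
  then show "norm ((1/2)^n * (a F n)\<^sup>2) \<le> (1/2)^n * 4" if "n \<ge> 0" for n
    by (simp add: abs_mult mult_left_mono)
qed

lemma Q_bounds: assumes "F \<in> dual_ball" shows "0 \<le> Q F" "Q F \<le> 8"
proof -
  show "0 \<le> Q F" unfolding Q_def by (intro suminf_nonneg summable_Q assms) simp
  have s: "summable (\<lambda>n. (1/2::real)^n * 4)" by (intro summable_mult2 summable_geometric) simp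
  have "(a F n)\<^sup>2 \<le> 2\<^sup>2" for n using a_bounds[OF assms] by (intro power_mono)
  then have "Q F \<le> (\<Sum>n. (1/2::real)^n * 4)"
    unfolding Q_def by (intro suminf_le summable_Q assms s mult_left_mono) auto
  also have "\<dots> = (\<Sum>n. (1/2::real)^n) * 4" by (intro suminf_mult2[symmetric] summable_geometric) simp
  also have "\<dots> = 8" using suminf_geometric[of "1/2::real"] by simp
  finally show "Q F \<le> 8" .
qed

text \<open>The distances \<open>a F n\<close> need not be weak* continuous in \<open>F\<close>, but
  as suprema of continuous functions they are lower semicontinuous, and they enter \<open>J\<close>
  with a minus sign. Concretely, the superlevel set is the intersection, over truncations
  \<open>N\<close> and choices \<open>s\<close> of test points in the unit ball of \<open>Y\<close>,
  of closed conditions on finitely many values of \<open>F\<close>.\<close>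

lemma closed_superlevel: "closed {F \<in> dual_ball. J x F \<ge> c}"
proof -
  let ?P = "\<lambda>N s F. F x - t * (\<Sum>n<N. (1/2)^n * (F (s n) - f n (s n))\<^sup>2)"
  let ?S = "{s. \<forall>n::nat. s n \<in> Y \<inter> cball 0 1}"
  have "{F \<in> dual_ball. J x F \<ge> c} = dual_ball \<inter> (\<Inter>N. \<Inter>s\<in>?S. {F. c \<le> ?P N s F})" (is "?L = ?R")
  proof (intro equalityI subsetI)
    fix F assume "F \<in> ?L"
    then have F: "F \<in> dual_ball" "J x F \<ge> c" by auto
    have "c \<le> ?P N s F" if s: "s \<in> ?S" for N s
    proof -
      have "\<bar>F (s n) - f n (s n)\<bar> \<le> \<bar>a F n\<bar>" for n
      proof -
        have "s n \<in> Y" "norm (s n) \<le> 1" using s by auto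
        then have "\<bar>F (s n) - f n (s n)\<bar> \<le> a F n * norm (s n)" using a_upper[OF F(1)] by blast
        also have "\<dots> \<le> a F n * 1"
          using a_bounds(1)[OF F(1)] \<open>norm (s n) \<le> 1\<close> by (intro mult_left_mono)
        finally show ?thesis by simp
      qed
      then have "(\<Sum>n<N. (1/2)^n * (F (s n) - f n (s n))\<^sup>2) \<le> (\<Sum>n<N. (1/2)^n * (a F n)\<^sup>2)"
        by (intro sum_mono mult_left_mono) (auto simp: abs_le_square_iff)
      also have "\<dots> \<le> Q F" unfolding Q_def by (intro sum_le_suminf summable_Q F) auto
      finally have "t * (\<Sum>n<N. (1/2)^n * (F (s n) - f n (s n))\<^sup>2) \<le> t * Q F"
        using t by (intro mult_left_mono) auto
      then show ?thesis using F(2) unfolding J_def by linarith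
    qed
    then show "F \<in> ?R" using F(1) by blast
  next
    fix F assume "F \<in> ?R"
    then have F: "F \<in> dual_ball" "\<And>N s. s \<in> ?S \<Longrightarrow> c \<le> ?P N s F" by blast+
    have "\<exists>s. (\<forall>k. s k \<in> Y \<inter> cball 0 1) \<and> (\<lambda>k. \<bar>F (s k) - f n (s k)\<bar>) \<longlonglongrightarrow> a F n" for n
    proof -
      obtain s where "\<And>k. s k \<in> Y \<inter> cball 0 1" "(\<lambda>k. \<bar>F (s k) - f n (s k)\<bar>) \<longlonglongrightarrow> seminorm_on Y (\<lambda>y. F y - f n y)"
        by (rule seminorm_on_sequence[OF zero_in diff_bound[OF F(1), of _ n] zero_le_numeral]) (rule that)
      then show ?thesis unfolding a_def by blast
    qed
    from choice[OF allI[OF this]] obtain s where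
      "\<forall>n. (\<forall>k. s n k \<in> Y \<inter> cball 0 1) \<and> (\<lambda>k. \<bar>F (s n k) - f n (s n k)\<bar>) \<longlonglongrightarrow> a F n" ..
    then have s: "\<And>n k. s n k \<in> Y \<inter> cball 0 1"
      "\<And>n. (\<lambda>k. \<bar>F (s n k) - f n (s n k)\<bar>) \<longlonglongrightarrow> a F n" by blast+
    have "c \<le> F x - t * (\<Sum>n<N. (1/2)^n * (a F n)\<^sup>2)" for N
    proof (rule tendsto_lowerbound)
      have "(\<lambda>k. F x - t * (\<Sum>n<N. (1/2)^n * \<bar>F (s n k) - f n (s n k)\<bar>\<^sup>2))
          \<longlonglongrightarrow> F x - t * (\<Sum>n<N. (1/2)^n * (a F n)\<^sup>2)"
        by (intro tendsto_intros s(2))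
      then show "(\<lambda>k. ?P N (\<lambda>n. s n k) F) \<longlonglongrightarrow> F x - t * (\<Sum>n<N. (1/2)^n * (a F n)\<^sup>2)"
        by simp
      have "c \<le> ?P N (\<lambda>n. s n k) F" for k by (rule F(2)) (use s(1) in blast)
      then show "\<forall>\<^sub>F k in sequentially. c \<le> ?P N (\<lambda>n. s n k) F" by (rule always_eventually[OF allI])
    qed simp
    moreover have "(\<lambda>N. F x - t * (\<Sum>n<N. (1/2)^n * (a F n)\<^sup>2)) \<longlonglongrightarrow> J x F"
      unfolding J_def Q_def by (intro tendsto_intros summable_LIMSEQ summable_Q F(1))
    ultimately have "c \<le> J x F" by (intro tendsto_lowerbound[where F = sequentially]) auto
    then show "F \<in> ?L" using F(1) by simp
  qed
  also have "closed \<dots>"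
    by (intro closed_Int closed_INT ballI closed_dual_ball closed_Collect_le
        continuous_on_diff continuous_on_mult continuous_on_sum continuous_on_power
        continuous_on_const continuous_on_eval)
  finally show ?thesis .
qed

lemma maximizer:
  obtains F where "F \<in> dual_ball" "\<And>G. G \<in> dual_ball \<Longrightarrow> J x G \<le> J x F"
  by (rule compact_attains_sup_usc[OF compact_dual_ball, of "J x"]) (use f closed_superlevel in auto)

text \<open>The value is specified as an attained maximum: existence comes from
  \<open>maximizer\<close>, and two maximal values coincide.\<close>

definition \<theta> :: "'a \<Rightarrow> real" where
  "\<theta> x = (THE v. \<exists>F\<in>dual_ball. v = J x F \<and> (\<forall>G\<in>dual_ball. J x G \<le> v))"

lemma theta_eq:
  assumes "F \<in> dual_ball" "\<And>G. G \<in> dual_ball \<Longrightarrow> J x G \<le> J x F"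
  shows "\<theta> x = J x F"
  unfolding \<theta>_def
proof (rule the_equality)
  fix v assume "\<exists>F\<in>dual_ball. v = J x F \<and> (\<forall>G\<in>dual_ball. J x G \<le> v)"
  then obtain G where "G \<in> dual_ball" "v = J x G" "J x F \<le> v" using assms(1) by blast
  then show "v = J x F" using assms(2)[of G] by linarith
qed (use assms in blast)

lemma theta_ge: assumes "G \<in> dual_ball" shows "J x G \<le> \<theta> x"
proof -
  obtain F where "F \<in> dual_ball" "\<And>G. G \<in> dual_ball \<Longrightarrow> J x G \<le> J x F"
    by (rule maximizer[of x]) (rule that)
  then show ?thesis using theta_eq[of F x] assms by simp
qed

lemma J_diff: "F \<in> dual_ball \<Longrightarrow> J z F - J x F = F (z - x)"
  by (simp add: J_def dual_ballD)

lemma theta_lipschitz: "\<bar>\<theta> x - \<theta> y\<bar> \<le> norm (x - y)"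
proof -
  have *: "\<theta> z \<le> \<theta> x + norm (z - x)" for z x
  proof -
    obtain F where F: "F \<in> dual_ball" "\<And>G. G \<in> dual_ball \<Longrightarrow> J z G \<le> J z F"
      by (rule maximizer[of z]) (rule that)
    have "\<theta> z = J x F + F (z - x)" using theta_eq[OF F] J_diff[OF F(1), of z x] by simp
    also have "\<dots> \<le> \<theta> x + norm (z - x)"
      using theta_ge[OF F(1), of x] abs_le_D1[OF dual_ballD(3)[OF F(1)], of "z - x"] by linarith
    finally show ?thesis .
  qed
  from *[of x y] *[of y x] show ?thesis by (simp add: norm_minus_commute abs_le_iff)
qed

lemma theta_le_norm: "\<theta> x \<le> norm x"
proof -
  obtain F where F: "F \<in> dual_ball" "\<And>G. G \<in> dual_ball \<Longrightarrow> J x G \<le> J x F"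
    by (rule maximizer[of x]) (rule that)
  have "t * Q F \<ge> 0" using Q_bounds(1)[OF F(1)] t by simp
  then show ?thesis
    using theta_eq[OF F] abs_le_D1[OF dual_ballD(3)[OF F(1)], of x] by (simp add: J_def)
qed

lemma theta_ge_norm:
  assumes "asplund_space TYPE('a)"
  shows "norm x - 16 * t \<le> \<theta> x"
proof -
  \<comment> \<open>Half of the allowed \<open>16 * t\<close> pays for the inexact norming
    functional, the other half for the penalty, since \<open>Q F \<le> 8\<close>.\<close>
  have "8 * t > 0" using t by simp
  then obtain F where F: "F \<in> dual_ball" "F x \<ge> norm x - 8 * t"
    using norming_functional[OF assms] by metis
  have "t * Q F \<le> t * 8" using Q_bounds(2)[OF F(1)] t by (intro mult_left_mono) auto
  then show ?thesis using theta_ge[OF F(1), of x] F(2) by (simp add: J_def)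
qed

text \<open>Each \<open>a F k\<close> is convex in \<open>F\<close>, and
  \<open>((u + v)/2)^2 = (u^2 + v^2)/2 - (u - v)^2/4\<close> gives a quantitative gain for its
  square. All these gains are nonnegative, so the gain of the single index \<open>n\<close> may be
  kept and the others dropped.\<close>

lemma midpoint:
  assumes "F \<in> dual_ball" "G \<in> dual_ball"
  defines "H \<equiv> \<lambda>y. (F y + G y) / 2"
  shows "H \<in> dual_ball" "Q H \<le> (Q F + Q G) / 2 - (1/2)^n * (a F n - a G n)\<^sup>2 / 4"
proof -
  show H: "H \<in> dual_ball"
    unfolding dual_ball_def
  proof (intro CollectI conjI allI)
    show "linear H" unfolding H_def
      by (rule linearI) (simp_all add: dual_ballD(1,2)[OF assms(1)] dual_ballD(1,2)[OF assms(2)] field_simps)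
    show "\<bar>H y\<bar> \<le> norm y" for y
    proof -
      have "\<bar>F y + G y\<bar> \<le> 2 * norm y"
        using dual_ballD(3)[OF assms(1), of y] dual_ballD(3)[OF assms(2), of y] by linarith
      then show ?thesis by (simp add: H_def)
    qed
  qed
  have aH: "a H k \<le> (a F k + a G k) / 2" for k
    unfolding a_def[of H]
  proof (rule seminorm_on_le[OF zero_in])
    show "0 \<le> (a F k + a G k) / 2" using a_bounds(1) assms(1,2) by simp
    fix y assume y: "y \<in> Y"
    have eq: "(F y - f k y) + (G y - f k y) = 2 * (H y - f k y)" by (simp add: H_def)
    have "2 * \<bar>H y - f k y\<bar> = \<bar>(F y - f k y) + (G y - f k y)\<bar>" unfolding eq abs_mult by simp
    also have "\<dots> \<le> \<bar>F y - f k y\<bar> + \<bar>G y - f k y\<bar>" by (rule abs_triangle_ineq)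
    also have "\<dots> \<le> a F k * norm y + a G k * norm y"
      by (intro add_mono a_upper assms y)
    finally have "2 * \<bar>H y - f k y\<bar> \<le> a F k * norm y + a G k * norm y" .
    then show "\<bar>H y - f k y\<bar> \<le> (a F k + a G k) / 2 * norm y" by (simp add: field_simps)
  qed
  define u where "u k = (1/2)^k * (a F k)\<^sup>2 / 2 + (1/2)^k * (a G k)\<^sup>2 / 2 - (1/2)^k * (a H k)\<^sup>2" for k
  have su: "u sums (Q F / 2 + Q G / 2 - Q H)"
    unfolding u_def Q_def using H assms
    by (intro sums_diff sums_add sums_divide summable_sums summable_Q)
  have lower: "(1/2)^k * (a F k - a G k)\<^sup>2 / 4 \<le> u k" for k
  proof -
    have "(a H k)\<^sup>2 \<le> ((a F k + a G k) / 2)\<^sup>2" using a_bounds(1)[OF H] aH by (intro power_mono)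
    then have "(a F k - a G k)\<^sup>2 / 4 \<le> (a F k)\<^sup>2 / 2 + (a G k)\<^sup>2 / 2 - (a H k)\<^sup>2"
      by (simp add: power2_eq_square field_simps)
    then have "(1/2)^k * ((a F k - a G k)\<^sup>2 / 4) \<le> (1/2)^k * ((a F k)\<^sup>2 / 2 + (a G k)\<^sup>2 / 2 - (a H k)\<^sup>2)"
      by (rule mult_left_mono) simp
    then show ?thesis by (simp add: u_def algebra_simps)
  qed
  have "0 \<le> u k" for k by (rule order_trans[OF _ lower]) simp
  then have "sum u {n} \<le> suminf u" by (intro sum_le_suminf) (use su in \<open>auto simp: sums_iff\<close>)
  then have "u n \<le> Q F / 2 + Q G / 2 - Q H" using su by (simp add: sums_iff)
  then have "Q H \<le> (Q F / 2 + Q G / 2) - u n" by simp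
  also have "\<dots> \<le> (Q F / 2 + Q G / 2) - (1/2)^n * (a F n - a G n)\<^sup>2 / 4"
    by (intro diff_mono order_refl lower)
  finally show "Q H \<le> (Q F + Q G) / 2 - (1/2)^n * (a F n - a G n)\<^sup>2 / 4"
    by (simp only: add_divide_distrib)
qed

text \<open>The midpoint of \<open>F\<close> and \<open>G\<close> cannot beat the maximiser
  \<open>F\<close>, so the convexity gain of \<open>Q\<close> at the midpoint is limited by the
  defect \<open>\<eta>\<close> of \<open>G\<close>.\<close>

lemma near_maximizer:
  assumes F: "F \<in> dual_ball" "\<And>G. G \<in> dual_ball \<Longrightarrow> J x G \<le> J x F"
    and G: "G \<in> dual_ball" "J x F - \<eta> \<le> J x G"
  shows "t * (1/2)^n * (a F n - a G n)\<^sup>2 \<le> 2 * \<eta>"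
proof -
  define H where "H = (\<lambda>y. (F y + G y) / 2)"
  note H = midpoint[OF F(1) G(1), folded H_def]
  define X where "X = (1/2)^n * (a F n - a G n)\<^sup>2"
  have "t * Q H \<le> t * ((Q F + Q G) / 2 - X / 4)"
    using H(2)[of n] t unfolding X_def by (intro mult_left_mono) auto
  then have "J x F + J x G + t * X / 2 \<le> 2 * J x H"
    by (simp add: J_def H_def field_simps)
  moreover have "t * (1/2)^n * (a F n - a G n)\<^sup>2 = t * X" by (simp add: X_def)
  ultimately show ?thesis using F(2)[OF H(1)] G(2) by linarith
qed

text \<open>The derivative at \<open>x\<close> is the maximiser \<open>F\<close> itself. A maximiser
  \<open>G\<close> at a nearby \<open>z\<close> is nearly maximal at \<open>x\<close>, so
  \<open>a G n\<close> is close to \<open>a F n\<close>; taking \<open>f n\<close> close to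
  \<open>F\<close> makes both small and forces \<open>G\<close> close to \<open>F\<close> on
  \<open>Y\<close>. Then \<open>F (z - x) \<le> \<theta> z - \<theta> x \<le> G (z - x)\<close>
  gives differentiability, but only along \<open>Y\<close>, where closeness to the
  \<open>f n\<close> is measured.\<close>

lemma theta_derivative:
  assumes x: "x \<in> Y"
  obtains D where "norm D \<le> 1" "(\<theta> has_derivative blinfun_apply D) (at x within Y)"
proof -
  obtain F where F: "F \<in> dual_ball" "\<And>G. G \<in> dual_ball \<Longrightarrow> J x G \<le> J x F"
    by (rule maximizer[of x]) (rule that)
  obtain D where D: "blinfun_apply D = F" "norm D \<le> 1" using dual_ball_obtain[OF F(1)] .
  have "\<exists>d>0. \<forall>z\<in>Y. norm (z - x) < d \<longrightarrow> \<bar>\<theta> z - \<theta> x - F (z - x)\<bar> \<le> e * norm (z - x)" if e: "e > 0" for e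
  proof -
    obtain n where n: "\<forall>y\<in>Y. \<bar>F y - f n y\<bar> \<le> e/4 * norm y" using dense[OF F(1), of "e/4"] e by auto
    have aF: "a F n \<le> e/4" unfolding a_def by (rule seminorm_on_le[OF zero_in]) (use n e in auto)
    define w where "w = t * (1/2)^n"
    have w: "w > 0" using t by (simp add: w_def)
    \<comment> \<open>The defect of \<open>G\<close> at \<open>x\<close> is at most
      \<open>2 * norm (z - x)\<close>, which \<open>near_maximizer\<close> doubles. Within radius
      \<open>d\<close> the result \<open>4 * norm (z - x)\<close> stays below
      \<open>w * (e/4)^2\<close>.\<close>
    define d where "d = w * (e/4)\<^sup>2 / 4"
    have "d > 0" using w e by (simp add: d_def)
    have "\<bar>\<theta> z - \<theta> x - F (z - x)\<bar> \<le> e * norm (z - x)" if z: "z \<in> Y" "norm (z - x) < d" for z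
    proof -
      obtain G where G: "G \<in> dual_ball" "\<And>H. H \<in> dual_ball \<Longrightarrow> J z H \<le> J z G"
        by (rule maximizer[of z]) (rule that)
      have th: "\<theta> x = J x F" "\<theta> z = J z G" using theta_eq F G by blast+
      have near: "J x F - 2 * norm (z - x) \<le> J x G"
        using G(2)[OF F(1)] J_diff[OF F(1), of z x] J_diff[OF G(1), of z x]
          dual_ballD(3)[OF F(1), of "z - x"] dual_ballD(3)[OF G(1), of "z - x"] by linarith
      have "w * (a F n - a G n)\<^sup>2 \<le> 2 * (2 * norm (z - x))"
        unfolding w_def using near_maximizer[OF F G(1) near] .
      also have "\<dots> \<le> w * (e/4)\<^sup>2" using z(2) by (simp add: d_def)
      finally have "(a F n - a G n)\<^sup>2 \<le> (e/4)\<^sup>2" using w by (simp only: mult_le_cancel_left_pos)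
      then have "\<bar>a F n - a G n\<bar> \<le> e/4" using e by (simp add: abs_le_square_iff[symmetric])
      then have aG: "a G n \<le> e/2" using aF by linarith
      have zx: "z - x \<in> Y" using z(1) x Y by (intro subspace_diff)
      have "\<bar>G (z - x) - f n (z - x)\<bar> \<le> e/2 * norm (z - x)"
        using a_upper[OF G(1) zx, of n] mult_right_mono[OF aG norm_ge_zero, of "z - x"] by linarith
      moreover have "\<bar>F (z - x) - f n (z - x)\<bar> \<le> e/4 * norm (z - x)" using n zx by blast
      moreover have "e * norm (z - x) \<ge> 0" using e by simp
      ultimately have "G (z - x) \<le> F (z - x) + e * norm (z - x)" by linarith
      moreover have "\<theta> z \<le> \<theta> x + G (z - x)"
        using th J_diff[OF G(1), of z x] F(2)[OF G(1)] by linarith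
      moreover have "\<theta> z \<ge> \<theta> x + F (z - x)"
        using th G(2)[OF F(1)] J_diff[OF F(1), of z x] by linarith
      ultimately show ?thesis using \<open>e * norm (z - x) \<ge> 0\<close> by linarith
    qed
    with \<open>d > 0\<close> show ?thesis by blast
  qed
  then have "(\<theta> has_derivative blinfun_apply D) (at x within Y)"
    unfolding has_derivative_within_alt D(1)[symmetric]
    by (simp add: blinfun.bounded_linear_right)
  with D(2) that show ?thesis by blast
qed

end

lemma smooth_norm_approximation:
  fixes M :: "'a::banach set"
  assumes "asplund_space TYPE('a)" "countable M" "subspace (closure M)" "\<tau> > 0"
  obtains \<theta> :: "'a \<Rightarrow> real" where "\<And>x y. \<bar>\<theta> x - \<theta> y\<bar> \<le> norm (x - y)"
    "\<And>x. \<theta> x \<le> norm x" "\<And>x. norm x - \<tau> \<le> \<theta> x"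
    "\<And>x. x \<in> closure M \<Longrightarrow>
      \<exists>D. norm D \<le> 1 \<and> (\<theta> has_derivative blinfun_apply D) (at x within closure M)"
proof -
  obtain f :: "nat \<Rightarrow> 'a \<Rightarrow> real" where f: "\<And>n. f n \<in> dual_ball"
    "\<And>g e. g \<in> dual_ball \<Longrightarrow> e > 0 \<Longrightarrow> \<exists>n. \<forall>y\<in>closure M. \<bar>g y - f n y\<bar> \<le> e * norm y"
    by (rule dual_ball_separable_on[OF assms(1,2)]) (rule that)
  interpret dense_functionals "closure M" f "\<tau> / 16"
    using assms(3,4) f by unfold_locales auto
  show ?thesis
  proof (rule that[of \<theta>])
    show "norm x - \<tau> \<le> \<theta> x" for x using theta_ge_norm[OF assms(1), of x] by simp
    show "\<exists>D. norm D \<le> 1 \<and> (\<theta> has_derivative blinfun_apply D) (at x within closure M)"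
      if "x \<in> closure M" for x using theta_derivative[OF that] by blast
  qed (rule theta_lipschitz theta_le_norm)+
qed

section \<open>A smooth variational principle\<close>

lemma half_power_sum_le: "(\<Sum>j\<le>n. (1/2::real)^j) \<le> 2"
proof -
  have "(\<Sum>j\<le>n. (1/2::real)^j) = (\<Sum>j<Suc n. (1/2::real)^j)" by (simp only: lessThan_Suc_atMost)
  also have "\<dots> \<le> (\<Sum>j. (1/2::real)^j)" by (intro sum_le_suminf summable_geometric) auto
  also have "\<dots> = 2" using suminf_geometric[of "1/2::real"] by simp
  finally show ?thesis .
qed

lemma convergent_of_geometric_steps:
  fixes u :: "nat \<Rightarrow> 'b::banach"
  assumes "\<And>n. norm (u (Suc n) - u n) \<le> K * (1/2)^n"
  shows "convergent u"
proof -
  have "summable (\<lambda>n. u (Suc n) - u n)"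
    by (rule summable_comparison_test'[of "\<lambda>n. K * (1/2)^n" 0])
      (use assms in \<open>auto intro!: summable_mult summable_geometric\<close>)
  then have "convergent (\<lambda>n. \<Sum>i<n. u (Suc i) - u i)"
    by (simp add: summable_iff_convergent)
  then have "convergent (\<lambda>n. u n - u 0)" by (simp only: sum_lessThan_telescope)
  then have "convergent (\<lambda>n. (u n - u 0) + u 0)" by (intro convergent_add convergent_const)
  then show ?thesis by simp
qed

text \<open>A smooth variational principle of Borwein-Preiss type. The bumps \<open>R i\<close> may
  miss the growth and the vanishing at 0 of a norm by \<open>(1/2)^i\<close>; as they carry the
  weight \<open>\<mu> * (1/2)^i\<close>, this error is of the same order \<open>(1/4)^i\<close> as
  the tolerance with which successive near-minimisers are chosen. Consecutive points then move by
  geometric steps, and the limit minimises the fully perturbed function exactly. Norm-like bumps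
  give \<open>ekeland\<close>; smooth ones give a minimiser at which derivatives can be
  compared.\<close>

lemma variational_principle:
  fixes S :: "'b::banach set" and f :: "'b \<Rightarrow> real" and R :: "nat \<Rightarrow> 'b \<Rightarrow> real"
  assumes S: "closed S" "v0 \<in> S" and f: "continuous_on S f" "\<And>v. v \<in> S \<Longrightarrow> m \<le> f v"
    and pos: "c > 0" "\<mu> > 0" "L \<ge> 0"
    and lip: "\<And>i u v. \<bar>R i u - R i v\<bar> \<le> L * norm (u - v)"
    and lower: "\<And>i u. c * norm u - (1/2)^i \<le> R i u"
    and zero: "\<And>i. R i 0 \<le> (1/2)^i"
  obtains w vh K where "w 0 = v0" "\<And>n. w n \<in> S" "\<And>n. norm (w n) \<le> K" "vh \<in> S"
    "\<And>v. summable (\<lambda>i. \<mu> * (1/2)^i * R i (v - w i))"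
    "\<And>v. v \<in> S \<Longrightarrow> f vh + (\<Sum>i. \<mu> * (1/2)^i * R i (vh - w i))
      \<le> f v + (\<Sum>i. \<mu> * (1/2)^i * R i (v - w i))"
proof -
  \<comment> \<open>The state of the construction is a pair of the current centre and the current
    perturbed function. \<open>T\<close> lets the next centre almost minimise the current function
    and then adds a bump at that centre. The first centre is \<open>v0\<close>, which need not be
    almost minimal, so \<open>step\<close> compares the centres only from the second one on.\<close>
  define P where "P n wg \<longleftrightarrow> fst wg \<in> S \<and> (\<exists>b. \<forall>v\<in>S. b \<le> snd wg v) \<and>
    (n = 0 \<longrightarrow> wg = (v0, \<lambda>v. f v + \<mu> * R 0 (v - v0)))" for n :: nat and wg :: "'b \<times> ('b \<Rightarrow> real)"
  define T where "T n wg wg' \<longleftrightarrow> (\<forall>v\<in>S. snd wg (fst wg') \<le> snd wg v + \<mu> * (1/4)^n) \<and>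
    snd wg' = (\<lambda>v. snd wg v + \<mu> * (1/2)^(Suc n) * R (Suc n) (v - fst wg'))"
    for n :: nat and wg wg' :: "'b \<times> ('b \<Rightarrow> real)"
  have Rge: "- 1 \<le> R i u" for i u
  proof -
    have "(1/2::real)^i \<le> 1" by (simp add: power_le_one)
    moreover have "0 \<le> c * norm u" using pos by simp
    ultimately show ?thesis using lower[of u i] by linarith
  qed
  have "\<exists>wg. P 0 wg"
  proof -
    have "m - \<mu> \<le> f v + \<mu> * R 0 (v - v0)" if "v \<in> S" for v
      using f(2)[OF that] mult_left_mono[OF Rge[of 0 "v - v0"], of \<mu>] pos by simp
    then show ?thesis unfolding P_def using S(2) by (intro exI[of _ "(v0, \<lambda>v. f v + \<mu> * R 0 (v - v0))"]) auto
  qed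
  moreover have "\<exists>wg'. P (Suc n) wg' \<and> T n wg wg'" if P: "P n wg" for wg n
  proof -
    obtain b where b: "\<forall>v\<in>S. b \<le> snd wg v" using P unfolding P_def by blast
    have ne: "S \<noteq> {}" using S(2) by blast
    have bdd: "bdd_below (snd wg ` S)" using b by (intro bdd_belowI[of _ b]) auto
    have "(INF v\<in>S. snd wg v) < (INF v\<in>S. snd wg v) + \<mu> * (1/4)^n" using pos by simp
    then obtain w' where w': "w' \<in> S" "snd wg w' < (INF v\<in>S. snd wg v) + \<mu> * (1/4)^n"
      using cINF_less_iff[OF ne bdd] by blast
    have 1: "snd wg w' \<le> snd wg v + \<mu> * (1/4)^n" if "v \<in> S" for v
      using w'(2) cINF_lower[OF bdd that] by linarith
    have 2: "b - \<mu> * (1/2)^(Suc n) \<le> snd wg v + \<mu> * (1/2)^(Suc n) * R (Suc n) (v - w')" if "v \<in> S" for v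
    proof -
      have "\<mu> * (1/2)^(Suc n) * (- 1) \<le> \<mu> * (1/2)^(Suc n) * R (Suc n) (v - w')"
        using pos by (intro mult_left_mono Rge) auto
      moreover have "b \<le> snd wg v" using b that by blast
      ultimately show ?thesis by linarith
    qed
    show ?thesis
    proof (intro exI conjI)
      show "P (Suc n) (w', \<lambda>v. snd wg v + \<mu> * (1/2)^(Suc n) * R (Suc n) (v - w'))"
        unfolding P_def fst_conv snd_conv using w'(1) 2 by blast
      show "T n wg (w', \<lambda>v. snd wg v + \<mu> * (1/2)^(Suc n) * R (Suc n) (v - w'))"
        unfolding T_def fst_conv snd_conv using 1 by blast
    qed
  qed
  ultimately have "\<exists>h. \<forall>n. P n (h n) \<and> T n (h n) (h (Suc n))" by (rule dependent_nat_choice)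
  then obtain h where h: "\<And>n. P n (h n)" "\<And>n. T n (h n) (h (Suc n))" by blast
  define w where "w n = fst (h n)" for n
  define g where "g n = snd (h n)" for n
  have w0: "w 0 = v0" and g0: "g 0 = (\<lambda>v. f v + \<mu> * R 0 (v - v0))"
    using h(1)[of 0] by (auto simp: P_def w_def g_def)
  have wS: "w n \<in> S" for n using h(1)[of n] by (simp add: P_def w_def)
  have gSuc: "g (Suc n) v = g n v + \<mu> * (1/2)^(Suc n) * R (Suc n) (v - w (Suc n))" for n v
    using h(2)[of n] by (simp add: T_def w_def g_def)
  have near: "g n (w (Suc n)) \<le> g n v + \<mu> * (1/4)^n" if "v \<in> S" for n v
    using h(2)[of n] that by (simp add: T_def w_def g_def)
  have g_eq: "g n v = f v + (\<Sum>j\<le>n. \<mu> * (1/2)^j * R j (v - w j))" for n v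
    by (induction n) (simp_all add: g0 w0 gSuc)
  \<comment> \<open>\<open>w (Suc (Suc n))\<close> almost minimises \<open>g (Suc n)\<close> and
    \<open>w (Suc n)\<close> almost minimises \<open>g n\<close>. The two functions differ by the
    bump at \<open>w (Suc n)\<close>, whose growth is therefore bounded by the two tolerances and
    the errors of the bump.\<close>
  have step: "norm (w (Suc (Suc n)) - w (Suc n)) \<le> 4 / c * (1/2)^n" for n
  proof -
    let ?d = "w (Suc (Suc n)) - w (Suc n)"
    define p where "p = (1/2::real)^n"
    have p: "p > 0" "(1/2::real)^(Suc n) = p/2" "(1/4::real)^n = p * p" "(1/4::real)^(Suc n) = p * p / 4"
      unfolding p_def by (simp_all flip: power_mult_distrib)
    have "g n (w (Suc (Suc n))) + \<mu> * (p/2) * R (Suc n) ?d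
        \<le> g n (w (Suc n)) + \<mu> * (p/2) * R (Suc n) 0 + \<mu> * (p * p / 4)"
      using near[OF wS[of "Suc n"], of "Suc n"] unfolding gSuc p by simp
    moreover have "g n (w (Suc n)) \<le> g n (w (Suc (Suc n))) + \<mu> * (p * p)"
      using near[OF wS[of "Suc (Suc n)"], of n] unfolding p .
    moreover have "\<mu> * (p/2) * R (Suc n) 0 \<le> \<mu> * (p/2) * (p/2)"
      using zero[of "Suc n"] pos p unfolding p by (intro mult_left_mono) auto
    moreover have "\<mu> * (p/2) * (c * norm ?d - p/2) \<le> \<mu> * (p/2) * R (Suc n) ?d"
      using lower[of ?d "Suc n"] pos p unfolding p by (intro mult_left_mono) auto
    ultimately have "\<mu> * (p/2) * (c * norm ?d - p/2) \<le> \<mu> * (p/2) * (p/2) + \<mu> * (p * p / 4) + \<mu> * (p * p)"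
      by linarith
    also have "\<dots> = \<mu> * (p/2) * (3 * p)" by (simp add: field_simps)
    finally have "c * norm ?d - p/2 \<le> 3 * p" using pos p by (simp only: mult_le_cancel_left_pos mult_pos_pos half_gt_zero)
    then have "c * norm ?d \<le> 4 * p" using p by linarith
    then show ?thesis using pos by (simp add: p_def field_simps)
  qed
  have "convergent (\<lambda>n. w (Suc n))" by (rule convergent_of_geometric_steps[OF step])
  then obtain vh where "(\<lambda>n. w (Suc n)) \<longlonglongrightarrow> vh" unfolding convergent_def by blast
  note lim = this
  have vh: "vh \<in> S" by (rule closed_sequentially[OF S(1) _ lim]) (rule wS)
  have "w \<longlonglongrightarrow> vh" using lim by (rule LIMSEQ_imp_Suc)
  then have "Bseq w" by (rule convergent_imp_Bseq[OF convergentI])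
  then obtain B where B: "\<And>n. norm (w n) \<le> B" unfolding Bseq_def by blast
  have R0: "\<bar>R j 0\<bar> \<le> 1" for j
    using zero[of j] Rge[of j 0] power_le_one[of "1/2::real" j] by simp
  have summable: "summable (\<lambda>i. \<mu> * (1/2)^i * R i (v - w i))" for v
  proof (rule summable_comparison_test'[of "\<lambda>i. \<mu> * (1/2)^i * (1 + L * (norm v + B))" 0])
    show "summable (\<lambda>i. \<mu> * (1/2)^i * (1 + L * (norm v + B)))"
      by (intro summable_mult2 summable_mult summable_geometric) simp
    fix i
    have "norm (v - w i) \<le> norm v + B" using norm_triangle_ineq4[of v "w i"] B[of i] by linarith
    then have "L * norm (v - w i) \<le> L * (norm v + B)" using pos by (intro mult_left_mono)
    then have "\<bar>R i (v - w i)\<bar> \<le> 1 + L * (norm v + B)"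
      using lip[of i "v - w i" 0] R0[of i] by simp
    then show "norm (\<mu> * (1/2)^i * R i (v - w i)) \<le> \<mu> * (1/2)^i * (1 + L * (norm v + B))"
      using pos by (simp add: abs_mult mult_left_mono)
  qed
  have glim: "(\<lambda>n. g n v) \<longlonglongrightarrow> f v + (\<Sum>i. \<mu> * (1/2)^i * R i (v - w i))" for v
    unfolding g_eq by (intro tendsto_add tendsto_const summable_LIMSEQ' summable)
  have cont: "(\<lambda>n. f (w (Suc n))) \<longlonglongrightarrow> f vh"
    by (rule continuous_on_tendsto_compose[OF f(1) lim vh]) (simp add: wS)
  \<comment> \<open>Near-minimality is known at \<open>w (Suc n)\<close> but needed at the limit
    \<open>vh\<close>. The partial perturbations share the Lipschitz constant
    \<open>2 * \<mu> * L\<close>, so the exchange costs an error that vanishes as \<open>n\<close>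
    grows.\<close>
  have gdiff: "g n vh \<le> g n (w (Suc n)) + (f vh - f (w (Suc n))) + 2 * \<mu> * L * norm (vh - w (Suc n))" for n
  proof -
    let ?d = "norm (vh - w (Suc n))"
    have "\<mu> * (1/2)^j * R j (vh - w j) - \<mu> * (1/2)^j * R j (w (Suc n) - w j) \<le> (1/2)^j * (\<mu> * (L * ?d))" for j
    proof -
      have "R j (vh - w j) - R j (w (Suc n) - w j) \<le> L * ?d"
        using lip[of j "vh - w j" "w (Suc n) - w j"] by simp
      then have "\<mu> * (1/2)^j * (R j (vh - w j) - R j (w (Suc n) - w j)) \<le> \<mu> * (1/2)^j * (L * ?d)"
        using pos by (intro mult_left_mono) auto
      then show ?thesis by (simp add: algebra_simps)
    qed
    then have "(\<Sum>j\<le>n. \<mu> * (1/2)^j * R j (vh - w j) - \<mu> * (1/2)^j * R j (w (Suc n) - w j))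
        \<le> (\<Sum>j\<le>n. (1/2)^j * (\<mu> * (L * ?d)))" by (rule sum_mono)
    also have "\<dots> = (\<Sum>j\<le>n. (1/2)^j) * (\<mu> * (L * ?d))" by (rule sum_distrib_right[symmetric])
    also have "\<dots> \<le> 2 * (\<mu> * (L * ?d))" using pos by (intro mult_right_mono half_power_sum_le) auto
    finally show ?thesis unfolding g_eq sum_subtractf by (simp add: mult.assoc)
  qed
  show ?thesis
  proof (rule that[OF w0 wS B vh summable])
    fix v assume v: "v \<in> S"
    have up: "(\<lambda>n. g n v + \<mu> * (1/4)^n + (f vh - f (w (Suc n))) + 2 * \<mu> * L * norm (vh - w (Suc n)))
      \<longlonglongrightarrow> (f v + (\<Sum>i. \<mu> * (1/2)^i * R i (v - w i))) + \<mu> * 0 + (f vh - f vh) + 2 * \<mu> * L * norm (vh - vh)"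
      by (intro tendsto_intros glim cont lim) simp
    have "g n vh \<le> g n v + \<mu> * (1/4)^n + (f vh - f (w (Suc n))) + 2 * \<mu> * L * norm (vh - w (Suc n))" for n
      using gdiff[of n] near[OF v, of n] by linarith
    then show "f vh + (\<Sum>i. \<mu> * (1/2)^i * R i (vh - w i)) \<le> f v + (\<Sum>i. \<mu> * (1/2)^i * R i (v - w i))"
      using LIMSEQ_le[OF glim up] by simp
  qed
qed

section \<open>Separable reduction\<close>

text \<open>One preimage is chosen for each member of a countable base; for base sets that the map
  misses the choice is arbitrary and harmless.\<close>

lemma countable_approximation:
  fixes \<tau> :: "'b \<Rightarrow> 'c::second_countable_topology"
  obtains D where "countable D" "\<And>v W. open W \<Longrightarrow> \<tau> v \<in> W \<Longrightarrow> \<exists>u\<in>D. \<tau> u \<in> W"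
proof -
  obtain \<B> :: "'c set set" where \<B>: "countable \<B>" "\<And>C. C \<in> \<B> \<Longrightarrow> open C"
    "\<And>S. open S \<Longrightarrow> \<exists>U. U \<subseteq> \<B> \<and> S = \<Union>U"
    using univ_second_countable by blast
  define D where "D = (\<lambda>C. SOME v. \<tau> v \<in> C) ` \<B>"
  show ?thesis
  proof (rule that[of D])
    show "countable D" using \<B>(1) by (simp add: D_def)
    fix v W assume W: "open W" "\<tau> v \<in> W"
    obtain U where "U \<subseteq> \<B>" "W = \<Union>U" using \<B>(3)[OF W(1)] by blast
    then obtain C where C: "C \<in> \<B>" "\<tau> v \<in> C" "C \<subseteq> W" using W(2) by blast
    have "\<tau> (SOME v. \<tau> v \<in> C) \<in> C" using C(2) by (rule someI)
    then show "\<exists>u\<in>D. \<tau> u \<in> W" using C by (auto simp: D_def)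
  qed
qed

text \<open>One step of a Loewenheim-Skolem closing-off. The combinations
  \<open>u i + u j - u l\<close> carry the linear information: with \<open>i = j = l\<close> they
  give the norms, and where \<open>v l = v i + v j\<close> they say that the copies are nearly
  additive.\<close>

lemma reflecting_step:
  fixes A B M :: "'a::real_normed_vector set"
  assumes "countable M"
  shows "\<exists>M'. countable M' \<and> M \<subseteq> M' \<and> (\<forall>x\<in>M. \<forall>y\<in>M. x + y \<in> M') \<and>
    (\<forall>q\<in>\<rat>. \<forall>x\<in>M. q *\<^sub>R x \<in> M') \<and>
    (\<forall>(v::nat \<Rightarrow> 'a) N F \<eta>. finite F \<and> F \<subseteq> M \<and> \<eta> > 0 \<longrightarrow>
      (\<exists>u. (\<forall>i. u i \<in> M') \<and> (\<forall>i<N. (u i \<in> A \<longleftrightarrow> v i \<in> A) \<and> (u i \<in> B \<longleftrightarrow> v i \<in> B) \<and>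
        (\<forall>m\<in>F. \<bar>norm (u i - m) - norm (v i - m)\<bar> < \<eta>) \<and>
        (\<forall>j<N. \<forall>l<N. \<bar>norm (u i + u j - u l) - norm (v i + v j - v l)\<bar> < \<eta>))))"
proof -
  define e where "e = from_nat_into M"
  \<comment> \<open>\<open>\<tau> v\<close> codes the norms and memberships to be copied as a point of a second countable space,
    so countably many sequences approximate all sequences.\<close>
  define \<tau> where "\<tau> = (\<lambda>(v::nat \<Rightarrow> 'a) (c::nat, i::nat, j::nat, l::nat).
    if c = 0 then norm (v i + v j - v l) else if c = 1 then norm (v i - e j)
    else if c = 2 then (if v i \<in> A then 1 else 0) else (if v i \<in> B then 1 else 0 :: real))"
  obtain D where D: "countable D" "\<And>v W. open W \<Longrightarrow> \<tau> v \<in> W \<Longrightarrow> \<exists>u\<in>D. \<tau> u \<in> W"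
    by (rule countable_approximation[of \<tau>]) (rule that)
  define M' where "M' = M \<union> (\<Union>u\<in>D. range u) \<union> (\<lambda>(x, y). x + y) ` (M \<times> M) \<union>
    (\<lambda>(q, x). q *\<^sub>R x) ` (\<rat> \<times> M)"
  show ?thesis
  proof (intro exI[of _ M'] conjI allI impI)
    show "countable M'" unfolding M'_def using assms D(1)
      by (intro countable_Un countable_UN countable_image countable_SIGMA countable_rat) auto
    show "M \<subseteq> M'" by (auto simp: M'_def)
    show "\<forall>x\<in>M. \<forall>y\<in>M. x + y \<in> M'" by (auto simp: M'_def)
    show "\<forall>q\<in>\<rat>. \<forall>x\<in>M. q *\<^sub>R x \<in> M'" by (auto simp: M'_def)
    fix v :: "nat \<Rightarrow> 'a" and N :: nat and F and \<eta> :: real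
    assume F: "finite F \<and> F \<subseteq> M \<and> \<eta> > 0"
    have "F \<subseteq> range e"
    proof
      fix x assume "x \<in> F"
      then have "x \<in> M" using F by blast
      then obtain k where "from_nat_into M k = x" using from_nat_into_surj[OF assms] by blast
      then show "x \<in> range e" unfolding e_def by blast
    qed
    then obtain K where K: "finite K" "F = e ` K" using F finite_subset_image[of F e UNIV] by blast
    \<comment> \<open>The first entry selects the kind of quantity as in \<open>\<tau>\<close>.
      \<open>K\<close> holds the positions of \<open>F\<close> in the enumeration of
      \<open>M\<close>, and \<open>0\<close> fills the slot that most kinds ignore.\<close>
    define T where "T = {0, 1, 2, 3::nat} \<times> {..<N} \<times> ({..<N} \<union> K) \<times> ({..<N} \<union> {0})"
    have "finite T" unfolding T_def using K by simp
    \<comment> \<open>Membership is coded by 0 and 1, so a strict tolerance of at most 1 forces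
      equality.\<close>
    define \<epsilon> where "\<epsilon> = min \<eta> 1"
    have \<epsilon>: "\<epsilon> > 0" "\<epsilon> \<le> \<eta>" "\<epsilon> \<le> 1" using F by (auto simp: \<epsilon>_def)
    define W where "W = (\<Inter>t\<in>T. {g. \<bar>g t - \<tau> v t\<bar> < \<epsilon>})"
    have "open W" unfolding W_def
      by (intro open_INT \<open>finite T\<close> ballI open_Collect_less continuous_on_rabs continuous_on_diff
          continuous_on_const continuous_on_eval)
    moreover have "\<tau> v \<in> W" using \<epsilon> by (simp add: W_def)
    ultimately obtain u where u: "u \<in> D" "\<tau> u \<in> W" using D(2) by blast
    then have close: "\<bar>\<tau> u t - \<tau> v t\<bar> < \<epsilon>" if "t \<in> T" for t using that by (auto simp: W_def)
    show "\<exists>u. (\<forall>i. u i \<in> M') \<and> (\<forall>i<N. (u i \<in> A \<longleftrightarrow> v i \<in> A) \<and> (u i \<in> B \<longleftrightarrow> v i \<in> B) \<and>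
        (\<forall>m\<in>F. \<bar>norm (u i - m) - norm (v i - m)\<bar> < \<eta>) \<and>
        (\<forall>j<N. \<forall>l<N. \<bar>norm (u i + u j - u l) - norm (v i + v j - v l)\<bar> < \<eta>))"
    proof (intro exI[of _ u] conjI allI impI ballI)
      show "u i \<in> M'" for i using u(1) by (auto simp: M'_def)
      fix i assume i: "i < N"
      show "u i \<in> A \<longleftrightarrow> v i \<in> A"
        using close[of "(2, i, i, 0)"] i \<epsilon> by (auto simp: T_def \<tau>_def split: if_splits)
      show "u i \<in> B \<longleftrightarrow> v i \<in> B"
        using close[of "(3, i, i, 0)"] i \<epsilon> by (auto simp: T_def \<tau>_def split: if_splits)
      show "\<bar>norm (u i - m) - norm (v i - m)\<bar> < \<eta>" if m: "m \<in> F" for m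
      proof -
        obtain k where "k \<in> K" "m = e k" using m K(2) by blast
        then show ?thesis using close[of "(1, i, k, 0)"] i \<epsilon> by (simp add: T_def \<tau>_def)
      qed
      show "\<bar>norm (u i + u j - u l) - norm (v i + v j - v l)\<bar> < \<eta>" if "j < N" "l < N" for j l
        using close[of "(0, i, j, l)"] i that \<epsilon> by (simp add: T_def \<tau>_def)
    qed
  qed
qed

lemma subspace_closure_rational:
  fixes M :: "'a::real_normed_vector set"
  assumes "0 \<in> M" "\<And>x y. x \<in> M \<Longrightarrow> y \<in> M \<Longrightarrow> x + y \<in> M"
    "\<And>q x. q \<in> \<rat> \<Longrightarrow> x \<in> M \<Longrightarrow> q *\<^sub>R x \<in> M"
  shows "subspace (closure M)"
  unfolding subspace_def
proof (intro conjI ballI allI)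
  show "0 \<in> closure M" using assms(1) closure_subset by blast
  show "x + y \<in> closure M" if "x \<in> closure M" "y \<in> closure M" for x y
  proof -
    have "(\<lambda>(x, y). x + y) ` closure (M \<times> M) \<subseteq> closure M"
      by (rule image_closure_subset)
        (use subsetD[OF closure_subset assms(2)] in \<open>auto simp: split_def intro!: continuous_intros\<close>)
    moreover have "(x, y) \<in> closure (M \<times> M)" using that by (simp add: closure_Times)
    ultimately show ?thesis by fast
  qed
  show "c *\<^sub>R x \<in> closure M" if "x \<in> closure M" for c x
  proof -
    have "(\<lambda>(q, x). q *\<^sub>R x) ` closure (\<rat> \<times> M) \<subseteq> closure M"
      by (rule image_closure_subset)
        (use subsetD[OF closure_subset assms(3)] in \<open>auto simp: split_def intro!: continuous_intros\<close>)
    moreover have "(c, x) \<in> closure (\<rat> \<times> M)"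
      using that by (simp add: closure_Times Rats_closure_real)
    ultimately show ?thesis by fast
  qed
qed

text \<open>Repeating the closing-off step countably often gives a set closed under it: a finite
  \<open>F\<close> already lies in some stage, and the copies appear in the next. The union is
  closed under sums and rational multiples, so its closure is a subspace.\<close>

lemma reflecting_set:
  fixes A B S :: "'a::real_normed_vector set"
  assumes "countable S"
  obtains M where "countable M" "S \<subseteq> M" "subspace (closure M)"
    "\<And>V F \<eta>. finite V \<Longrightarrow> finite F \<Longrightarrow> F \<subseteq> M \<Longrightarrow> \<eta> > 0 \<Longrightarrow>
      \<exists>\<phi>. \<forall>x\<in>V. \<phi> x \<in> M \<and> (\<phi> x \<in> A \<longleftrightarrow> x \<in> A) \<and> (\<phi> x \<in> B \<longleftrightarrow> x \<in> B) \<and>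
        (\<forall>m\<in>F. \<bar>norm (\<phi> x - m) - norm (x - m)\<bar> < \<eta>) \<and>
        (\<forall>y\<in>V. \<forall>z\<in>V. \<bar>norm (\<phi> x + \<phi> y - \<phi> z) - norm (x + y - z)\<bar> < \<eta>)"
proof -
  define step where "step M M' \<longleftrightarrow> M \<subseteq> M' \<and> (\<forall>x\<in>M. \<forall>y\<in>M. x + y \<in> M') \<and>
    (\<forall>q\<in>\<rat>. \<forall>x\<in>M. q *\<^sub>R x \<in> M') \<and>
    (\<forall>(v::nat \<Rightarrow> 'a) N F \<eta>. finite F \<and> F \<subseteq> M \<and> \<eta> > 0 \<longrightarrow>
      (\<exists>u. (\<forall>i. u i \<in> M') \<and> (\<forall>i<N. (u i \<in> A \<longleftrightarrow> v i \<in> A) \<and> (u i \<in> B \<longleftrightarrow> v i \<in> B) \<and>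
        (\<forall>m\<in>F. \<bar>norm (u i - m) - norm (v i - m)\<bar> < \<eta>) \<and>
        (\<forall>j<N. \<forall>l<N. \<bar>norm (u i + u j - u l) - norm (v i + v j - v l)\<bar> < \<eta>))))" for M M'
  have "\<exists>h. \<forall>n. (countable (h n) \<and> (n = 0 \<longrightarrow> h n = insert 0 S)) \<and> step (h n) (h (Suc n))"
  proof (rule dependent_nat_choice[of "\<lambda>n x. countable x \<and> (n = 0 \<longrightarrow> x = insert 0 S)" "\<lambda>n. step"])
    show "\<exists>x. countable x \<and> (0 = (0::nat) \<longrightarrow> x = insert 0 S)" using assms by simp
    fix x and n :: nat assume "countable x \<and> (n = 0 \<longrightarrow> x = insert 0 S)"
    then have "countable x" by blast
    from reflecting_step[OF this, of A B, folded step_def] obtain y where y: "countable y \<and> step x y" ..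
    show "\<exists>y. (countable y \<and> (Suc n = 0 \<longrightarrow> y = insert 0 S)) \<and> step x y"
      by (rule exI[of _ y]) (simp add: y)
  qed
  then obtain h where "\<forall>n. (countable (h n) \<and> (n = 0 \<longrightarrow> h n = insert 0 S)) \<and> step (h n) (h (Suc n))" ..
  then have hn: "(countable (h n) \<and> (n = 0 \<longrightarrow> h n = insert 0 S)) \<and> step (h n) (h (Suc n))" for n
    by (rule spec)
  have h: "\<And>n. countable (h n)" "h 0 = insert 0 S" "\<And>n. step (h n) (h (Suc n))"
    by (rule hn[THEN conjunct1, THEN conjunct1] hn[THEN conjunct1, THEN conjunct2, THEN mp, OF refl]
        hn[THEN conjunct2])+
  have "h n \<subseteq> h (Suc n)" for n
    by (rule h(3)[of n, unfolded step_def, THEN conjunct1])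
  then have mono: "h n \<subseteq> h m" if "n \<le> m" for n m using that by (rule lift_Suc_mono_le)
  define M where "M = (\<Union>n. h n)"
  have "x + y \<in> M" if xy: "x \<in> M" "y \<in> M" for x y
  proof -
    obtain i j where "x \<in> h i" "y \<in> h j" using xy unfolding M_def by blast
    then have "x \<in> h (max i j)" "y \<in> h (max i j)"
      using mono[of i "max i j"] mono[of j "max i j"] by auto
    then have "x + y \<in> h (Suc (max i j))" using h(3)[of "max i j", unfolded step_def, THEN conjunct2, THEN conjunct1] by blast
    then show ?thesis unfolding M_def by blast
  qed
  moreover have "q *\<^sub>R x \<in> M" if qx: "q \<in> \<rat>" "x \<in> M" for q x
  proof -
    obtain i where "x \<in> h i" using qx unfolding M_def by blast
    then have "q *\<^sub>R x \<in> h (Suc i)" using h(3)[of i, unfolded step_def, THEN conjunct2, THEN conjunct2, THEN conjunct1] qx(1) by blast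
    then show ?thesis unfolding M_def by blast
  qed
  moreover have "0 \<in> h 0" "S \<subseteq> h 0" using h(2) by auto
  then have "0 \<in> M" "S \<subseteq> M" unfolding M_def by blast+
  ultimately have "subspace (closure M)" by (intro subspace_closure_rational)
  show ?thesis
  proof (rule that[of M])
    show "countable M" unfolding M_def using h(1) by (intro countable_UN) auto
    show "S \<subseteq> M" "subspace (closure M)" by fact+
    fix V F :: "'a set" and \<eta> :: real
    assume V: "finite V" and F: "finite F" "F \<subseteq> M" and \<eta>: "\<eta> > 0"
    have "\<exists>n. F \<subseteq> h n" using F
    proof (induction F rule: finite_induct)
      case (insert x F)
      then obtain n k where "F \<subseteq> h n" "x \<in> h k" unfolding M_def by blast
      then have "insert x F \<subseteq> h (max n k)" using mono[of n "max n k"] mono[of k "max n k"] by auto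
      then show ?case by blast
    qed simp
    then obtain n where n: "F \<subseteq> h n" by blast
    obtain N and v :: "nat \<Rightarrow> 'a" where v: "V = v ` {i. i < N}" "inj_on v {i. i < N}"
      using finite_imp_nat_seg_image_inj_on[OF V] by blast
    note reflect = h(3)[of n, unfolded step_def, THEN conjunct2, THEN conjunct2, THEN conjunct2,
        THEN spec[of _ v], THEN spec[of _ N], THEN spec[of _ F], THEN spec[of _ \<eta>], THEN mp]
    have "finite F \<and> F \<subseteq> h n \<and> \<eta> > 0" using F(1) n \<eta> by blast
    from reflect[OF this] obtain u where "(\<forall>i. u i \<in> h (Suc n)) \<and> (\<forall>i<N. (u i \<in> A \<longleftrightarrow> v i \<in> A) \<and> (u i \<in> B \<longleftrightarrow> v i \<in> B) \<and>
        (\<forall>m\<in>F. \<bar>norm (u i - m) - norm (v i - m)\<bar> < \<eta>) \<and>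
        (\<forall>j<N. \<forall>l<N. \<bar>norm (u i + u j - u l) - norm (v i + v j - v l)\<bar> < \<eta>))" ..
    then have u: "\<And>i. u i \<in> h (Suc n)"
      "\<And>i. i < N \<Longrightarrow> (u i \<in> A \<longleftrightarrow> v i \<in> A) \<and> (u i \<in> B \<longleftrightarrow> v i \<in> B) \<and>
        (\<forall>m\<in>F. \<bar>norm (u i - m) - norm (v i - m)\<bar> < \<eta>) \<and>
        (\<forall>j<N. \<forall>l<N. \<bar>norm (u i + u j - u l) - norm (v i + v j - v l)\<bar> < \<eta>)"
      by blast+
    define \<phi> where "\<phi> x = u (the_inv_into {i. i < N} v x)" for x
    have \<phi>: "\<phi> (v i) = u i" if "i < N" for i
      using the_inv_into_f_f[OF v(2)] that by (simp add: \<phi>_def)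
    have uM: "u i \<in> M" for i using u(1) unfolding M_def by blast
    show "\<exists>\<phi>. \<forall>x\<in>V. \<phi> x \<in> M \<and> (\<phi> x \<in> A \<longleftrightarrow> x \<in> A) \<and> (\<phi> x \<in> B \<longleftrightarrow> x \<in> B) \<and>
        (\<forall>m\<in>F. \<bar>norm (\<phi> x - m) - norm (x - m)\<bar> < \<eta>) \<and>
        (\<forall>y\<in>V. \<forall>z\<in>V. \<bar>norm (\<phi> x + \<phi> y - \<phi> z) - norm (x + y - z)\<bar> < \<eta>)"
    proof (intro exI[of _ \<phi>] ballI conjI)
      fix x assume "x \<in> V"
      then obtain i where i: "x = v i" "i < N" unfolding v(1) by blast
      note ui = u(2)[OF i(2)]
      show "\<phi> x \<in> M" "\<phi> x \<in> A \<longleftrightarrow> x \<in> A" "\<phi> x \<in> B \<longleftrightarrow> x \<in> B"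
        unfolding i(1) \<phi>[OF i(2)] using uM ui by blast+
      show "\<bar>norm (\<phi> x - m) - norm (x - m)\<bar> < \<eta>" if "m \<in> F" for m
        unfolding i(1) \<phi>[OF i(2)] using that ui by blast
      fix y z assume "y \<in> V" "z \<in> V"
      then obtain j l where jl: "y = v j" "j < N" "z = v l" "l < N" unfolding v(1) by blast
      show "\<bar>norm (\<phi> x + \<phi> y - \<phi> z) - norm (x + y - z)\<bar> < \<eta>"
        unfolding i(1) jl(1,3) \<phi>[OF i(2)] \<phi>[OF jl(2)] \<phi>[OF jl(4)] using jl(2,4) ui by blast
    qed
  qed
qed

text \<open>The requirements attached to finite \<open>V\<close>, finite \<open>F\<close> and
  tolerance \<open>\<eta>\<close> are directed and each can be met, so they generate a proper filter
  of copying maps. Limits along it remove the tolerances for all points at once, although no single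
  map is additive. Distances to members of \<open>M\<close> are controlled as well, so that points
  of the closure are fixed in the limit.\<close>

lemma reflecting_filter:
  fixes A B S :: "'a::real_normed_vector set"
  assumes "countable S"
  obtains M and \<G> :: "('a \<Rightarrow> 'a) filter" where "countable M" "S \<subseteq> M" "subspace (closure M)" "\<G> \<noteq> bot"
    "\<And>v. \<forall>\<^sub>F \<phi> in \<G>. \<phi> v \<in> closure M \<and> (\<phi> v \<in> A \<longleftrightarrow> v \<in> A) \<and> (\<phi> v \<in> B \<longleftrightarrow> v \<in> B)"
    "\<And>u v w. ((\<lambda>\<phi>. norm (\<phi> u + \<phi> v - \<phi> w)) \<longlongrightarrow> norm (u + v - w)) \<G>"
    "\<And>v. v \<in> closure M \<Longrightarrow> ((\<lambda>\<phi>. \<phi> v) \<longlongrightarrow> v) \<G>"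
proof -
  obtain M where M: "countable M" "S \<subseteq> M" "subspace (closure M)"
    "\<And>V F \<eta>. finite V \<Longrightarrow> finite F \<Longrightarrow> F \<subseteq> M \<Longrightarrow> \<eta> > 0 \<Longrightarrow>
      \<exists>\<phi>. \<forall>x\<in>V. \<phi> x \<in> M \<and> (\<phi> x \<in> A \<longleftrightarrow> x \<in> A) \<and> (\<phi> x \<in> B \<longleftrightarrow> x \<in> B) \<and>
        (\<forall>m\<in>F. \<bar>norm (\<phi> x - m) - norm (x - m)\<bar> < \<eta>) \<and>
        (\<forall>y\<in>V. \<forall>z\<in>V. \<bar>norm (\<phi> x + \<phi> y - \<phi> z) - norm (x + y - z)\<bar> < \<eta>)"
    by (rule reflecting_set[OF assms, of A B]) (rule that)
  define I where "I = {(V :: 'a set, F, \<eta>). finite V \<and> finite F \<and> F \<subseteq> M \<and> (\<eta>::real) > 0}"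
  define R where "R = (\<lambda>(V, F, \<eta>::real). {\<phi>. \<forall>x\<in>V. \<phi> x \<in> M \<and> (\<phi> x \<in> A \<longleftrightarrow> x \<in> A) \<and> (\<phi> x \<in> B \<longleftrightarrow> x \<in> B) \<and>
        (\<forall>m\<in>F. \<bar>norm (\<phi> x - m) - norm (x - m)\<bar> < \<eta>) \<and>
        (\<forall>y\<in>V. \<forall>z\<in>V. \<bar>norm (\<phi> x + \<phi> y - \<phi> z) - norm (x + y - z)\<bar> < \<eta>)})"
  define \<G> where "\<G> = (INF t\<in>I. principal (R t))"
  have R_mono: "R (V', F', \<eta>') \<subseteq> R (V, F, \<eta>)" if "V \<subseteq> V'" "F \<subseteq> F'" "\<eta>' \<le> \<eta>" for V V' F F' \<eta> \<eta>'
  proof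
    fix \<phi> assume \<phi>: "\<phi> \<in> R (V', F', \<eta>')"
    show "\<phi> \<in> R (V, F, \<eta>)"
      unfolding R_def prod.case
    proof (intro CollectI ballI conjI)
      fix x assume "x \<in> V"
      then have x: "x \<in> V'" using that(1) by blast
      show "\<phi> x \<in> M" "\<phi> x \<in> A \<longleftrightarrow> x \<in> A" "\<phi> x \<in> B \<longleftrightarrow> x \<in> B"
        using \<phi> x by (auto simp: R_def)
      show "\<bar>norm (\<phi> x - m) - norm (x - m)\<bar> < \<eta>" if "m \<in> F" for m
      proof (rule less_le_trans)
        have "m \<in> F'" using that \<open>F \<subseteq> F'\<close> by blast
        then show "\<bar>norm (\<phi> x - m) - norm (x - m)\<bar> < \<eta>'" using \<phi> x by (simp add: R_def)
      qed fact
      fix y z assume "y \<in> V" "z \<in> V"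
      then have yz: "y \<in> V'" "z \<in> V'" using that(1) by blast+
      show "\<bar>norm (\<phi> x + \<phi> y - \<phi> z) - norm (x + y - z)\<bar> < \<eta>"
      proof (rule less_le_trans)
        show "\<bar>norm (\<phi> x + \<phi> y - \<phi> z) - norm (x + y - z)\<bar> < \<eta>'" using \<phi> x yz by (simp add: R_def)
      qed fact
    qed
  qed
  have sub: "\<exists>s\<in>I. R s \<subseteq> (\<Inter>t\<in>X. R t)" if "finite X" "X \<subseteq> I" for X
    using that
  proof (induction X rule: finite_induct)
    case empty
    have "({}, {}, 1) \<in> I" by (simp add: I_def)
    then show ?case by blast
  next
    case (insert t X)
    then obtain s where s: "s \<in> I" "R s \<subseteq> (\<Inter>t\<in>X. R t)" by auto
    obtain V F \<eta> where t: "t = (V, F, \<eta>)" by (cases t)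
    obtain V' F' \<eta>' where s': "s = (V', F', \<eta>')" by (cases s)
    have "(V \<union> V', F \<union> F', min \<eta> \<eta>') \<in> I" using insert.prems s(1) by (auto simp: I_def t s')
    moreover have "R (V \<union> V', F \<union> F', min \<eta> \<eta>') \<subseteq> R t \<inter> R s"
      unfolding t s' by (intro Int_greatest R_mono) auto
    ultimately show ?case using s(2) by blast
  qed
  have ne: "R s \<noteq> {}" if "s \<in> I" for s
  proof -
    obtain V F \<eta> where s: "s = (V, F, \<eta>)" by (cases s)
    have "finite V" "finite F" "F \<subseteq> M" "\<eta> > 0" using that by (auto simp: I_def s)
    from M(4)[OF this] show ?thesis unfolding R_def s prod.case by blast
  qed
  have "\<G> \<noteq> bot"
    unfolding \<G>_def
  proof (rule INF_filter_not_bot)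
    fix X assume X: "X \<subseteq> I" "finite X"
    obtain s where "s \<in> I" "R s \<subseteq> (\<Inter>t\<in>X. R t)" using sub[OF X(2,1)] by blast
    then have "(\<Inter>t\<in>X. R t) \<noteq> {}" using ne[of s] by blast
    then show "(INF t\<in>X. principal (R t)) \<noteq> bot"
      unfolding INF_principal_finite[OF X(2)] principal_eq_bot_iff .
  qed
  have ev: "\<forall>\<^sub>F \<phi> in \<G>. \<phi> \<in> R t" if "t \<in> I" for t
    unfolding \<G>_def by (rule eventually_INF1[OF that]) (simp add: eventually_principal)
  show ?thesis
  proof (rule that[of M \<G>])
    show "countable M" "S \<subseteq> M" "subspace (closure M)" "\<G> \<noteq> bot" by fact+
    show "\<forall>\<^sub>F \<phi> in \<G>. \<phi> v \<in> closure M \<and> (\<phi> v \<in> A \<longleftrightarrow> v \<in> A) \<and> (\<phi> v \<in> B \<longleftrightarrow> v \<in> B)" for v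
    proof -
      have "({v}, {}, 1) \<in> I" by (simp add: I_def)
      from ev[OF this] show ?thesis
        by (rule eventually_mono) (use closure_subset in \<open>auto simp: R_def\<close>)
    qed
    show "((\<lambda>\<phi>. norm (\<phi> u + \<phi> v - \<phi> w)) \<longlongrightarrow> norm (u + v - w)) \<G>" for u v w
      unfolding tendsto_iff dist_real_def
    proof (intro allI impI)
      fix e :: real assume "e > 0"
      then have "({u, v, w}, {}, e) \<in> I" by (simp add: I_def)
      from ev[OF this] show "\<forall>\<^sub>F \<phi> in \<G>. \<bar>norm (\<phi> u + \<phi> v - \<phi> w) - norm (u + v - w)\<bar> < e"
        by (rule eventually_mono) (simp add: R_def)
    qed
    show "((\<lambda>\<phi>. \<phi> v) \<longlongrightarrow> v) \<G>" if v: "v \<in> closure M" for v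
      unfolding tendsto_iff dist_norm
    proof (intro allI impI)
      fix e :: real assume "e > 0"
      then have "e/3 > 0" by simp
      then obtain m where m: "m \<in> M" "norm (m - v) < e/3"
        using v unfolding closure_approachable dist_norm by blast
      have "({v}, {m}, e/3) \<in> I" using m \<open>e > 0\<close> by (simp add: I_def)
      from ev[OF this] show "\<forall>\<^sub>F \<phi> in \<G>. norm (\<phi> v - v) < e"
      proof (rule eventually_mono)
        fix \<phi> assume "\<phi> \<in> R ({v}, {m}, e/3)"
        then have "\<bar>norm (\<phi> v - m) - norm (v - m)\<bar> < e/3" unfolding R_def by blast
        then have "norm (\<phi> v - m) < norm (m - v) + e/3"
          by (simp only: abs_less_iff norm_minus_commute[of v m]) linarith
        moreover have "norm (\<phi> v - v) \<le> norm (\<phi> v - m) + norm (m - v)"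
          using norm_triangle_ineq[of "\<phi> v - m" "m - v"] by simp
        ultimately show "norm (\<phi> v - v) < e" using m(2) \<open>e > 0\<close> by linarith
      qed
    qed
  qed
qed

section \<open>Weak* limits of functionals along copying maps\<close>

text \<open>Limits along copying maps are additive, but homogeneity has to be recovered. For fixed
  \<open>v\<close> the defect \<open>h c = g (c *\<^sub>R v) - c * g v\<close> is additive, vanishes
  at integers and is bounded on \<open>[-1, 1]\<close>; its value depends only on the fractional
  part of \<open>c\<close>, so it is bounded everywhere. As \<open>h (n * c) = n * h c\<close>, it
  is zero.\<close>

lemma additive_bounded_imp_blinfun:
  fixes g :: "'a::real_normed_vector \<Rightarrow> real"
  assumes add: "\<And>u v. g (u + v) = g u + g v" and bd: "\<And>v. \<bar>g v\<bar> \<le> L * norm v"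
  obtains G where "blinfun_apply G = g"
proof -
  have scale: "g (c *\<^sub>R v) = c * g v" for c v
  proof -
    define h where "h c = g (c *\<^sub>R v) - c * g v" for c
    have hadd: "h (a + b) = h a + h b" for a b
      by (simp add: h_def scaleR_left_distrib add algebra_simps)
    have h1: "h 1 = 0" by (simp add: h_def)
    have h0: "h 0 = 0" using hadd[of 0 0] by simp
    have hnat: "h (real n * a) = real n * h a" for n a
      by (induction n) (simp_all add: h0 hadd distrib_right)
    have hneg: "h (- a) = - h a" for a using hadd[of a "- a"] h0 by simp
    have hint: "h (of_int k) = 0" for k
    proof (cases k)
      case (nonneg n)
      then show ?thesis using hnat[of n 1] h1 by simp
    next
      case (neg n)
      then show ?thesis using hnat[of "Suc n" 1] h1 hneg[of "real (Suc n)"] by simp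
    qed
    define K where "K = \<bar>L\<bar> * norm v + \<bar>g v\<bar>"
    have hbd: "\<bar>h a\<bar> \<le> K" if "\<bar>a\<bar> \<le> 1" for a
    proof -
      have "\<bar>g (a *\<^sub>R v)\<bar> \<le> \<bar>L\<bar> * (\<bar>a\<bar> * norm v)"
        using bd[of "a *\<^sub>R v"] mult_right_mono[OF abs_ge_self[of L], of "\<bar>a\<bar> * norm v"] by simp
      also have "\<dots> \<le> \<bar>L\<bar> * (1 * norm v)" using that by (intro mult_left_mono mult_right_mono) auto
      finally have "\<bar>g (a *\<^sub>R v)\<bar> \<le> \<bar>L\<bar> * norm v" by simp
      moreover have "\<bar>a * g v\<bar> \<le> 1 * \<bar>g v\<bar>" unfolding abs_mult using that by (intro mult_right_mono) auto
      ultimately show ?thesis unfolding h_def K_def by linarith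
    qed
    have "real n * \<bar>h c\<bar> \<le> K" for n
    proof -
      have "h (real n * c) = h (of_int \<lfloor>real n * c\<rfloor>) + h (frac (real n * c))"
        unfolding hadd[symmetric] frac_def by simp
      then have "\<bar>h (real n * c)\<bar> \<le> K"
        using hbd[of "frac (real n * c)"] frac_ge_0[of "real n * c"] frac_lt_1[of "real n * c"]
        by (simp add: hint)
      then show ?thesis by (simp add: hnat abs_mult)
    qed
    then have "h c = 0"
      by (metis reals_Archimedean3 abs_le_zero_iff not_le)
    then show ?thesis by (simp add: h_def)
  qed
  have "bounded_linear g"
    by (rule bounded_linear_intro[of _ L]) (use add scale bd in \<open>auto simp: mult.commute\<close>)
  then have "blinfun_apply (Blinfun g) = g" by (rule bounded_linear_Blinfun_apply)
  then show ?thesis by (rule that)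
qed

text \<open>A convergent subnet in filter form: compactness provides a cluster point
  \<open>g\<close> of \<open>\<Psi>\<close> along \<open>\<G>\<close>, and intersecting
  \<open>\<G>\<close> with the preimages of its neighbourhoods leaves a proper filter.\<close>

lemma compact_refine_filter:
  assumes "\<G> \<noteq> bot" "compact K" "\<And>x. \<Psi> x \<in> K"
  obtains \<U> g where "\<U> \<noteq> bot" "\<U> \<le> \<G>" "filterlim \<Psi> (nhds g) \<U>"
proof -
  have "filtermap \<Psi> \<G> \<noteq> bot" "eventually (\<lambda>y. y \<in> K) (filtermap \<Psi> \<G>)"
    using assms(1,3) by (simp_all add: filtermap_bot_iff eventually_filtermap)
  then obtain g where g: "inf (nhds g) (filtermap \<Psi> \<G>) \<noteq> bot"
    using assms(2) unfolding compact_filter by blast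
  define \<U> where "\<U> = inf \<G> (filtercomap \<Psi> (nhds g))"
  have "\<U> \<noteq> bot"
  proof
    assume "\<U> = bot"
    then have "eventually (\<lambda>_. False) \<U>" by simp
    then obtain P Q where PQ: "eventually P \<G>" "eventually Q (filtercomap \<Psi> (nhds g))"
      "\<And>x. P x \<Longrightarrow> Q x \<Longrightarrow> False" unfolding \<U>_def eventually_inf by blast
    obtain R where R: "eventually R (nhds g)" "\<And>x. R (\<Psi> x) \<Longrightarrow> Q x"
      using PQ(2) unfolding eventually_filtercomap by blast
    have "eventually (\<lambda>y. \<exists>x. y = \<Psi> x \<and> P x) (filtermap \<Psi> \<G>)"
      unfolding eventually_filtermap by (rule eventually_mono[OF PQ(1)]) blast
    then have "eventually (\<lambda>_. False) (inf (nhds g) (filtermap \<Psi> \<G>))"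
      unfolding eventually_inf using R PQ(3) by blast
    with g show False by (simp add: trivial_limit_def)
  qed
  moreover have "\<U> \<le> \<G>" by (simp add: \<U>_def)
  moreover have "filterlim \<Psi> (nhds g) \<U>"
    unfolding \<U>_def by (rule filterlim_mono[OF filterlim_filtercomap order_refl inf_le2])
  ultimately show ?thesis by (rule that)
qed

text \<open>The maps \<open>\<phi>\<close> are arbitrary functions and all information about them is
  asymptotic: \<open>three\<close> expresses near-additivity and near-isometry together,
  \<open>fixed\<close> says that \<open>Y\<close> stays in place.\<close>

locale reflection =
  fixes Y :: "'a::real_normed_vector set" and \<G> :: "('a \<Rightarrow> 'a) filter"
  assumes Y: "subspace Y" and nontriv: "\<G> \<noteq> bot"
    and into: "\<And>v. \<forall>\<^sub>F \<phi> in \<G>. \<phi> v \<in> Y"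
    and three: "\<And>u v w. ((\<lambda>\<phi>. norm (\<phi> u + \<phi> v - \<phi> w)) \<longlongrightarrow> norm (u + v - w)) \<G>"
    and fixed: "\<And>v. v \<in> Y \<Longrightarrow> ((\<lambda>\<phi>. \<phi> v) \<longlongrightarrow> v) \<G>"
begin

lemma norm_lim: "((\<lambda>\<phi>. norm (\<phi> v)) \<longlongrightarrow> norm v) \<G>"
  using three[of v v v] by simp

lemma norm_diff_lim: assumes "y \<in> Y" shows "((\<lambda>\<phi>. norm (\<phi> v - y)) \<longlongrightarrow> norm (v - y)) \<G>"
proof -
  have "0 \<in> Y" using Y by (rule subspace_0)
  then have "((\<lambda>\<phi>. norm (\<phi> 0) + norm (\<phi> y - y)) \<longlongrightarrow> norm (0::'a) + norm (y - y)) \<G>"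
    using assms by (intro tendsto_intros fixed)
  then have "((\<lambda>\<phi>. norm (\<phi> 0) + norm (\<phi> y - y)) \<longlongrightarrow> 0) \<G>" by simp
  then have "((\<lambda>\<phi>. norm (\<phi> v - y) - norm (\<phi> v + \<phi> 0 - \<phi> y)) \<longlongrightarrow> 0) \<G>"
  proof (rule Lim_null_comparison[rotated])
    show "\<forall>\<^sub>F \<phi> in \<G>. norm (norm (\<phi> v - y) - norm (\<phi> v + \<phi> 0 - \<phi> y)) \<le> norm (\<phi> 0) + norm (\<phi> y - y)"
    proof (rule always_eventually, rule allI)
      fix \<phi> :: "'a \<Rightarrow> 'a"
      have "norm (norm (\<phi> v - y) - norm (\<phi> v + \<phi> 0 - \<phi> y)) \<le> norm ((\<phi> v - y) - (\<phi> v + \<phi> 0 - \<phi> y))"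
        unfolding real_norm_def by (rule norm_triangle_ineq3)
      also have "(\<phi> v - y) - (\<phi> v + \<phi> 0 - \<phi> y) = (\<phi> y - y) - \<phi> 0" by simp
      also have "norm \<dots> \<le> norm (\<phi> y - y) + norm (\<phi> 0)" by (rule norm_triangle_ineq4)
      finally show "norm (norm (\<phi> v - y) - norm (\<phi> v + \<phi> 0 - \<phi> y)) \<le> norm (\<phi> 0) + norm (\<phi> y - y)"
        by simp
    qed
  qed
  from tendsto_add[OF this three[of v 0 y]] show ?thesis by simp
qed

text \<open>\<open>g i\<close> is a weak* limit of \<open>f i\<close> composed with the copying
  maps. It is additive because the defect is at most
  \<open>L * norm (\<phi> u + \<phi> v - \<phi> (u + v))\<close>, which tends to 0 by
  \<open>three\<close>. One filter serves all indices, so inequalities that relate several of the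
  functionals pass to the limit together.\<close>

lemma lift_functionals:
  fixes f :: "'i \<Rightarrow> 'a \<Rightarrow>\<^sub>L real"
  assumes L: "\<And>i. norm (f i) \<le> L"
  obtains \<U> and g :: "'i \<Rightarrow> 'a \<Rightarrow>\<^sub>L real" where "\<U> \<noteq> bot" "\<U> \<le> \<G>"
    "\<And>i v. ((\<lambda>\<phi>. blinfun_apply (f i) (\<phi> v)) \<longlongrightarrow> blinfun_apply (g i) v) \<U>"
proof -
  have "L \<ge> 0" using L norm_ge_zero order_trans by blast
  define b where "b iv = L * (norm (snd iv) + 1)" for iv :: "'i \<times> 'a"
  have b: "b iv \<ge> 0" for iv using \<open>L \<ge> 0\<close> by (simp add: b_def)
  \<comment> \<open>Clamping makes the values lie in a compact box for every \<open>\<phi>\<close>; at each coordinate it is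
    eventually inactive.\<close>
  define \<Psi> where "\<Psi> \<phi> iv = max (- b iv) (min (b iv) (f (fst iv) (\<phi> (snd iv))))"
    for \<phi> :: "'a \<Rightarrow> 'a" and iv
  have "\<Psi> \<phi> \<in> {F. \<forall>iv. \<bar>F iv\<bar> \<le> b iv}" for \<phi>
    using b by (auto simp: \<Psi>_def abs_le_iff le_max_iff_disj)
  then obtain \<U> F where U: "\<U> \<noteq> bot" "\<U> \<le> \<G>" "filterlim \<Psi> (nhds F) \<U>"
    using compact_refine_filter[OF nontriv compact_box, of \<Psi>] by blast
  have coord: "((\<lambda>\<phi>. f i (\<phi> v)) \<longlongrightarrow> F (i, v)) \<U>" for i v
  proof -
    have "((\<lambda>\<phi>. \<Psi> \<phi> (i, v)) \<longlongrightarrow> F (i, v)) \<U>"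
      by (rule continuous_on_tendsto_compose[OF continuous_on_eval[of UNIV] U(3)]) simp_all
    moreover have "\<forall>\<^sub>F \<phi> in \<U>. \<Psi> \<phi> (i, v) = f i (\<phi> v)"
    proof -
      have "\<forall>\<^sub>F \<phi> in \<G>. norm (\<phi> v) < norm v + 1"
        by (rule order_tendstoD(2)[OF norm_lim]) simp
      then have "\<forall>\<^sub>F \<phi> in \<U>. norm (\<phi> v) < norm v + 1" using U(2) by (rule filter_leD[rotated])
      then show ?thesis
      proof (rule eventually_mono)
        fix \<phi> :: "'a \<Rightarrow> 'a" assume "norm (\<phi> v) < norm v + 1"
        then have "norm (f i) * norm (\<phi> v) \<le> L * (norm v + 1)"
          using L[of i] \<open>L \<ge> 0\<close> by (intro mult_mono) auto
        then have "\<bar>f i (\<phi> v)\<bar> \<le> b (i, v)"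
          using norm_blinfun[of "f i" "\<phi> v"] by (simp add: b_def)
        then show "\<Psi> \<phi> (i, v) = f i (\<phi> v)" by (simp add: \<Psi>_def abs_le_iff)
      qed
    qed
    ultimately show ?thesis by (simp add: filterlim_cong)
  qed
  have nl: "((\<lambda>\<phi>. norm (\<phi> v)) \<longlongrightarrow> norm v) \<U>" for v by (rule tendsto_mono[OF U(2) norm_lim])
  have bnd: "\<bar>f i v\<bar> \<le> L * norm v" for i v
    using norm_blinfun[of "f i" v] mult_right_mono[OF L[of i] norm_ge_zero[of v]] by simp
  have bd: "\<bar>F (i, v)\<bar> \<le> L * norm v" for i v
  proof (rule tendsto_le[OF U(1)])
    show "((\<lambda>\<phi>. L * norm (\<phi> v)) \<longlongrightarrow> L * norm v) \<U>" by (intro tendsto_intros nl)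
    show "((\<lambda>\<phi>. \<bar>f i (\<phi> v)\<bar>) \<longlongrightarrow> \<bar>F (i, v)\<bar>) \<U>" by (intro tendsto_intros coord)
  qed (simp add: bnd)
  have add: "F (i, u + v) = F (i, u) + F (i, v)" for i u v
  proof -
    have "((\<lambda>\<phi>. L * norm (\<phi> u + \<phi> v - \<phi> (u + v))) \<longlongrightarrow> L * norm (u + v - (u + v))) \<U>"
      by (intro tendsto_intros tendsto_mono[OF U(2) three])
    moreover have "((\<lambda>\<phi>. \<bar>f i (\<phi> u) + f i (\<phi> v) - f i (\<phi> (u + v))\<bar>)
        \<longlongrightarrow> \<bar>F (i, u) + F (i, v) - F (i, u + v)\<bar>) \<U>"
      by (intro tendsto_intros coord)
    moreover have "\<bar>f i (\<phi> u) + f i (\<phi> v) - f i (\<phi> (u + v))\<bar> \<le> L * norm (\<phi> u + \<phi> v - \<phi> (u + v))" for \<phi>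
      using bnd[of i "\<phi> u + \<phi> v - \<phi> (u + v)"] by (simp add: blinfun.add_right blinfun.diff_right)
    ultimately have "\<bar>F (i, u) + F (i, v) - F (i, u + v)\<bar> \<le> L * norm (u + v - (u + v))"
      using tendsto_le[OF U(1)] by (metis (no_types, lifting) always_eventually)
    then show ?thesis by simp
  qed
  have "\<exists>G. blinfun_apply G = (\<lambda>v. F (i, v))" for i
  proof -
    obtain G where "blinfun_apply G = (\<lambda>v. F (i, v))"
      by (rule additive_bounded_imp_blinfun[of "\<lambda>v. F (i, v)" L]) (simp_all add: add bd)
    then show ?thesis by blast
  qed
  from choice[OF allI[OF this]] obtain g where "\<forall>i. blinfun_apply (g i) = (\<lambda>v. F (i, v))" ..
  then show ?thesis using that[OF U(1,2), of g] coord by simp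
qed

end

text \<open>The epsilon form of Frechet normality. For each \<open>e\<close> it consists of
  inequalities at single points, which is what pointwise limits preserve, and it can be stated for
  \<open>A \<inter> Y\<close> as well as for \<open>A\<close>.\<close>

definition normal_within :: "'a::real_normed_vector set \<Rightarrow> 'a \<Rightarrow> ('a \<Rightarrow>\<^sub>L real) \<Rightarrow> bool" where
  "normal_within A a f \<longleftrightarrow> (\<forall>e>0. \<exists>r>0. \<forall>z\<in>A. norm (z - a) < r \<longrightarrow> blinfun_apply f (z - a) \<le> e * norm (z - a))"

lemma normal_within_imp_frechet_normal:
  assumes "normal_within A a f"
  shows "f \<in> frechet_normal_cone A a"
  unfolding frechet_normal_cone_def mem_Collect_eq
proof (rule Limsup_le_iff[THEN iffD2], intro allI impI)
  fix y :: ereal assume "y > 0"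
  then obtain e where e: "e > 0" "ereal e < y" using ereal_dense2[of 0 y] by (auto simp: zero_ereal_def)
  obtain r where r: "r > 0" "\<forall>z\<in>A. norm (z - a) < r \<longrightarrow> blinfun_apply f (z - a) \<le> e * norm (z - a)"
    using assms e(1) unfolding normal_within_def by blast
  show "\<forall>\<^sub>F z in at a within A. ereal (blinfun_apply f (z - a) / norm (z - a)) < y"
    unfolding eventually_at
  proof (intro exI[of _ r] conjI ballI impI)
    fix z assume z: "z \<in> A" "z \<noteq> a \<and> dist z a < r"
    then have "blinfun_apply f (z - a) \<le> e * norm (z - a)" using r(2) by (simp add: dist_norm)
    then have "blinfun_apply f (z - a) / norm (z - a) \<le> e" using z(2) by (simp add: divide_le_eq)
    then show "ereal (blinfun_apply f (z - a) / norm (z - a)) < y" using e(2) by (meson ereal_less_eq(3) le_less_trans)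
  qed (rule r(1))
qed

text \<open>The radius \<open>r\<close> found in \<open>Y\<close> works unchanged. A test point
  \<open>z\<close> of \<open>A\<close> with \<open>norm (z - a) < r\<close> is copied to points of
  \<open>A \<inter> Y\<close> whose distances to \<open>a\<close> tend to
  \<open>norm (z - a)\<close>; they eventually satisfy the strict bound, and the inequality there
  passes to the limit. Since \<open>a\<close> lies in \<open>Y\<close>, \<open>f\<close> and
  \<open>g\<close> agree at \<open>a\<close>.\<close>

lemma (in reflection) normal_within_lift:
  assumes \<U>: "\<U> \<noteq> bot" "\<U> \<le> \<G>" "\<And>v. ((\<lambda>\<phi>. blinfun_apply f (\<phi> v)) \<longlongrightarrow> blinfun_apply g v) \<U>"
    and A: "\<And>v. v \<in> A \<Longrightarrow> \<forall>\<^sub>F \<phi> in \<G>. \<phi> v \<in> A" and a: "a \<in> Y"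
    and f: "normal_within (A \<inter> Y) a f"
  shows "normal_within A a g"
  unfolding normal_within_def
proof (intro allI impI)
  fix e :: real assume "e > 0"
  then obtain r where r: "r > 0" "\<And>z. z \<in> A \<inter> Y \<Longrightarrow> norm (z - a) < r \<Longrightarrow> f (z - a) \<le> e * norm (z - a)"
    using f unfolding normal_within_def by blast
  have "g (z - a) \<le> e * norm (z - a)" if z: "z \<in> A" "norm (z - a) < r" for z
  proof -
    have nl: "((\<lambda>\<phi>. norm (\<phi> z - a)) \<longlongrightarrow> norm (z - a)) \<U>"
      by (rule tendsto_mono[OF \<U>(2) norm_diff_lim[OF a]])
    have "((\<lambda>\<phi>. f (\<phi> a)) \<longlongrightarrow> f a) \<U>"
      by (intro tendsto_intros tendsto_mono[OF \<U>(2) fixed[OF a]])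
    then have fa: "g a = f a" by (rule tendsto_unique[OF \<U>(1) \<U>(3)])
    have "((\<lambda>\<phi>. f (\<phi> z - a)) \<longlongrightarrow> g (z - a)) \<U>"
      unfolding blinfun.diff_right fa[symmetric] using \<U>(3)[of z] tendsto_const[of "g a"]
      by (intro tendsto_diff) (simp_all add: fa)
    moreover have "((\<lambda>\<phi>. e * norm (\<phi> z - a)) \<longlongrightarrow> e * norm (z - a)) \<U>" by (intro tendsto_intros nl)
    moreover have "\<forall>\<^sub>F \<phi> in \<U>. f (\<phi> z - a) \<le> e * norm (\<phi> z - a)"
    proof -
      have "\<forall>\<^sub>F \<phi> in \<U>. norm (\<phi> z - a) < r" by (rule order_tendstoD(2)[OF nl z(2)])
      moreover have "\<forall>\<^sub>F \<phi> in \<U>. \<phi> z \<in> A" by (rule filter_leD[OF \<U>(2) A[OF z(1)]])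
      moreover have "\<forall>\<^sub>F \<phi> in \<U>. \<phi> z \<in> Y" by (rule filter_leD[OF \<U>(2) into])
      ultimately show ?thesis by eventually_elim (simp add: r(2))
    qed
    ultimately show ?thesis by (intro tendsto_le[OF \<U>(1)])
  qed
  with r(1) show "\<exists>r>0. \<forall>z\<in>A. norm (z - a) < r \<longrightarrow> g (z - a) \<le> e * norm (z - a)" by blast
qed

section \<open>Multipliers along a separable subspace\<close>

lemma has_derivative_chain_within:
  assumes "(f has_derivative f') (at (g x) within Y)" "(g has_derivative g') (at x within S)" "g ` S \<subseteq> Y"
  shows "((\<lambda>x. f (g x)) has_derivative (\<lambda>h. f' (g' h))) (at x within S)"
  using has_derivative_in_compose[OF assms(2) has_derivative_subset[OF assms(1,3)]] by simp

lemma smooth_min_normal: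
  assumes "(\<psi> has_derivative blinfun_apply D) (at a within Y)" "S \<subseteq> Y"
    and min: "\<And>z. z \<in> S \<Longrightarrow> \<psi> a \<le> \<psi> z"
  shows "normal_within S a (- D)"
  unfolding normal_within_def
proof (intro allI impI)
  fix e :: real assume "e > 0"
  then obtain r where r: "r > 0"
    "\<And>z. z \<in> Y \<Longrightarrow> norm (z - a) < r \<Longrightarrow> norm (\<psi> z - \<psi> a - D (z - a)) \<le> e * norm (z - a)"
    using assms(1) unfolding has_derivative_within_alt by blast
  have "(- D) (z - a) \<le> e * norm (z - a)" if "z \<in> S" "norm (z - a) < r" for z
  proof -
    have "\<bar>\<psi> z - \<psi> a - D (z - a)\<bar> \<le> e * norm (z - a)" using r(2) that assms(2) by auto
    then show ?thesis using min[OF that(1)] by (simp add: blinfun.minus_left)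
  qed
  with r(1) show "\<exists>r>0. \<forall>z\<in>S. norm (z - a) < r \<longrightarrow> (- D) (z - a) \<le> e * norm (z - a)" by blast
qed

text \<open>Along a short step \<open>t *\<^sub>R h\<close> smoothness gives the first-order change
  of \<open>\<phi>\<close>, while convexity bounds the change of \<open>g\<close> by
  \<open>t * (g (x + h) - g x)\<close>. Dividing by \<open>t\<close> yields an inequality for the
  full \<open>h\<close>, that is, a subgradient along \<open>Y\<close>.\<close>

lemma convex_plus_smooth_min:
  fixes g :: "'b::real_normed_vector \<Rightarrow> real"
  assumes Y: "subspace Y" and g: "convex_on UNIV g" and D: "(\<phi> has_derivative D) (at x within Y)"
    and x: "x \<in> Y" and min: "\<And>z. z \<in> Y \<Longrightarrow> g x + \<phi> x \<le> g z + \<phi> z" and h: "h \<in> Y"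
  shows "- D h \<le> g (x + h) - g x"
proof (rule field_le_epsilon)
  fix e :: real assume e: "e > 0"
  define e' where "e' = e / (norm h + 1)"
  have "norm h + 1 > 0" using norm_ge_zero[of h] by linarith
  then have e': "e' > 0" "e' * norm h \<le> e" using e by (auto simp: e'_def field_simps)
  obtain r where r: "r > 0" "\<And>z. z \<in> Y \<Longrightarrow> norm (z - x) < r \<Longrightarrow> norm (\<phi> z - \<phi> x - D (z - x)) \<le> e' * norm (z - x)"
    using D e'(1) unfolding has_derivative_within_alt by blast
  define t where "t = min 1 (r / (2 * (norm h + 1)))"
  have t: "t > 0" "t \<le> 1" using r \<open>norm h + 1 > 0\<close> by (auto simp: t_def)
  have "t * norm h \<le> r / (2 * (norm h + 1)) * (norm h + 1)"
    using \<open>norm h + 1 > 0\<close> t r by (intro mult_mono) (auto simp: t_def)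
  also have "\<dots> = r / 2" using \<open>norm h + 1 > 0\<close> by (simp add: field_simps)
  finally have th: "t * norm h < r" using r(1) by linarith
  define z where "z = x + t *\<^sub>R h"
  have z: "z \<in> Y" unfolding z_def using Y x h by (intro subspace_add subspace_scale)
  have lin: "linear D" using D by (rule has_derivative_linear)
  have "\<bar>\<phi> z - \<phi> x - t * D h\<bar> \<le> e' * (t * norm h)"
    using r(2)[OF z] th t by (simp add: z_def linear_scale[OF lin])
  moreover have "e' * (t * norm h) \<le> t * e"
    using mult_left_mono[OF e'(2), of t] t by (simp add: algebra_simps)
  moreover have "g z \<le> (1 - t) * g x + t * g (x + h)"
  proof -
    have "z = (1 - t) *\<^sub>R x + t *\<^sub>R (x + h)" by (simp add: z_def algebra_simps)
    then show ?thesis using convex_onD[OF g, of t x "x + h"] t by simp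
  qed
  ultimately have "t * (- D h) \<le> t * (g (x + h) - g x + e)"
    using min[OF z] by (simp add: algebra_simps)
  then show "- D h \<le> g (x + h) - g x + e" using t by (simp only: mult_le_cancel_left_pos)
qed

lemma convex_on_max_norm: "convex_on UNIV (\<lambda>(p::'a::real_normed_vector, q::'b::real_normed_vector). max (norm p) (norm q))"
proof (rule convex_onI)
  fix t :: real and x y :: "'a \<times> 'b" assume t: "0 < t" "t < 1"
  have *: "norm ((1 - t) *\<^sub>R u + t *\<^sub>R v) \<le> (1 - t) * M + t * N"
    if "norm u \<le> M" "norm v \<le> N" for u v :: "'c::real_normed_vector" and M N
  proof -
    have "norm ((1 - t) *\<^sub>R u + t *\<^sub>R v) \<le> (1 - t) * norm u + t * norm v"
      using norm_triangle_ineq[of "(1 - t) *\<^sub>R u" "t *\<^sub>R v"] t by simp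
    also have "\<dots> \<le> (1 - t) * M + t * N" using that t by (intro add_mono mult_left_mono) auto
    finally show ?thesis .
  qed
  show "(case (1 - t) *\<^sub>R x + t *\<^sub>R y of (p, q) \<Rightarrow> max (norm p) (norm q))
      \<le> (1 - t) * (case x of (p, q) \<Rightarrow> max (norm p) (norm q)) + t * (case y of (p, q) \<Rightarrow> max (norm p) (norm q))"
    by (auto simp: split_def intro!: *)
qed simp

text \<open>Derivatives of norm at most 1 make the differentiated series converge uniformly on
  \<open>Y\<close>, which permits termwise differentiation; the weights sum to
  \<open>2 * \<mu>\<close>.\<close>

lemma weighted_series_derivative:
  fixes \<theta> :: "nat \<Rightarrow> 'a::banach \<Rightarrow> real"
  assumes Y: "subspace Y" and \<mu>: "\<mu> \<ge> 0" and w: "\<And>i. w i \<in> Y" and x: "x \<in> Y"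
    and D: "\<And>i y. y \<in> Y \<Longrightarrow> \<exists>D. norm D \<le> 1 \<and> (\<theta> i has_derivative blinfun_apply D) (at y within Y)"
    and summ: "\<And>y. summable (\<lambda>i. \<mu> * (1/2)^i * \<theta> i (y - w i))"
  obtains E where "norm E \<le> 2 * \<mu>"
    "((\<lambda>y. \<Sum>i. \<mu> * (1/2)^i * \<theta> i (y - w i)) has_derivative blinfun_apply E) (at x within Y)"
proof -
  have "\<forall>i. \<forall>y\<in>Y. \<exists>D. norm D \<le> 1 \<and> (\<theta> i has_derivative blinfun_apply D) (at y within Y)"
    using D by blast
  then have "\<forall>i. \<exists>d. \<forall>y\<in>Y. norm (d y) \<le> 1 \<and> (\<theta> i has_derivative blinfun_apply (d y)) (at y within Y)"
    by (intro allI bchoice) blast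
  from choice[OF this] obtain d where
    d: "\<forall>i. \<forall>y\<in>Y. norm (d i y) \<le> 1 \<and> (\<theta> i has_derivative blinfun_apply (d i y)) (at y within Y)" ..
  define F where "F y i = (\<mu> * (1/2)^i) *\<^sub>R d i (y - w i)" for y i
  define f where "f i y = \<mu> * (1/2)^i * \<theta> i (y - w i)" for i y
  have yw: "y - w i \<in> Y" if "y \<in> Y" for y i using Y that w by (intro subspace_diff)
  have geo: "summable (\<lambda>i. \<mu> * (1/2::real)^i)" by (intro summable_mult summable_geometric) simp
  have geosum: "(\<Sum>i. \<mu> * (1/2::real)^i) = 2 * \<mu>"
    using suminf_mult[OF summable_geometric, of "1/2::real" \<mu>] suminf_geometric[of "1/2::real"] by simp
  have normF: "norm (F y i) \<le> \<mu> * (1/2)^i" if "y \<in> Y" for y i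
    using d yw[OF that, of i] \<mu> mult_left_mono[of "norm (d i (y - w i))" 1 "\<mu> * (1/2)^i"]
    by (simp add: F_def abs_mult)
  have sumnF: "summable (\<lambda>i. norm (F y i))" if "y \<in> Y" for y
    by (rule summable_comparison_test'[OF geo, of 0]) (simp add: normF[OF that])
  have sumF: "summable (F y)" if "y \<in> Y" for y by (rule summable_norm_cancel[OF sumnF[OF that]])
  have tail: "norm (sum (F y) {..<n} - suminf (F y)) \<le> 2 * \<mu> * (1/2)^n" if y: "y \<in> Y" for y n
  proof -
    have "suminf (F y) - sum (F y) {..<n} = (\<Sum>i. F y (i + n))"
      using suminf_minus_initial_segment[OF sumF[OF y], of n] by simp
    then have "norm (sum (F y) {..<n} - suminf (F y)) = norm (\<Sum>i. F y (i + n))"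
      by (metis norm_minus_commute)
    also have "\<dots> \<le> (\<Sum>i. norm (F y (i + n)))"
      by (intro summable_norm summable_ignore_initial_segment sumnF[OF y])
    also have "\<dots> \<le> (\<Sum>i. (\<mu> * (1/2)^i) * (1/2)^n)"
    proof (intro suminf_le summable_ignore_initial_segment sumnF[OF y] summable_mult2 geo)
      show "norm (F y (i + n)) \<le> (\<mu> * (1/2)^i) * (1/2)^n" for i
        using normF[OF y, of "i + n"] by (simp add: power_add mult.assoc)
    qed
    also have "\<dots> = 2 * \<mu> * (1/2)^n" by (simp only: suminf_mult2[OF geo, symmetric] geosum)
    finally show ?thesis .
  qed
  have "\<exists>g. \<forall>y\<in>Y. (\<lambda>n. f n y) sums g y \<and> (g has_derivative blinfun_apply (suminf (F y))) (at y within Y)"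
  proof (rule has_derivative_series[where f' = "\<lambda>i y. blinfun_apply (F y i)"])
    show "convex Y" using Y by (rule subspace_imp_convex)
    show "(f n has_derivative blinfun_apply (F y n)) (at y within Y)" if y: "y \<in> Y" for n y
    proof -
      have "((\<lambda>z. \<theta> n (z - w n)) has_derivative (\<lambda>h. d n (y - w n) h)) (at y within Y)"
        by (rule has_derivative_chain_within[where Y = Y])
          (use d yw y in \<open>auto intro!: derivative_eq_intros\<close>)
      then have "((\<lambda>z. (\<mu> * (1/2)^n) *\<^sub>R \<theta> n (z - w n)) has_derivative (\<lambda>h. (\<mu> * (1/2)^n) *\<^sub>R d n (y - w n) h)) (at y within Y)"
        by (rule has_derivative_scaleR_right)
      then show ?thesis by (simp add: f_def[abs_def] F_def scaleR_blinfun.rep_eq)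
    qed
    show "\<forall>\<^sub>F n in sequentially. \<forall>y\<in>Y. \<forall>h. norm (sum (\<lambda>i. F y i h) {..<n} - suminf (F y) h) \<le> e * norm h"
      if "e > 0" for e
    proof -
      have "(\<lambda>n. 2 * \<mu> * (1/2::real)^n) \<longlonglongrightarrow> 2 * \<mu> * 0" by (intro tendsto_intros) simp
      then have "\<forall>\<^sub>F n in sequentially. 2 * \<mu> * (1/2::real)^n < e"
        using that by (intro order_tendstoD(2)) auto
      then show ?thesis
      proof (rule eventually_mono, intro ballI allI)
        fix n y h assume n: "2 * \<mu> * (1/2::real)^n < e" and y: "y \<in> Y"
        have "norm (sum (\<lambda>i. F y i h) {..<n} - suminf (F y) h) = norm ((sum (F y) {..<n} - suminf (F y)) h)"
          by (simp add: blinfun.diff_left blinfun.sum_left)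
        also have "\<dots> \<le> norm (sum (F y) {..<n} - suminf (F y)) * norm h" by (rule norm_blinfun)
        also have "\<dots> \<le> e * norm h" using tail[OF y, of n] n by (intro mult_right_mono) auto
        finally show "norm (sum (\<lambda>i. F y i h) {..<n} - suminf (F y) h) \<le> e * norm h" .
      qed
    qed
    show "x \<in> Y" by (rule x)
    show "(\<lambda>n. f n x) sums suminf (\<lambda>n. f n x)" unfolding f_def by (intro summable_sums summ)
  qed
  then obtain g where g: "\<And>y. y \<in> Y \<Longrightarrow> (\<lambda>n. f n y) sums g y"
    "\<And>y. y \<in> Y \<Longrightarrow> (g has_derivative blinfun_apply (suminf (F y))) (at y within Y)" by blast
  have "((\<lambda>y. \<Sum>i. f i y) has_derivative blinfun_apply (suminf (F x))) (at x within Y)"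
    by (rule has_derivative_transform[OF x _ g(2)[OF x]]) (simp add: sums_unique[OF g(1)])
  moreover have "norm (suminf (F x)) \<le> 2 * \<mu>" using tail[OF x, of 0] by simp
  ultimately show ?thesis unfolding f_def by (intro that)
qed

text \<open>The variational principle with \<open>R i = N\<close>. The series of bumps is Lipschitz
  for \<open>N\<close> with constant \<open>2 * \<eta>\<close>. Adding
  \<open>(\<alpha> + 2 * \<eta>) * N (v - v0)\<close> to \<open>f\<close> beforehand yields the
  estimate relative to \<open>v0\<close>: comparison with \<open>v0\<close> loses
  \<open>2 * \<eta>\<close> and leaves \<open>\<alpha>\<close>. For the slope the constants add up
  to \<open>\<beta> = \<alpha> + 4 * \<eta>\<close>.\<close>

lemma ekeland:
  fixes S :: "'b::banach set" and f :: "'b \<Rightarrow> real" and N :: "'b \<Rightarrow> real"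
  assumes S: "closed S" "v0 \<in> S" and f: "continuous_on S f" "\<And>v. v \<in> S \<Longrightarrow> 0 \<le> f v"
    and tri: "\<And>u v. N (u + v) \<le> N u + N v" and sym: "\<And>u. N (- u) = N u"
    and bounds: "c > 0" "\<And>u. c * norm u \<le> N u" "\<And>u. N u \<le> L * norm u"
    and \<lambda>: "0 < \<alpha>" "\<alpha> < \<beta>"
  obtains vh where "vh \<in> S" "\<And>v. v \<in> S \<Longrightarrow> f vh \<le> f v + \<beta> * N (v - vh)" "f vh + \<alpha> * N (vh - v0) \<le> f v0"
proof -
  have N0: "N 0 = 0" using bounds(2)[of 0] bounds(3)[of 0] by simp
  have Npos: "N u \<ge> 0" for u 
    by (rule order_trans[OF _ bounds(2)[of u]]) (use bounds(1) in simp)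
  have tri': "N (u - w) \<le> N (v - w) + N (u - v)" for u v w using tri[of "v - w" "u - v"] by simp
  have Ncomm: "N (u - v) = N (v - u)" for u v using sym[of "u - v"] by simp
  define L' where "L' = max 0 L"
  have N_L': "N u \<le> L' * norm u" for u
    using bounds(3)[of u] mult_right_mono[of L L' "norm u"] by (simp add: L'_def)
  have Nlip: "\<bar>N u - N v\<bar> \<le> L' * norm (u - v)" for u v
  proof -
    have "N u - N v \<le> L' * norm (u - v)" using tri[of v "u - v"] N_L'[of "u - v"] by simp
    moreover have "N v - N u \<le> L' * norm (u - v)"
      using tri[of u "v - u"] N_L'[of "v - u"] by (simp add: norm_minus_commute)
    ultimately show ?thesis by (simp add: abs_le_iff)
  qed
  have contN: "continuous_on S (\<lambda>v. N (v - v0))"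
  proof (rule continuous_on_subset[OF lipschitz_on_continuous_on[of L']])
    show "L'-lipschitz_on UNIV (\<lambda>v. N (v - v0))"
      by (rule lipschitz_onI) (use Nlip[of "_ - v0" "_ - v0"] in \<open>auto simp: dist_norm L'_def\<close>)
  qed simp
  define \<eta> where "\<eta> = (\<beta> - \<alpha>) / 4"
  have \<eta>: "\<eta> > 0" using \<lambda> by (simp add: \<eta>_def)
  define f' where "f' v = f v + (\<alpha> + 2 * \<eta>) * N (v - v0)" for v
  have f'cont: "continuous_on S f'" unfolding f'_def[abs_def] by (intro continuous_intros f contN)
  have f'pos: "0 \<le> f' v" if "v \<in> S" for v
    unfolding f'_def using f(2)[OF that] Npos \<lambda> \<eta> by (intro add_nonneg_nonneg mult_nonneg_nonneg) auto
  have lower: "c * norm u - (1/2)^i \<le> N u" for u and i :: nat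
    using bounds(2)[of u] zero_le_power[of "1/2::real" i] by linarith
  have zero: "N 0 \<le> (1/2)^i" for i :: nat by (simp add: N0)
  have "L' \<ge> 0" by (simp add: L'_def)
  obtain w vh where vh: "vh \<in> S" "\<And>v. summable (\<lambda>i. \<eta> * (1/2)^i * N (v - w i))"
    "\<And>v. v \<in> S \<Longrightarrow> f' vh + (\<Sum>i. \<eta> * (1/2)^i * N (vh - w i)) \<le> f' v + (\<Sum>i. \<eta> * (1/2)^i * N (v - w i))"
    by (rule variational_principle[OF S f'cont f'pos bounds(1) \<eta> \<open>L' \<ge> 0\<close>, of "\<lambda>_. N",
          OF _ Nlip lower zero]) (assumption, rule that)
  have geo: "summable (\<lambda>i. \<eta> * (1/2::real)^i)" by (intro summable_mult summable_geometric) simp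
  have geosum: "(\<Sum>i. \<eta> * (1/2::real)^i) = 2 * \<eta>"
    using suminf_mult[OF summable_geometric, of "1/2::real" \<eta>] suminf_geometric[of "1/2::real"] by simp
  have pert: "(\<Sum>i. \<eta> * (1/2)^i * N (v - w i)) \<le> (\<Sum>i. \<eta> * (1/2)^i * N (vh - w i)) + 2 * \<eta> * N (v - vh)" for v
  proof -
    have "(\<Sum>i. \<eta> * (1/2)^i * N (v - w i)) \<le> (\<Sum>i. \<eta> * (1/2)^i * N (vh - w i) + \<eta> * (1/2)^i * N (v - vh))"
    proof (rule suminf_le)
      show "\<eta> * (1/2)^i * N (v - w i) \<le> \<eta> * (1/2)^i * N (vh - w i) + \<eta> * (1/2)^i * N (v - vh)" for i
        unfolding distrib_left[symmetric] using \<eta> by (intro mult_left_mono tri') auto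
    qed (intro summable_add vh(2) summable_mult2 geo)+
    also have "\<dots> = (\<Sum>i. \<eta> * (1/2)^i * N (vh - w i)) + (\<Sum>i. \<eta> * (1/2)^i * N (v - vh))"
      by (intro suminf_add[symmetric] vh(2) summable_mult2 geo)
    also have "(\<Sum>i. \<eta> * (1/2)^i * N (v - vh)) = 2 * \<eta> * N (v - vh)"
      by (simp only: suminf_mult2[OF geo, symmetric] geosum)
    finally show ?thesis .
  qed
  show ?thesis
  proof (rule that[OF vh(1)])
    fix v assume v: "v \<in> S"
    have "(\<alpha> + 2 * \<eta>) * N (v - v0) \<le> (\<alpha> + 2 * \<eta>) * (N (vh - v0) + N (v - vh))"
      using \<lambda> \<eta> by (intro mult_left_mono tri') auto
    moreover have "f vh + (\<alpha> + 2 * \<eta>) * N (vh - v0) \<le> f v + (\<alpha> + 2 * \<eta>) * N (v - v0) + 2 * \<eta> * N (v - vh)"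
      using vh(3)[OF v] pert[of v] unfolding f'_def by linarith
    moreover have "\<beta> = \<alpha> + 4 * \<eta>" by (simp add: \<eta>_def field_simps)
    ultimately show "f vh \<le> f v + \<beta> * N (v - vh)" by (simp add: algebra_simps)
  next
    have "f vh + (\<alpha> + 2 * \<eta>) * N (vh - v0) \<le> f v0 + (\<alpha> + 2 * \<eta>) * N (v0 - v0) + 2 * \<eta> * N (v0 - vh)"
      using vh(3)[OF S(2)] pert[of v0] unfolding f'_def by linarith
    then show "f vh + \<alpha> * N (vh - v0) \<le> f v0"
      by (simp add: N0 Ncomm[of v0 vh] algebra_simps)
  qed
qed

lemma norm_component_le:
  fixes a b c d e :: "'a::real_normed_vector"
  shows "norm a \<le> norm (a, b, c, d, e)" "norm b \<le> norm (a, b, c, d, e)" "norm c \<le> norm (a, b, c, d, e)"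
    "norm d \<le> norm (a, b, c, d, e)" "norm e \<le> norm (a, b, c, d, e)"
    "norm a \<le> norm (a, b, c)" "norm b \<le> norm (a, b, c)" "norm c \<le> norm (a, b, c)"
  using norm_fst_le[of a "(b, c, d, e)"] norm_snd_le[of "(b, c, d, e)" a]
    norm_fst_le[of b "(c, d, e)"] norm_snd_le[of "(c, d, e)" b]
    norm_fst_le[of c "(d, e)"] norm_snd_le[of "(d, e)" c] norm_fst_le[of d e] norm_snd_le[of e d]
    norm_fst_le[of a "(b, c)"] norm_snd_le[of "(b, c)" a] norm_fst_le[of b c] norm_snd_le[of c b]
  by linarith+

lemma lipschitz_imp_continuous_on:
  fixes \<theta> :: "'a::real_normed_vector \<Rightarrow> real"
  assumes "\<And>x y. \<bar>\<theta> x - \<theta> y\<bar> \<le> norm (x - y)"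
  shows "continuous_on S \<theta>"
  unfolding continuous_on_iff dist_norm real_norm_def
  using assms by (meson order_le_less_trans)

text \<open>The bumps on the product space are sums of five such functions, one per coordinate, so
  the error \<open>(1/2)^i / 5\<close> in each matches the error \<open>(1/2)^i\<close> that
  \<open>variational_principle\<close> tolerates.\<close>

locale norm_series =
  fixes Y :: "'a::banach set" and \<theta> :: "nat \<Rightarrow> 'a \<Rightarrow> real" and \<mu> :: real
  assumes Y: "subspace Y" and \<mu>: "\<mu> > 0"
    and lip: "\<And>i x y. \<bar>\<theta> i x - \<theta> i y\<bar> \<le> norm (x - y)"
    and le: "\<And>i x. \<theta> i x \<le> norm x"
    and ge: "\<And>i x. norm x - (1/2)^i / 5 \<le> \<theta> i x"
    and diff: "\<And>i y. y \<in> Y \<Longrightarrow> \<exists>D. norm D \<le> 1 \<and> (\<theta> i has_derivative blinfun_apply D) (at y within Y)"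
begin

definition \<pi> :: "(nat \<Rightarrow> 'a) \<Rightarrow> 'a \<Rightarrow> real" where
  "\<pi> u t = (\<Sum>i. \<mu> * (1/2)^i * \<theta> i (t - u i))"

lemma geo: "summable (\<lambda>i. \<mu> * (1/2::real)^i)" "(\<Sum>i. \<mu> * (1/2::real)^i) = 2 * \<mu>"
  using suminf_mult[OF summable_geometric, of "1/2::real" \<mu>] suminf_geometric[of "1/2::real"]
  by (auto intro: summable_mult summable_geometric)

lemma abs_le: "\<bar>\<theta> i x\<bar> \<le> norm x + 1"
proof -
  have "(1/2::real)^i \<le> 1" by (simp add: power_le_one)
  then show ?thesis using le[of i x] ge[of x i] norm_ge_zero[of x] by linarith
qed

lemma summable_\<pi>: assumes "\<And>i. norm (u i) \<le> K" shows "summable (\<lambda>i. \<mu> * (1/2)^i * \<theta> i (t - u i))"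
proof (rule summable_comparison_test'[OF summable_mult2[OF geo(1), of "norm t + K + 1"], of 0])
  fix i
  have "norm (t - u i) \<le> norm t + K" using norm_triangle_ineq4[of t "u i"] assms[of i] by linarith
  then have "\<bar>\<theta> i (t - u i)\<bar> \<le> norm t + K + 1" using abs_le[of i "t - u i"] by linarith
  then show "norm (\<mu> * (1/2)^i * \<theta> i (t - u i)) \<le> \<mu> * (1/2)^i * (norm t + K + 1)"
    using \<mu> by (simp add: abs_mult mult_left_mono)
qed

lemma \<pi>_lipschitz: assumes "\<And>i. norm (u i) \<le> K" shows "\<pi> u s \<le> \<pi> u t + 2 * \<mu> * norm (s - t)"
proof -
  have "\<pi> u s \<le> (\<Sum>i. \<mu> * (1/2)^i * \<theta> i (t - u i) + \<mu> * (1/2)^i * norm (s - t))"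
    unfolding \<pi>_def
  proof (rule suminf_le)
    fix i
    have "\<theta> i (s - u i) \<le> \<theta> i (t - u i) + norm (s - t)"
      using lip[of i "s - u i" "t - u i"] by (simp add: abs_le_iff)
    then show "\<mu> * (1/2)^i * \<theta> i (s - u i) \<le> \<mu> * (1/2)^i * \<theta> i (t - u i) + \<mu> * (1/2)^i * norm (s - t)"
      unfolding distrib_left[symmetric] using \<mu> by (intro mult_left_mono) auto
  qed (intro summable_add summable_mult2 geo summable_\<pi>[OF assms])+
  also have "\<dots> = \<pi> u t + (\<Sum>i. \<mu> * (1/2)^i * norm (s - t))"
    unfolding \<pi>_def by (intro suminf_add[symmetric] summable_mult2 geo summable_\<pi>[OF assms])
  also have "(\<Sum>i. \<mu> * (1/2)^i * norm (s - t)) = 2 * \<mu> * norm (s - t)"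
    by (simp only: suminf_mult2[OF geo(1), symmetric] geo(2))
  finally show ?thesis .
qed

lemma \<pi>_derivative:
  assumes "\<And>i. norm (u i) \<le> K" "\<And>i. u i \<in> Y" "t \<in> Y"
  obtains E where "norm E \<le> 2 * \<mu>" "(\<pi> u has_derivative blinfun_apply E) (at t within Y)"
proof -
  obtain E where "norm E \<le> 2 * \<mu>"
    "((\<lambda>y. \<Sum>i. \<mu> * (1/2)^i * \<theta> i (y - u i)) has_derivative blinfun_apply E) (at t within Y)"
    by (rule weighted_series_derivative[OF Y less_imp_le[OF \<mu>] assms(2,3) diff summable_\<pi>[OF assms(1)]])
      (assumption, rule that)
  then show ?thesis by (intro that) (simp_all add: \<pi>_def[abs_def])
qed

end

text \<open>
  The points \<open>p\<close>, \<open>q\<close> are decoupled copies of \<open>a - x - s\<close>, \<open>b - x - s\<close>; the factor \<open>2\<close> in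
  front of the coupling terms makes the penalty exact, since the maximum of norms is \<open>1\<close>-Lipschitz in each variable.
\<close>

lemma approximate_multipliers:
  fixes A B M :: "'a::banach set"
  assumes asp: "asplund_space TYPE('a)" and M: "countable M" "subspace (closure M)"
    and AB: "closed A" "closed B"
    and pts: "ah \<in> A \<inter> closure M" "bh \<in> B \<inter> closure M" "x \<in> closure M"
    and nonneg: "\<kappa> \<ge> 0" "\<beta> \<ge> 0" and e: "e > 0"
    and min: "\<And>a b s. a \<in> A \<Longrightarrow> b \<in> B \<Longrightarrow>
      max (norm (ah - x)) (norm (bh - x)) \<le> max (norm (a - x - s)) (norm (b - x - s)) + \<beta> * norm s
        + \<kappa> * (norm (a - ah) + norm (b - bh))"
  obtains a b p q and \<nu>1 \<nu>2 y1 y2 :: "'a \<Rightarrow>\<^sub>L real" where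
    "a \<in> A \<inter> closure M" "b \<in> B \<inter> closure M" "p \<in> closure M" "q \<in> closure M"
    "norm (a - ah) < e" "norm (b - bh) < e" "norm (p - (ah - x)) < e" "norm (q - (bh - x)) < e"
    "normal_within (A \<inter> closure M) a \<nu>1" "normal_within (B \<inter> closure M) b \<nu>2"
    "\<And>h k. h \<in> closure M \<Longrightarrow> k \<in> closure M \<Longrightarrow>
      max (norm p) (norm q) + y1 h + y2 k \<le> max (norm (p + h)) (norm (q + k))"
    "\<And>h. h \<in> closure M \<Longrightarrow> y1 h + y2 h \<le> (\<beta> + e) * norm h"
    "\<And>h. \<nu>1 h + y1 h \<le> (\<kappa> + e) * norm h" "\<And>h. \<nu>2 h + y2 h \<le> (\<kappa> + e) * norm h"
proof -
  define Y where "Y = closure M"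
  have Y: "subspace Y" and clY: "closed Y" using M by (auto simp: Y_def)
  note in_Y = subspace_0[OF Y] subspace_diff[OF Y] subspace_add[OF Y] subspace_scale[OF Y]
  have pts': "ah \<in> A" "bh \<in> B" "ah \<in> Y" "bh \<in> Y" "x \<in> Y" using pts by (auto simp: Y_def)
  \<comment> \<open>Half of \<open>e\<close>, so that the slope \<open>e1\<close> built into the
    functional and the slopes of the perturbation stay within \<open>e\<close> together. The bound 1
    is for \<open>e1 * (U + V) \<le> U + V\<close>.\<close>
  define e1 where "e1 = min e 1 / 2"
  have e1: "e1 > 0" "e1 \<le> 1" "e1 \<le> e / 2" using e by (auto simp: e1_def)
  \<comment> \<open>\<open>C * \<tau>\<close> is the total loss from replacing norms by
    \<open>\<theta>\<close>: two terms with factor \<open>\<kappa> + e1\<close> and two coupling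
    terms with factor 2.\<close>
  define C where "C = 2 * (\<kappa> + e1) + 4"
  have C: "C > 0" using nonneg e1 by (simp add: C_def)
  define \<tau> where "\<tau> = e1 * e1 / (8 * C)"
  have \<tau>: "\<tau> > 0" "C * \<tau> = e1 * e1 / 8" using e1 C by (auto simp: \<tau>_def)
  \<comment> \<open>The perturbation changes by at most \<open>2 * \<mu> * (3 * T)\<close>, half of
    the growth \<open>e1 * T\<close> of the functional. With \<open>C * \<tau> = e1 * e1 / 8\<close>
    this leaves \<open>T \<le> e1 / 4\<close> at the minimiser.\<close>
  define \<mu> where "\<mu> = e1 / 12"
  have \<mu>: "\<mu> > 0" using e1 by (simp add: \<mu>_def)
  obtain \<theta> :: "'a \<Rightarrow> real" where \<theta>: "\<And>x y. \<bar>\<theta> x - \<theta> y\<bar> \<le> norm (x - y)"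
    "\<And>x. \<theta> x \<le> norm x" "\<And>x. norm x - \<tau> \<le> \<theta> x"
    "\<And>x. x \<in> Y \<Longrightarrow> \<exists>D. norm D \<le> 1 \<and> (\<theta> has_derivative blinfun_apply D) (at x within Y)"
    unfolding Y_def by (rule smooth_norm_approximation[OF asp M \<tau>(1)]) (rule that, unfold Y_def)
  have "\<forall>i::nat. \<exists>\<theta> :: 'a \<Rightarrow> real. (\<forall>x y. \<bar>\<theta> x - \<theta> y\<bar> \<le> norm (x - y)) \<and> (\<forall>x. \<theta> x \<le> norm x)
    \<and> (\<forall>x. norm x - (1/2)^i / 5 \<le> \<theta> x)
    \<and> (\<forall>x\<in>Y. \<exists>D. norm D \<le> 1 \<and> (\<theta> has_derivative blinfun_apply D) (at x within Y))"
  proof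
    fix i :: nat
    have "(1/2::real)^i / 5 > 0" by simp
    then obtain t :: "'a \<Rightarrow> real" where "\<And>x y. \<bar>t x - t y\<bar> \<le> norm (x - y)"
      "\<And>x. t x \<le> norm x" "\<And>x. norm x - (1/2)^i / 5 \<le> t x"
      "\<And>x. x \<in> Y \<Longrightarrow> \<exists>D. norm D \<le> 1 \<and> (t has_derivative blinfun_apply D) (at x within Y)"
      unfolding Y_def by (rule smooth_norm_approximation[OF asp M]) (rule that, unfold Y_def)
    then show "\<exists>\<theta> :: 'a \<Rightarrow> real. (\<forall>x y. \<bar>\<theta> x - \<theta> y\<bar> \<le> norm (x - y)) \<and> (\<forall>x. \<theta> x \<le> norm x)
      \<and> (\<forall>x. norm x - (1/2)^i / 5 \<le> \<theta> x)
      \<and> (\<forall>x\<in>Y. \<exists>D. norm D \<le> 1 \<and> (\<theta> has_derivative blinfun_apply D) (at x within Y))" by blast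
  qed
  from choice[OF this] obtain \<psi> where \<psi>: "\<forall>i::nat. (\<forall>x y. \<bar>\<psi> i x - \<psi> i y\<bar> \<le> norm (x - y)) \<and> (\<forall>x. \<psi> i x \<le> norm x)
    \<and> (\<forall>x. norm x - (1/2)^i / 5 \<le> \<psi> i x)
    \<and> (\<forall>x\<in>Y. \<exists>D. norm D \<le> 1 \<and> (\<psi> i has_derivative blinfun_apply D) (at x within Y))" ..
  interpret norm_series Y \<psi> \<mu>
    by (unfold_locales; (rule Y \<mu>)?) (use \<psi> in blast)+
  define r where "r = max (norm (ah - x)) (norm (bh - x))"
  define \<Phi> where "\<Phi> a b p q s = max (norm p) (norm q) + (\<beta> + e1) * norm s
    + (\<kappa> + e1) * (\<theta> (a - ah) + \<theta> (b - bh)) + 2 * (\<theta> (a - x - s - p) + \<theta> (b - x - s - q))" for a b p q s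
  define T where "T a b p q s = norm (a - ah) + norm (b - bh) + norm s + norm (a - x - s - p) + norm (b - x - s - q)"
    for a b p q s
  \<comment> \<open>Of the two copies of \<open>U + V\<close>, one undoes the decoupling through the
    Lipschitz bound on the maximum and the other supplies the growth \<open>e1 * (U + V)\<close>.
    The extra \<open>e1\<close> in the remaining coefficients supplies the rest of the
    growth.\<close>
  have \<Phi>_lower: "r + e1 * T a b p q s - C * \<tau> \<le> \<Phi> a b p q s" if "a \<in> A" "b \<in> B" for a b p q s
  proof -
    define P where "P = norm (a - ah) + norm (b - bh)"
    define U where "U = norm (a - x - s - p)"
    define V where "V = norm (b - x - s - q)"
    have UV: "U \<ge> 0" "V \<ge> 0" by (auto simp: U_def V_def)
    have 1: "r \<le> max (norm (a - x - s)) (norm (b - x - s)) + \<beta> * norm s + \<kappa> * P"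
      using min[OF that, of s] by (simp add: r_def P_def)
    have 2: "max (norm (a - x - s)) (norm (b - x - s)) \<le> max (norm p) (norm q) + U + V"
      using norm_triangle_sub[of "a - x - s" p] norm_triangle_sub[of "b - x - s" q] UV
      unfolding U_def V_def by linarith
    have 3: "(\<kappa> + e1) * (P - 2 * \<tau>) \<le> (\<kappa> + e1) * (\<theta> (a - ah) + \<theta> (b - bh))"
      using \<theta>(3)[of "a - ah"] \<theta>(3)[of "b - bh"] nonneg e1 unfolding P_def by (intro mult_left_mono) auto
    have 4: "U + V - 2 * \<tau> \<le> \<theta> (a - x - s - p) + \<theta> (b - x - s - q)"
      using \<theta>(3)[of "a - x - s - p"] \<theta>(3)[of "b - x - s - q"] unfolding U_def V_def by linarith
    have 5: "e1 * (U + V) \<le> U + V" using mult_right_mono[OF e1(2), of "U + V"] UV by simp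
    define Z where "Z = (\<kappa> + e1) * (\<theta> (a - ah) + \<theta> (b - bh))"
    define W where "W = \<theta> (a - x - s - p) + \<theta> (b - x - s - q)"
    define m where "m = max (norm p) (norm q)"
    have "r + e1 * T a b p q s - C * \<tau>
        = r + (e1 * P + e1 * norm s + e1 * (U + V)) - (2 * (\<kappa> * \<tau>) + 2 * (e1 * \<tau>) + 4 * \<tau>)"
      by (simp add: T_def P_def U_def V_def C_def algebra_simps)
    also have "\<dots> \<le> (m + (U + V) + \<beta> * norm s + \<kappa> * P) + (e1 * P + e1 * norm s + (U + V))
        - (2 * (\<kappa> * \<tau>) + 2 * (e1 * \<tau>) + 4 * \<tau>)"
      using order_trans[OF 1 add_right_mono[OF add_right_mono[OF 2]]] 5 unfolding m_def by simp
    also have "\<dots> = m + (\<beta> + e1) * norm s + (\<kappa> + e1) * (P - 2 * \<tau>) + 2 * (U + V - 2 * \<tau>)"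
      by (simp add: algebra_simps)
    also have "\<dots> \<le> m + (\<beta> + e1) * norm s + Z + 2 * W"
      by (rule add_mono[OF add_left_mono[OF 3[folded Z_def]] mult_left_mono[OF 4[folded W_def]]]) simp
    finally show ?thesis unfolding \<Phi>_def m_def Z_def W_def .
  qed
  have \<Phi>_start: "\<Phi> ah bh (ah - x) (bh - x) 0 \<le> r"
  proof -
    have "\<theta> 0 \<le> 0" using \<theta>(2)[of 0] by simp
    then have "(\<kappa> + e1) * (\<theta> 0 + \<theta> 0) \<le> 0" using nonneg e1 by (intro mult_nonneg_nonpos) auto
    moreover have "2 * (\<theta> 0 + \<theta> 0) \<le> 0" using \<open>\<theta> 0 \<le> 0\<close> by simp
    ultimately have "(\<kappa> + e1) * (\<theta> 0 + \<theta> 0) + 2 * (\<theta> 0 + \<theta> 0) \<le> 0" by (rule add_nonpos_nonpos)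
    moreover have "\<Phi> ah bh (ah - x) (bh - x) 0 = r + ((\<kappa> + e1) * (\<theta> 0 + \<theta> 0) + 2 * (\<theta> 0 + \<theta> 0))"
      unfolding \<Phi>_def r_def by (simp only: diff_self diff_zero norm_zero mult_zero_right add_0_right add.assoc)
    ultimately show ?thesis by linarith
  qed
  define S where "S = (A \<inter> Y) \<times> (B \<inter> Y) \<times> Y \<times> Y \<times> Y"
  define v0 where "v0 = (ah, bh, ah - x, bh - x, 0 :: 'a)"
  define F where "F = (\<lambda>(a, b, p, q, s). \<Phi> a b p q s)"
  define R where "R i = (\<lambda>(a, b, p, q, s). \<psi> i a + \<psi> i b + \<psi> i p + \<psi> i q + \<psi> i s)" for i
  have "closed S" unfolding S_def by (intro closed_Times closed_Int AB clY)
  have "v0 \<in> S" using pts' in_Y by (simp add: S_def v0_def)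
  have cont\<theta>: "continuous_on X (\<lambda>v. \<theta> (g v))" if "continuous_on X g" for X and g :: "'b::topological_space \<Rightarrow> 'a"
    by (rule continuous_on_compose2[OF lipschitz_imp_continuous_on[OF \<theta>(1)] that]) auto
  have contF: "continuous_on S F"
    unfolding F_def \<Phi>_def split_def by (intro continuous_intros cont\<theta>)
  have Flow: "- C * \<tau> \<le> F v" if "v \<in> S" for v
  proof -
    obtain a b p q s where v: "v = (a, b, p, q, s)" by (cases v)
    have "r \<ge> 0" by (simp add: r_def le_max_iff_disj)
    moreover have "e1 * T a b p q s \<ge> 0" using e1 by (simp add: T_def)
    ultimately show ?thesis using \<Phi>_lower[of a b p q s] that unfolding v F_def S_def by simp
  qed
  have R_lip: "\<bar>R i u - R i v\<bar> \<le> 5 * norm (u - v)" for i u v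
  proof -
    obtain u1 u2 u3 u4 u5 where u: "u = (u1, u2, u3, u4, u5)" by (cases u)
    obtain v1 v2 v3 v4 v5 where v: "v = (v1, v2, v3, v4, v5)" by (cases v)
    define w where "w = u - v"
    have w: "w = (u1 - v1, u2 - v2, u3 - v3, u4 - v4, u5 - v5)" by (simp add: w_def u v)
    have "norm (u1 - v1) \<le> norm w" "norm (u2 - v2) \<le> norm w" "norm (u3 - v3) \<le> norm w"
      "norm (u4 - v4) \<le> norm w" "norm (u5 - v5) \<le> norm w" unfolding w by (rule norm_component_le)+
    then have "\<bar>R i u - R i v\<bar> \<le> 5 * norm w"
      using lip[of i u1 v1] lip[of i u2 v2] lip[of i u3 v3] lip[of i u4 v4] lip[of i u5 v5]
      unfolding R_def u v prod.case by linarith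
    then show ?thesis unfolding w_def .
  qed
  have R_low: "1 * norm u - (1/2)^i \<le> R i u" for i u
  proof -
    obtain u1 u2 u3 u4 u5 where u: "u = (u1, u2, u3, u4, u5)" by (cases u)
    have "norm u \<le> norm u1 + (norm u2 + (norm u3 + (norm u4 + norm u5)))"
      unfolding u by (intro order_trans[OF norm_Pair_le] add_left_mono order_refl)
    then show ?thesis
      using ge[of u1 i] ge[of u2 i] ge[of u3 i] ge[of u4 i] ge[of u5 i] unfolding R_def u prod.case by linarith
  qed
  have R_zero: "R i 0 \<le> (1/2)^i" for i
  proof -
    have "R i 0 \<le> 0" using le[of i 0] by (simp add: R_def zero_prod_def)
    then show ?thesis using zero_le_power[of "1/2::real" i] by linarith
  qed
  obtain w vh K where w: "\<And>n. w n \<in> S" "\<And>n. norm (w n) \<le> K" and vh: "vh \<in> S"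
    and vmin: "\<And>v. v \<in> S \<Longrightarrow> F vh + (\<Sum>i. \<mu> * (1/2)^i * R i (vh - w i)) \<le> F v + (\<Sum>i. \<mu> * (1/2)^i * R i (v - w i))"
    by (rule variational_principle[OF \<open>closed S\<close> \<open>v0 \<in> S\<close> contF Flow zero_less_one \<mu>, of 5 R,
          OF _ _ R_lip R_low R_zero]) (assumption, simp, rule that)
  define w1 where "w1 i = fst (w i)" for i
  define w2 where "w2 i = fst (snd (w i))" for i
  define w3 where "w3 i = fst (snd (snd (w i)))" for i
  define w4 where "w4 i = fst (snd (snd (snd (w i))))" for i
  define w5 where "w5 i = snd (snd (snd (snd (w i))))" for i
  have w_eq: "w i = (w1 i, w2 i, w3 i, w4 i, w5 i)" for i
    by (simp add: w1_def w2_def w3_def w4_def w5_def)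
  have wY: "w1 i \<in> Y" "w2 i \<in> Y" "w3 i \<in> Y" "w4 i \<in> Y" "w5 i \<in> Y" for i
    using w(1)[of i] unfolding w_eq S_def by auto
  have wK: "norm (w1 i) \<le> K" "norm (w2 i) \<le> K" "norm (w3 i) \<le> K" "norm (w4 i) \<le> K" "norm (w5 i) \<le> K" for i
    using w(2)[of i] unfolding w_eq by (rule order_trans[OF norm_component_le(1)] order_trans[OF norm_component_le(2)]
        order_trans[OF norm_component_le(3)] order_trans[OF norm_component_le(4)] order_trans[OF norm_component_le(5)])+
  have pert: "(\<Sum>i. \<mu> * (1/2)^i * R i ((a, b, p, q, s) - w i)) = \<pi> w1 a + \<pi> w2 b + \<pi> w3 p + \<pi> w4 q + \<pi> w5 s"
    for a b p q s
  proof -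
    have "(\<lambda>i. \<mu> * (1/2)^i * \<psi> i (a - w1 i) + \<mu> * (1/2)^i * \<psi> i (b - w2 i) + \<mu> * (1/2)^i * \<psi> i (p - w3 i)
      + \<mu> * (1/2)^i * \<psi> i (q - w4 i) + \<mu> * (1/2)^i * \<psi> i (s - w5 i)) sums
      (\<pi> w1 a + \<pi> w2 b + \<pi> w3 p + \<pi> w4 q + \<pi> w5 s)"
      unfolding \<pi>_def by (intro sums_add summable_sums summable_\<pi>[OF wK(1)] summable_\<pi>[OF wK(2)]
          summable_\<pi>[OF wK(3)] summable_\<pi>[OF wK(4)] summable_\<pi>[OF wK(5)])
    moreover have "\<mu> * (1/2)^i * \<psi> i (a - w1 i) + \<mu> * (1/2)^i * \<psi> i (b - w2 i) + \<mu> * (1/2)^i * \<psi> i (p - w3 i)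
      + \<mu> * (1/2)^i * \<psi> i (q - w4 i) + \<mu> * (1/2)^i * \<psi> i (s - w5 i)
      = \<mu> * (1/2)^i * R i ((a, b, p, q, s) - w i)" for i
      by (simp add: R_def w_eq distrib_left)
    ultimately show ?thesis by (simp add: sums_iff)
  qed
  obtain a b p q s where vh_eq: "vh = (a, b, p, q, s)" by (cases vh)
  have mem: "a \<in> A" "a \<in> Y" "b \<in> B" "b \<in> Y" "p \<in> Y" "q \<in> Y" "s \<in> Y"
    using vh unfolding vh_eq S_def by auto
  have vmin': "\<Phi> a b p q s + (\<pi> w1 a + \<pi> w2 b + \<pi> w3 p + \<pi> w4 q + \<pi> w5 s)
    \<le> \<Phi> a' b' p' q' s' + (\<pi> w1 a' + \<pi> w2 b' + \<pi> w3 p' + \<pi> w4 q' + \<pi> w5 s')"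
    if "a' \<in> A \<inter> Y" "b' \<in> B \<inter> Y" "p' \<in> Y" "q' \<in> Y" "s' \<in> Y" for a' b' p' q' s'
    using vmin[of "(a', b', p', q', s')"] that unfolding vh_eq pert F_def S_def prod.case by simp
  have Tsmall: "T a b p q s \<le> e1 / 4"
  proof -
    let ?T = "T a b p q s"
    have np: "norm (ah - x - p) \<le> norm (a - ah) + norm s + norm (a - x - s - p)"
    proof -
      have eq: "ah - x - p = - (a - ah) + s + (a - x - s - p)" by simp
      show ?thesis unfolding eq using norm_triangle_ineq[of "- (a - ah) + s" "a - x - s - p"]
          norm_triangle_ineq[of "- (a - ah)" s] unfolding norm_minus_cancel by linarith
    qed
    have nq: "norm (bh - x - q) \<le> norm (b - bh) + norm s + norm (b - x - s - q)"
    proof -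
      have eq: "bh - x - q = - (b - bh) + s + (b - x - s - q)" by simp
      show ?thesis unfolding eq using norm_triangle_ineq[of "- (b - bh) + s" "b - x - s - q"]
          norm_triangle_ineq[of "- (b - bh)" s] unfolding norm_minus_cancel by linarith
    qed
    have "\<Phi> a b p q s + (\<pi> w1 a + \<pi> w2 b + \<pi> w3 p + \<pi> w4 q + \<pi> w5 s)
      \<le> \<Phi> ah bh (ah - x) (bh - x) 0 + (\<pi> w1 ah + \<pi> w2 bh + \<pi> w3 (ah - x) + \<pi> w4 (bh - x) + \<pi> w5 0)"
      by (rule vmin') (use pts' in_Y in auto)
    moreover have "\<pi> w1 ah \<le> \<pi> w1 a + 2 * \<mu> * norm (ah - a)" "\<pi> w2 bh \<le> \<pi> w2 b + 2 * \<mu> * norm (bh - b)"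
      "\<pi> w3 (ah - x) \<le> \<pi> w3 p + 2 * \<mu> * norm (ah - x - p)" "\<pi> w4 (bh - x) \<le> \<pi> w4 q + 2 * \<mu> * norm (bh - x - q)"
      "\<pi> w5 0 \<le> \<pi> w5 s + 2 * \<mu> * norm (0 - s)"
      by (rule \<pi>_lipschitz, rule wK)+
    ultimately have "\<Phi> a b p q s \<le> r + 2 * \<mu> * (norm (ah - a) + norm (bh - b) + norm (ah - x - p) + norm (bh - x - q) + norm (0 - s))"
      using \<Phi>_start unfolding distrib_left by linarith
    also have "\<dots> \<le> r + 2 * \<mu> * (3 * ?T)"
    proof -
      have "norm (ah - a) = norm (a - ah)" "norm (bh - b) = norm (b - bh)" "norm (0 - s) = norm s"
        by (simp_all add: norm_minus_commute)
      then have "norm (ah - a) + norm (bh - b) + norm (ah - x - p) + norm (bh - x - q) + norm (0 - s) \<le> 3 * ?T"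
        using np nq norm_ge_zero[of "a - ah"] norm_ge_zero[of "b - bh"] norm_ge_zero[of "a - x - s - p"]
          norm_ge_zero[of "b - x - s - q"] unfolding T_def distrib_left by linarith
      then show ?thesis using \<mu> by (intro add_left_mono mult_left_mono) auto
    qed
    finally have "e1 * ?T - C * \<tau> \<le> 6 * \<mu> * ?T" using \<Phi>_lower[OF mem(1,3), of p q s] by simp
    then have "e1 * ?T \<le> e1 * (e1 / 4)" by (simp add: \<mu>_def \<tau>(2))
    then show ?thesis using e1 by (simp only: mult_le_cancel_left_pos)
  qed
  have small: "norm (a - ah) < e" "norm (b - bh) < e" "norm (p - (ah - x)) < e" "norm (q - (bh - x)) < e"
  proof -
    have T: "norm (a - ah) + norm (b - bh) + norm s + norm (a - x - s - p) + norm (b - x - s - q) < e"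
      using Tsmall e1 unfolding T_def by linarith
    show "norm (a - ah) < e" "norm (b - bh) < e"
      using T norm_ge_zero[of "a - ah"] norm_ge_zero[of "b - bh"] norm_ge_zero[of "a - x - s - p"]
        norm_ge_zero[of "b - x - s - q"] norm_ge_zero[of s] by linarith+
    have eq: "p - (ah - x) = (a - ah) - s - (a - x - s - p)" "q - (bh - x) = (b - bh) - s - (b - x - s - q)" by simp_all
    have "norm (p - (ah - x)) \<le> norm (a - ah) + norm s + norm (a - x - s - p)"
      "norm (q - (bh - x)) \<le> norm (b - bh) + norm s + norm (b - x - s - q)"
      unfolding eq using norm_triangle_ineq4[of "(a - ah) - s" "a - x - s - p"] norm_triangle_ineq4[of "a - ah" s]
        norm_triangle_ineq4[of "(b - bh) - s" "b - x - s - q"] norm_triangle_ineq4[of "b - bh" s] by linarith+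
    then show "norm (p - (ah - x)) < e" "norm (q - (bh - x)) < e"
      using T norm_ge_zero[of "a - ah"] norm_ge_zero[of "b - bh"] norm_ge_zero[of "a - x - s - p"]
        norm_ge_zero[of "b - x - s - q"] by linarith+
  qed
  have uY: "a - x - s - p \<in> Y" "b - x - s - q \<in> Y" "a - ah \<in> Y" "b - bh \<in> Y"
    by (intro in_Y mem pts')+
  obtain Du where Du: "norm Du \<le> 1" "(\<theta> has_derivative blinfun_apply Du) (at (a - x - s - p) within Y)"
    using \<theta>(4)[OF uY(1)] by blast
  obtain Dv where Dv: "norm Dv \<le> 1" "(\<theta> has_derivative blinfun_apply Dv) (at (b - x - s - q) within Y)"
    using \<theta>(4)[OF uY(2)] by blast
  obtain Da where Da: "norm Da \<le> 1" "(\<theta> has_derivative blinfun_apply Da) (at (a - ah) within Y)"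
    using \<theta>(4)[OF uY(3)] by blast
  obtain Db where Db: "norm Db \<le> 1" "(\<theta> has_derivative blinfun_apply Db) (at (b - bh) within Y)"
    using \<theta>(4)[OF uY(4)] by blast
  obtain E1 where E1: "norm E1 \<le> 2 * \<mu>" "(\<pi> w1 has_derivative blinfun_apply E1) (at a within Y)"
    by (rule \<pi>_derivative[OF wK(1) wY(1) mem(2)]) (rule that)
  obtain E2 where E2: "norm E2 \<le> 2 * \<mu>" "(\<pi> w2 has_derivative blinfun_apply E2) (at b within Y)"
    by (rule \<pi>_derivative[OF wK(2) wY(2) mem(4)]) (rule that)
  obtain E3 where E3: "norm E3 \<le> 2 * \<mu>" "(\<pi> w3 has_derivative blinfun_apply E3) (at p within Y)"
    by (rule \<pi>_derivative[OF wK(3) wY(3) mem(5)]) (rule that)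
  obtain E4 where E4: "norm E4 \<le> 2 * \<mu>" "(\<pi> w4 has_derivative blinfun_apply E4) (at q within Y)"
    by (rule \<pi>_derivative[OF wK(4) wY(4) mem(6)]) (rule that)
  obtain E5 where E5: "norm E5 \<le> 2 * \<mu>" "(\<pi> w5 has_derivative blinfun_apply E5) (at s within Y)"
    by (rule \<pi>_derivative[OF wK(5) wY(5) mem(7)]) (rule that)
  have abs_E: "\<bar>E h\<bar> \<le> c * norm h" if "norm E \<le> c" for E :: "'a \<Rightarrow>\<^sub>L real" and c h
    using norm_blinfun[of E h] mult_right_mono[OF that norm_ge_zero[of h]] by simp
  \<comment> \<open>Minimality in the set variable alone: there the functional is smooth along
    \<open>Y\<close>, so minus its derivative is a Frechet normal to the set within
    \<open>Y\<close>.\<close>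
  have block: "normal_within (X \<inter> Y) z0 (- ((\<kappa> + e1) *\<^sub>R D1 + 2 *\<^sub>R D2 + E))"
    if z0: "z0 \<in> Y" "zh \<in> Y" "c \<in> Y" and D: "(\<theta> has_derivative blinfun_apply D1) (at (z0 - zh) within Y)"
      "(\<theta> has_derivative blinfun_apply D2) (at (z0 - c) within Y)" "(\<rho> has_derivative blinfun_apply E) (at z0 within Y)"
      and m: "\<And>z. z \<in> X \<inter> Y \<Longrightarrow> (\<kappa> + e1) * \<theta> (z0 - zh) + 2 * \<theta> (z0 - c) + \<rho> z0 \<le> (\<kappa> + e1) * \<theta> (z - zh) + 2 * \<theta> (z - c) + \<rho> z"
    for X z0 zh c D1 D2 E \<rho>
  proof (rule smooth_min_normal[where Y = Y and \<psi> = "\<lambda>z. (\<kappa> + e1) * \<theta> (z - zh) + 2 * \<theta> (z - c) + \<rho> z"])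
    have "((\<lambda>z. (\<kappa> + e1) * \<theta> (z - zh) + 2 * \<theta> (z - c) + \<rho> z) has_derivative
        (\<lambda>h. (\<kappa> + e1) * D1 h + 2 * D2 h + E h)) (at z0 within Y)"
      by (intro has_derivative_add has_derivative_mult_right D(3)
          has_derivative_chain_within[where Y = Y and g = "\<lambda>z. z - zh", OF D(1)]
          has_derivative_chain_within[where Y = Y and g = "\<lambda>z. z - c", OF D(2)])
        (use z0 in_Y in \<open>auto intro!: derivative_eq_intros\<close>)
    then show "((\<lambda>z. (\<kappa> + e1) * \<theta> (z - zh) + 2 * \<theta> (z - c) + \<rho> z) has_derivative
        blinfun_apply ((\<kappa> + e1) *\<^sub>R D1 + 2 *\<^sub>R D2 + E)) (at z0 within Y)"
      by (simp add: plus_blinfun.rep_eq scaleR_blinfun.rep_eq)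
  qed (use m in auto)
  define \<nu>1 where "\<nu>1 = - ((\<kappa> + e1) *\<^sub>R Da + 2 *\<^sub>R Du + E1)"
  define \<nu>2 where "\<nu>2 = - ((\<kappa> + e1) *\<^sub>R Db + 2 *\<^sub>R Dv + E2)"
  \<comment> \<open>The coupling term depends on \<open>a - p\<close>, so its derivatives in
    \<open>a\<close> and in \<open>p\<close> are opposite. Hence \<open>Du\<close> cancels in
    \<open>\<nu>1 + y1\<close>, and only the slope \<open>\<kappa> + e1\<close> and perturbation
    terms remain.\<close>
  define y1 where "y1 = 2 *\<^sub>R Du - E3"
  define y2 where "y2 = 2 *\<^sub>R Dv - E4"
  have n1: "normal_within (A \<inter> Y) a \<nu>1"
    unfolding \<nu>1_def
  proof (rule block[OF mem(2) pts'(3) _ Da(2) _ E1(2)])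
    show "x + s + p \<in> Y" by (intro in_Y mem pts')
    show "(\<theta> has_derivative blinfun_apply Du) (at (a - (x + s + p)) within Y)"
      using Du(2) by (simp add: diff_diff_eq)
    show "(\<kappa> + e1) * \<theta> (a - ah) + 2 * \<theta> (a - (x + s + p)) + \<pi> w1 a
      \<le> (\<kappa> + e1) * \<theta> (z - ah) + 2 * \<theta> (z - (x + s + p)) + \<pi> w1 z" if "z \<in> A \<inter> Y" for z
      using vmin'[of z b p q s] that mem by (simp add: \<Phi>_def distrib_left diff_diff_eq)
  qed
  have n2: "normal_within (B \<inter> Y) b \<nu>2"
    unfolding \<nu>2_def
  proof (rule block[OF mem(4) pts'(4) _ Db(2) _ E2(2)])
    show "x + s + q \<in> Y" by (intro in_Y mem pts')
    show "(\<theta> has_derivative blinfun_apply Dv) (at (b - (x + s + q)) within Y)"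
      using Dv(2) by (simp add: diff_diff_eq)
    show "(\<kappa> + e1) * \<theta> (b - bh) + 2 * \<theta> (b - (x + s + q)) + \<pi> w2 b
      \<le> (\<kappa> + e1) * \<theta> (z - bh) + 2 * \<theta> (z - (x + s + q)) + \<pi> w2 z" if "z \<in> B \<inter> Y" for z
      using vmin'[of a z p q s] that mem by (simp add: \<Phi>_def distrib_left diff_diff_eq)
  qed
  \<comment> \<open>\<open>p\<close> and \<open>q\<close> are varied jointly because the maximum
    does not split into a function of \<open>p\<close> plus a function of \<open>q\<close>; it is
    convex in the pair, and the other terms are smooth.\<close>
  have sub: "max (norm p) (norm q) + y1 h + y2 k \<le> max (norm (p + h)) (norm (q + k))" if hk: "h \<in> Y" "k \<in> Y" for h k
  proof -
    let ?g = "\<lambda>(p::'a, q::'a). max (norm p) (norm q)"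
    let ?\<phi> = "\<lambda>z. 2 * \<theta> (a - x - s - fst z) + 2 * \<theta> (b - x - s - snd z) + \<pi> w3 (fst z) + \<pi> w4 (snd z)"
    let ?D = "\<lambda>z. 2 * Du (- fst z) + 2 * Dv (- snd z) + E3 (fst z) + E4 (snd z)"
    have YY: "subspace (Y \<times> Y)" by (intro subspace_Times Y)
    have d1: "((\<lambda>z. \<theta> (a - x - s - fst z)) has_derivative (\<lambda>h. Du (- fst h))) (at (p, q) within Y \<times> Y)"
    proof (rule has_derivative_chain_within[where g = "\<lambda>z. a - x - s - fst z"])
      show "((\<lambda>z. a - x - s - fst z) has_derivative (\<lambda>h. - fst h)) (at (p, q) within Y \<times> Y)"
        by (auto intro!: derivative_eq_intros)
      show "(\<lambda>z. a - x - s - fst z) ` (Y \<times> Y) \<subseteq> Y" using mem pts' by (auto intro!: in_Y)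
    qed (use Du(2) in simp)
    have d2: "((\<lambda>z. \<theta> (b - x - s - snd z)) has_derivative (\<lambda>h. Dv (- snd h))) (at (p, q) within Y \<times> Y)"
    proof (rule has_derivative_chain_within[where g = "\<lambda>z. b - x - s - snd z"])
      show "((\<lambda>z. b - x - s - snd z) has_derivative (\<lambda>h. - snd h)) (at (p, q) within Y \<times> Y)"
        by (auto intro!: derivative_eq_intros)
      show "(\<lambda>z. b - x - s - snd z) ` (Y \<times> Y) \<subseteq> Y" using mem pts' by (auto intro!: in_Y)
    qed (use Dv(2) in simp)
    have d3: "((\<lambda>z. \<pi> w3 (fst z)) has_derivative (\<lambda>h. E3 (fst h))) (at (p, q) within Y \<times> Y)"
      by (rule has_derivative_chain_within[where g = fst and Y = Y])
        (use E3(2) in \<open>auto intro: bounded_linear_imp_has_derivative bounded_linear_fst\<close>)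
    have d4: "((\<lambda>z. \<pi> w4 (snd z)) has_derivative (\<lambda>h. E4 (snd h))) (at (p, q) within Y \<times> Y)"
      by (rule has_derivative_chain_within[where g = snd and Y = Y])
        (use E4(2) in \<open>auto intro: bounded_linear_imp_has_derivative bounded_linear_snd\<close>)
    have der: "(?\<phi> has_derivative ?D) (at (p, q) within Y \<times> Y)"
      by (intro has_derivative_add has_derivative_mult_right d1 d2 d3 d4)
    have "- ?D (h, k) \<le> ?g ((p, q) + (h, k)) - ?g (p, q)"
    proof (rule convex_plus_smooth_min[OF YY convex_on_max_norm der])
      show "(p, q) \<in> Y \<times> Y" "(h, k) \<in> Y \<times> Y" using mem hk by auto
      fix z :: "'a \<times> 'a" assume z: "z \<in> Y \<times> Y"
      then show "?g (p, q) + ?\<phi> (p, q) \<le> ?g z + ?\<phi> z"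
        using vmin'[of a b "fst z" "snd z" s] mem by (auto simp: \<Phi>_def)
    qed
    then show ?thesis
      by (simp add: y1_def y2_def blinfun.minus_right blinfun.diff_left blinfun.scaleR_left)
  qed
  \<comment> \<open>Varying \<open>s\<close> alone moves both coupling terms at once, so their
    derivatives appear added and are balanced by the slope \<open>\<beta> + e1\<close> of the norm
    of \<open>s\<close>.\<close>
  have sumle: "y1 h + y2 h \<le> (\<beta> + e) * norm h" if h: "h \<in> Y" for h
  proof -
    let ?\<phi> = "\<lambda>z. 2 * \<theta> (a - x - p - z) + 2 * \<theta> (b - x - q - z) + \<pi> w5 z"
    let ?D = "\<lambda>z. 2 * Du (- z) + 2 * Dv (- z) + E5 z"
    have comm: "a - x - z - p = a - x - p - z" "b - x - z - q = b - x - q - z" for z by simp_all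
    have d1: "((\<lambda>z. \<theta> (a - x - p - z)) has_derivative (\<lambda>h. Du (- h))) (at s within Y)"
    proof (rule has_derivative_chain_within[where g = "\<lambda>z. a - x - p - z"])
      show "((\<lambda>z. a - x - p - z) has_derivative (\<lambda>h. - h)) (at s within Y)"
        by (auto intro!: derivative_eq_intros)
      show "(\<lambda>z. a - x - p - z) ` Y \<subseteq> Y" using mem pts' by (auto intro!: in_Y)
    qed (use Du(2) comm(1)[of s] in simp)
    have d2: "((\<lambda>z. \<theta> (b - x - q - z)) has_derivative (\<lambda>h. Dv (- h))) (at s within Y)"
    proof (rule has_derivative_chain_within[where g = "\<lambda>z. b - x - q - z"])
      show "((\<lambda>z. b - x - q - z) has_derivative (\<lambda>h. - h)) (at s within Y)"
        by (auto intro!: derivative_eq_intros)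
      show "(\<lambda>z. b - x - q - z) ` Y \<subseteq> Y" using mem pts' by (auto intro!: in_Y)
    qed (use Dv(2) comm(2)[of s] in simp)
    have "(?\<phi> has_derivative ?D) (at s within Y)"
      by (intro has_derivative_add has_derivative_mult_right d1 d2 E5(2))
    moreover have "convex_on UNIV (\<lambda>z::'a. (\<beta> + e1) * norm z)"
      using convex_on_cmul[OF _ convex_on_dist[of UNIV "0::'a"], of "\<beta> + e1"] nonneg e1 by simp
    moreover have "(\<beta> + e1) * norm s + ?\<phi> s \<le> (\<beta> + e1) * norm z + ?\<phi> z" if "z \<in> Y" for z
      using vmin'[of a b p q z] that mem by (simp add: \<Phi>_def comm)
    ultimately have "- ?D h \<le> (\<beta> + e1) * norm (s + h) - (\<beta> + e1) * norm s"
      by (intro convex_plus_smooth_min[OF Y, where \<phi> = ?\<phi>] mem h)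
    also have "\<dots> \<le> (\<beta> + e1) * norm h"
      using mult_left_mono[OF norm_triangle_ineq[of s h], of "\<beta> + e1"] nonneg e1 by (simp add: distrib_left)
    finally have "y1 h + y2 h \<le> (\<beta> + e1) * norm h + E5 h - E3 h - E4 h"
      by (simp add: y1_def y2_def blinfun.minus_right blinfun.diff_left blinfun.scaleR_left)
    also have "\<dots> \<le> (\<beta> + e1) * norm h + 6 * \<mu> * norm h"
      using abs_E[OF E3(1), of h] abs_E[OF E4(1), of h] abs_E[OF E5(1), of h] by linarith
    also have "\<dots> = (\<beta> + (e1 + 6 * \<mu>)) * norm h" by (simp add: algebra_simps)
    also have "\<dots> \<le> (\<beta> + e) * norm h" using e1 by (intro mult_right_mono) (auto simp: \<mu>_def)
    finally show ?thesis .
  qed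
  have dist: "(- ((\<kappa> + e1) *\<^sub>R D + 2 *\<^sub>R D' + E)) h + (2 *\<^sub>R D' - E') h \<le> (\<kappa> + e) * norm h"
    if "norm D \<le> 1" "norm E \<le> 2 * \<mu>" "norm E' \<le> 2 * \<mu>" for D D' E E' :: "'a \<Rightarrow>\<^sub>L real" and h
  proof -
    have "(- ((\<kappa> + e1) *\<^sub>R D + 2 *\<^sub>R D' + E)) h + (2 *\<^sub>R D' - E') h = (\<kappa> + e1) * (- D h) - E h - E' h"
      by (simp add: blinfun.minus_left blinfun.add_left blinfun.diff_left blinfun.scaleR_left algebra_simps)
    also have "(\<kappa> + e1) * (- D h) \<le> (\<kappa> + e1) * norm h"
      using abs_E[OF that(1), of h] nonneg e1 by (intro mult_left_mono) auto
    also have "(\<kappa> + e1) * norm h - E h - E' h \<le> (\<kappa> + e1) * norm h + 4 * \<mu> * norm h"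
      using abs_E[OF that(2), of h] abs_E[OF that(3), of h] by linarith
    also have "\<dots> = (\<kappa> + (e1 + 4 * \<mu>)) * norm h" by (simp add: algebra_simps)
    also have "\<dots> \<le> (\<kappa> + e) * norm h" using e1 by (intro mult_right_mono) (auto simp: \<mu>_def)
    finally show ?thesis by simp
  qed
  show ?thesis
  proof (rule that[of a b p q \<nu>1 \<nu>2 y1 y2])
    show "\<nu>1 h + y1 h \<le> (\<kappa> + e) * norm h" "\<nu>2 h + y2 h \<le> (\<kappa> + e) * norm h" for h
      unfolding \<nu>1_def \<nu>2_def y1_def y2_def by (rule dist; fact)+
  qed (use mem small n1 n2 sub sumle in \<open>auto simp: Y_def\<close>)
qed

section \<open>Multipliers in the whole space and the theorem\<close>

text \<open>The four functionals found along \<open>Y\<close> are lifted along one refined filter.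
  Test directions are replaced by their copies in \<open>Y\<close>, while \<open>a\<close>,
  \<open>b\<close>, \<open>p\<close>, \<open>q\<close> belong to \<open>Y\<close> and are kept as
  they are, so every inequality of \<open>approximate_multipliers\<close> passes to the limit with
  the same constants.\<close>

lemma asplund_multipliers:
  fixes A B :: "'a::banach set"
  assumes asp: "asplund_space TYPE('a)" and AB: "closed A" "closed B" and pts: "ah \<in> A" "bh \<in> B"
    and nonneg: "\<kappa> \<ge> 0" "\<beta> \<ge> 0" and e: "e > 0"
    and min: "\<And>a b s. a \<in> A \<Longrightarrow> b \<in> B \<Longrightarrow>
      max (norm (ah - x)) (norm (bh - x)) \<le> max (norm (a - x - s)) (norm (b - x - s)) + \<beta> * norm s
        + \<kappa> * (norm (a - ah) + norm (b - bh))"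
  obtains a b p q and \<nu>1 \<nu>2 y1 y2 :: "'a \<Rightarrow>\<^sub>L real" where "a \<in> A" "b \<in> B"
    "norm (a - ah) < e" "norm (b - bh) < e" "norm (p - (ah - x)) < e" "norm (q - (bh - x)) < e"
    "\<nu>1 \<in> frechet_normal_cone A a" "\<nu>2 \<in> frechet_normal_cone B b"
    "\<And>h k. max (norm p) (norm q) + y1 h + y2 k \<le> max (norm (p + h)) (norm (q + k))"
    "\<And>h. y1 h + y2 h \<le> (\<beta> + e) * norm h"
    "\<And>h. \<nu>1 h + y1 h \<le> (\<kappa> + e) * norm h" "\<And>h. \<nu>2 h + y2 h \<le> (\<kappa> + e) * norm h"
proof -
  have "countable {x, ah, bh}" by simp
  then obtain M and \<G> :: "('a \<Rightarrow> 'a) filter" where M: "countable M" "{x, ah, bh} \<subseteq> M" "subspace (closure M)"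
    and G: "\<G> \<noteq> bot"
    "\<And>v. \<forall>\<^sub>F \<phi> in \<G>. \<phi> v \<in> closure M \<and> (\<phi> v \<in> A \<longleftrightarrow> v \<in> A) \<and> (\<phi> v \<in> B \<longleftrightarrow> v \<in> B)"
    "\<And>u v w. ((\<lambda>\<phi>. norm (\<phi> u + \<phi> v - \<phi> w)) \<longlongrightarrow> norm (u + v - w)) \<G>"
    "\<And>v. v \<in> closure M \<Longrightarrow> ((\<lambda>\<phi>. \<phi> v) \<longlongrightarrow> v) \<G>"
    by (rule reflecting_filter[of _ A B]) (rule that)
  interpret reflection "closure M" \<G>
    by unfold_locales (use M(3) G(1,3,4) in \<open>auto intro: eventually_mono[OF G(2)]\<close>)
  have mem: "ah \<in> A \<inter> closure M" "bh \<in> B \<inter> closure M" "x \<in> closure M"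
    using M(2) closure_subset[of M] pts by auto
  obtain a b p q and \<nu>1 \<nu>2 y1 y2 :: "'a \<Rightarrow>\<^sub>L real" where ab: "a \<in> A \<inter> closure M" "b \<in> B \<inter> closure M"
    and pq: "p \<in> closure M" "q \<in> closure M"
    and near: "norm (a - ah) < e" "norm (b - bh) < e" "norm (p - (ah - x)) < e" "norm (q - (bh - x)) < e"
    and nor: "normal_within (A \<inter> closure M) a \<nu>1" "normal_within (B \<inter> closure M) b \<nu>2"
    and sub: "\<And>h k. h \<in> closure M \<Longrightarrow> k \<in> closure M \<Longrightarrow>
      max (norm p) (norm q) + y1 h + y2 k \<le> max (norm (p + h)) (norm (q + k))"
    and ysum: "\<And>h. h \<in> closure M \<Longrightarrow> y1 h + y2 h \<le> (\<beta> + e) * norm h"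
    and dist: "\<And>h. \<nu>1 h + y1 h \<le> (\<kappa> + e) * norm h" "\<And>h. \<nu>2 h + y2 h \<le> (\<kappa> + e) * norm h"
    by (rule approximate_multipliers[OF asp M(1,3) AB mem nonneg e min]) (assumption, assumption, rule that)
  define f where "f = (\<lambda>i::nat. if i = 0 then \<nu>1 else if i = 1 then \<nu>2 else if i = 2 then y1 else y2)"
  define L where "L = norm \<nu>1 + norm \<nu>2 + norm y1 + norm y2"
  have "norm (f i) \<le> L" for i
    using norm_ge_zero[of \<nu>1] norm_ge_zero[of \<nu>2] norm_ge_zero[of y1] norm_ge_zero[of y2]
    unfolding f_def L_def by simp
  then obtain \<U> and g :: "nat \<Rightarrow> 'a \<Rightarrow>\<^sub>L real" where U: "\<U> \<noteq> bot" "\<U> \<le> \<G>"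
    and lim: "\<And>i v. ((\<lambda>\<phi>. blinfun_apply (f i) (\<phi> v)) \<longlongrightarrow> blinfun_apply (g i) v) \<U>"
    by (rule lift_functionals) (rule that)
  have lims: "((\<lambda>\<phi>. \<nu>1 (\<phi> v)) \<longlongrightarrow> g 0 v) \<U>" "((\<lambda>\<phi>. \<nu>2 (\<phi> v)) \<longlongrightarrow> g 1 v) \<U>"
    "((\<lambda>\<phi>. y1 (\<phi> v)) \<longlongrightarrow> g 2 v) \<U>" "((\<lambda>\<phi>. y2 (\<phi> v)) \<longlongrightarrow> g 3 v) \<U>" for v
    using lim[of 0 v] lim[of 1 v] lim[of 2 v] lim[of 3 v] by (simp_all add: f_def)
  have nl: "((\<lambda>\<phi>. norm (\<phi> v)) \<longlongrightarrow> norm v) \<U>" for v by (rule tendsto_mono[OF U(2) norm_lim])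
  have evY: "\<forall>\<^sub>F \<phi> in \<U>. \<phi> v \<in> closure M" for v by (rule filter_leD[OF U(2) into])
  have shift: "((\<lambda>\<phi>. norm (u + \<phi> v)) \<longlongrightarrow> norm (u + v)) \<U>" if "u \<in> closure M" for u v
    using tendsto_mono[OF U(2) norm_diff_lim[of "- u" v]] subspace_neg[OF M(3) that] by (simp add: add.commute)
  show ?thesis
  proof (rule that[of a b p q "g 0" "g 1" "g 2" "g 3"])
    show "a \<in> A" "b \<in> B" using ab by auto
    show "norm (a - ah) < e" "norm (b - bh) < e" "norm (p - (ah - x)) < e" "norm (q - (bh - x)) < e"
      by fact+
    have evA: "\<forall>\<^sub>F \<phi> in \<G>. \<phi> v \<in> A" if "v \<in> A" for v using G(2)[of v] that by (auto elim: eventually_mono)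
    have evB: "\<forall>\<^sub>F \<phi> in \<G>. \<phi> v \<in> B" if "v \<in> B" for v using G(2)[of v] that by (auto elim: eventually_mono)
    show "g 0 \<in> frechet_normal_cone A a"
      by (rule normal_within_imp_frechet_normal[OF normal_within_lift[OF U lims(1) evA _ nor(1)]]) (use ab in auto)
    show "g 1 \<in> frechet_normal_cone B b"
      by (rule normal_within_imp_frechet_normal[OF normal_within_lift[OF U lims(2) evB _ nor(2)]]) (use ab in auto)
    show "max (norm p) (norm q) + g 2 h + g 3 k \<le> max (norm (p + h)) (norm (q + k))" for h k
    proof (rule tendsto_le[OF U(1)])
      show "((\<lambda>\<phi>. max (norm (p + \<phi> h)) (norm (q + \<phi> k))) \<longlongrightarrow> max (norm (p + h)) (norm (q + k))) \<U>"
        by (intro tendsto_max shift pq)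
      show "((\<lambda>\<phi>. max (norm p) (norm q) + y1 (\<phi> h) + y2 (\<phi> k)) \<longlongrightarrow> max (norm p) (norm q) + g 2 h + g 3 k) \<U>"
        by (intro tendsto_add tendsto_const lims)
      show "\<forall>\<^sub>F \<phi> in \<U>. max (norm p) (norm q) + y1 (\<phi> h) + y2 (\<phi> k) \<le> max (norm (p + \<phi> h)) (norm (q + \<phi> k))"
        using evY[of h] evY[of k] by eventually_elim (rule sub)
    qed
    show "g 2 h + g 3 h \<le> (\<beta> + e) * norm h" for h
    proof (rule tendsto_le[OF U(1)])
      show "((\<lambda>\<phi>. (\<beta> + e) * norm (\<phi> h)) \<longlongrightarrow> (\<beta> + e) * norm h) \<U>" by (intro tendsto_mult tendsto_const nl)
      show "((\<lambda>\<phi>. y1 (\<phi> h) + y2 (\<phi> h)) \<longlongrightarrow> g 2 h + g 3 h) \<U>" by (intro tendsto_add lims)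
      show "\<forall>\<^sub>F \<phi> in \<U>. y1 (\<phi> h) + y2 (\<phi> h) \<le> (\<beta> + e) * norm (\<phi> h)"
        using evY[of h] by eventually_elim (rule ysum)
    qed
    show "g 0 h + g 2 h \<le> (\<kappa> + e) * norm h" for h
    proof (rule tendsto_le[OF U(1)])
      show "((\<lambda>\<phi>. (\<kappa> + e) * norm (\<phi> h)) \<longlongrightarrow> (\<kappa> + e) * norm h) \<U>" by (intro tendsto_mult tendsto_const nl)
      show "((\<lambda>\<phi>. \<nu>1 (\<phi> h) + y1 (\<phi> h)) \<longlongrightarrow> g 0 h + g 2 h) \<U>" by (intro tendsto_add lims)
    qed (simp add: dist)
    show "g 1 h + g 3 h \<le> (\<kappa> + e) * norm h" for h
    proof (rule tendsto_le[OF U(1)])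
      show "((\<lambda>\<phi>. (\<kappa> + e) * norm (\<phi> h)) \<longlongrightarrow> (\<kappa> + e) * norm h) \<U>" by (intro tendsto_mult tendsto_const nl)
      show "((\<lambda>\<phi>. \<nu>2 (\<phi> h) + y2 (\<phi> h)) \<longlongrightarrow> g 1 h + g 3 h) \<U>" by (intro tendsto_add lims)
    qed (simp add: dist)
  qed
qed

section \<open>Subgradients of the maximum of two norms\<close>

lemma norm_blinfun_le_of_unit:
  fixes y :: "'a::real_normed_vector \<Rightarrow>\<^sub>L real"
  assumes "\<And>h. norm h \<le> 1 \<Longrightarrow> y h \<le> c"
  shows "norm y \<le> c"
proof (rule norm_blinfun_bound)
  show "0 \<le> c" using assms[of 0] by simp
  fix h
  show "norm (y h) \<le> c * norm h"
  proof (cases "h = 0")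
    case False
    have "y ((1 / norm h) *\<^sub>R h) \<le> c" "y ((1 / norm h) *\<^sub>R (- h)) \<le> c"
      using False by (intro assms; simp)+
    then have "y h / norm h \<le> c" "- y h / norm h \<le> c"
      unfolding blinfun.scaleR_right blinfun.minus_right by simp_all
    then have "y h \<le> c * norm h" "- y h \<le> c * norm h"
      using False by (simp_all only: pos_divide_le_eq zero_less_norm_iff not_False_eq_True)
    then show ?thesis by simp
  qed simp
qed

lemma norm_blinfun_le_of_norm:
  fixes y :: "'a::real_normed_vector \<Rightarrow>\<^sub>L real"
  assumes "\<And>h. y h \<le> c * norm h" "c \<ge> 0"
  shows "norm y \<le> c"
proof (rule norm_blinfun_le_of_unit)
  fix h :: 'a assume "norm h \<le> 1"
  then have "c * norm h \<le> c * 1" using assms(2) by (intro mult_left_mono)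
  then show "y h \<le> c" using assms(1)[of h] by simp
qed

text \<open>If \<open>norm p\<close> were larger, small changes of \<open>q\<close> would leave the
  maximum unchanged, hence \<open>y2 = 0\<close>. Then
  \<open>norm p \<le> y1 p \<le> c * norm p\<close>, which is impossible for
  \<open>c < 1\<close>.\<close>

lemma max_norm_subgradient_le:
  fixes y1 y2 :: "'a::real_normed_vector \<Rightarrow>\<^sub>L real"
  assumes sub: "\<And>h k. max (norm p) (norm q) + y1 h + y2 k \<le> max (norm (p + h)) (norm (q + k))"
    and c: "\<And>h. y1 h + y2 h \<le> c * norm h" "c < 1"
  shows "norm p \<le> norm q"
proof (rule ccontr)
  assume "\<not> norm p \<le> norm q"
  then have lt: "norm q < norm p" by simp
  have y2: "y2 k \<le> 0" for k
  proof -
    define t where "t = (norm p - norm q) / (norm k + 1)"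
    have pos: "norm k + 1 > 0" using norm_ge_zero[of k] by linarith
    then have t: "t > 0" using lt by (simp add: t_def)
    have "t * norm k \<le> t * (norm k + 1)" using t by (intro mult_left_mono) auto
    also have "\<dots> = norm p - norm q" using pos by (simp add: t_def)
    finally have "norm (q + t *\<^sub>R k) \<le> norm p"
      using norm_triangle_ineq[of q "t *\<^sub>R k"] t by simp
    then have "t * y2 k \<le> 0" using sub[of 0 "t *\<^sub>R k"] lt by (simp add: blinfun.scaleR_right)
    then show ?thesis using t by (simp add: mult_le_0_iff)
  qed
  have "y2 p = 0" "y2 q = 0" using y2[of p] y2[of "- p"] y2[of q] y2[of "- q"] by (simp_all add: blinfun.minus_right)
  then have "norm p \<le> c * norm p"
    using sub[of "- p" "- q"] c(1)[of p] lt by (simp add: blinfun.minus_right)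
  moreover have "c * norm p < 1 * norm p" using c(2) lt norm_ge_zero[of q] by (intro mult_strict_right_mono) linarith+
  ultimately show False by simp
qed

text \<open>A subgradient of the norm \<open>max (norm p) (norm q)\<close> at a nonzero point has
  dual norm 1 and attains it there, and the dual of a maximum of norms is the sum of the dual norms.
  Attainment for the sum forces attainment in each coordinate.\<close>

lemma max_norm_subgradient:
  fixes y1 y2 :: "'a::real_normed_vector \<Rightarrow>\<^sub>L real"
  assumes sub: "\<And>h k. max (norm p) (norm q) + y1 h + y2 k \<le> max (norm (p + h)) (norm (q + k))"
    and c: "\<And>h. y1 h + y2 h \<le> c * norm h" "c < 1" and "p \<noteq> 0"
  shows "norm p = norm q" "norm y1 + norm y2 = 1" "y1 p = norm y1 * norm p" "y2 q = norm y2 * norm q"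
proof -
  have "norm p \<le> norm q" by (rule max_norm_subgradient_le[OF sub c])
  moreover have "norm q \<le> norm p"
  proof (rule max_norm_subgradient_le[of q p y2 y1 c])
    fix h k
    have "max (norm q) (norm p) = max (norm p) (norm q)"
      "max (norm (q + h)) (norm (p + k)) = max (norm (p + k)) (norm (q + h))" by (rule max.commute)+
    then show "max (norm q) (norm p) + y2 h + y1 k \<le> max (norm (q + h)) (norm (p + k))"
      using sub[of k h] by linarith
    show "y2 h + y1 h \<le> c * norm h" using c(1)[of h] by simp
  qed (rule c(2))
  ultimately show eq: "norm p = norm q" by simp
  have pos: "norm p > 0" using \<open>p \<noteq> 0\<close> by simp
  have unit: "y1 h + y2 k \<le> 1" if "norm h \<le> 1" "norm k \<le> 1" for h k
  proof -
    have "norm (p + h) \<le> norm p + 1" "norm (q + k) \<le> norm p + 1"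
      using norm_triangle_ineq[of p h] norm_triangle_ineq[of q k] that eq by linarith+
    then have "max (norm (p + h)) (norm (q + k)) \<le> norm p + 1" by (rule max.boundedI)
    moreover have "max (norm p) (norm q) = norm p" using eq by simp
    ultimately show ?thesis using sub[of h k] by linarith
  qed
  have "norm y1 \<le> 1 - y2 k" if "norm k \<le> 1" for k
    using unit[OF _ that] by (intro norm_blinfun_le_of_unit) (simp add: le_diff_eq)
  then have "norm y2 \<le> 1 - norm y1"
    by (intro norm_blinfun_le_of_unit) (simp add: le_diff_eq add.commute)
  then have le1: "norm y1 + norm y2 \<le> 1" by simp
  have ge: "norm p \<le> y1 p + y2 q"
    using sub[of "- p" "- q"] eq by (simp add: blinfun.minus_right)
  have b1: "y1 p \<le> norm y1 * norm p" and b2: "y2 q \<le> norm y2 * norm p"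
    using norm_blinfun[of y1 p] norm_blinfun[of y2 q] eq by (simp_all add: abs_le_iff)
  have up: "norm y1 * norm p + norm y2 * norm p \<le> norm p"
    using mult_right_mono[OF le1, of "norm p"] by (simp add: distrib_right)
  have "norm y1 * norm p + norm y2 * norm p = norm p" using ge b1 b2 up by linarith
  then show "norm y1 + norm y2 = 1" using pos by (simp add: distrib_right[symmetric])
  show "y1 p = norm y1 * norm p" using ge b1 b2 up by linarith
  show "y2 q = norm y2 * norm q" unfolding eq[symmetric] using ge b1 b2 up by linarith
qed

section \<open>From failure of subtransversality to a point of slow decrease\<close>

text \<open>Moving from \<open>x\<close> towards the more distant \<open>a\<close> decreases that
  distance at unit rate and increases the other at most at unit rate, so the maximum falls with
  slope 1 until the two bounds meet. The fraction \<open>t\<close> of the way is where they do.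
  Slope 1 contradicts \<open>\<beta> < 1\<close>.\<close>

lemma equidistant_of_slow_growth:
  fixes x :: "'a::real_normed_vector"
  assumes slow: "\<And>z. max (norm (x - a)) (norm (x - b)) \<le> max (norm (z - a)) (norm (z - b)) + \<beta> * norm (z - x)"
    and "\<beta> < 1"
  shows "norm (x - a) \<le> norm (x - b)"
proof (rule ccontr)
  assume "\<not> norm (x - a) \<le> norm (x - b)"
  then have lt: "norm (x - b) < norm (x - a)" by simp
  define r where "r = norm (x - a)"
  have r: "r > 0" using lt norm_ge_zero[of "x - b"] unfolding r_def by linarith
  define t where "t = (r - norm (x - b)) / (2 * r)"
  have t: "t > 0" "t \<le> 1" "2 * (t * r) = r - norm (x - b)"
  proof -
    have "norm (x - b) < r" using lt by (simp add: r_def)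
    then show "t > 0" unfolding t_def using r by (intro divide_pos_pos) auto
    have "r - norm (x - b) \<le> 1 * (2 * r)" using r norm_ge_zero[of "x - b"] by linarith
    then show "t \<le> 1" unfolding t_def using r by (subst pos_divide_le_eq) auto
    have "r \<noteq> 0" using r by simp
    then show "2 * (t * r) = r - norm (x - b)" by (simp add: t_def)
  qed
  define z where "z = x + t *\<^sub>R (a - x)"
  have "norm (z - x) = t * r" using t by (simp add: z_def r_def norm_minus_commute)
  moreover have "norm (z - a) = (1 - t) * r"
  proof -
    have "z - a = (1 - t) *\<^sub>R (x - a)" by (simp add: z_def algebra_simps)
    then show ?thesis using t by (simp add: r_def)
  qed
  moreover have "norm (z - b) \<le> (1 - t) * r"
  proof -
    have "norm (z - b) \<le> norm (x - b) + norm (t *\<^sub>R (a - x))"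
      using norm_triangle_ineq[of "x - b" "t *\<^sub>R (a - x)"] by (simp add: z_def algebra_simps)
    also have "\<dots> = norm (x - b) + t * r" using t by (simp add: r_def norm_minus_commute)
    also have "\<dots> = (1 - t) * r" using t(3) by (simp add: algebra_simps)
    finally show ?thesis .
  qed
  ultimately have "r \<le> (1 - t) * r + \<beta> * (t * r)"
    using slow[of z] lt unfolding r_def[symmetric] by (simp add: max_def split: if_splits)
  then have "1 * (t * r) \<le> \<beta> * (t * r)" by (simp add: algebra_simps)
  moreover have "\<beta> * (t * r) < 1 * (t * r)" using \<open>\<beta> < 1\<close> t r by (intro mult_strict_right_mono) auto
  ultimately show False by simp
qed

lemma infdist_lt_obtain:
  assumes "A \<noteq> {}" "infdist x A < c"
  obtains a where "a \<in> A" "dist x a < c"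
proof -
  have "(INF a\<in>A. dist x a) < c" using assms by (simp add: infdist_notempty)
  then show ?thesis using cINF_less_iff[OF assms(1), of "dist x" c] that by (auto intro: bdd_belowI[of _ 0])
qed

text \<open>Ekeland's principle starts at a point \<open>x0\<close> violating the inequality, with
  \<open>a0\<close>, \<open>b0\<close> within \<open>\<alpha> * d\<close> of it. The descent
  estimate gives \<open>m + norm (x - x0) < d\<close>, where \<open>d\<close> is the distance from
  \<open>x0\<close> to the intersection; so \<open>a\<close> and \<open>b\<close> are closer to
  \<open>x0\<close> than any common point and each lies in one set only. As \<open>x0\<close> is
  within \<open>\<delta> / 3\<close> of \<open>xbar\<close> and \<open>d < \<delta> / 3\<close>,
  everything stays in the ball of radius \<open>\<delta>\<close>.\<close>

lemma nonsubtransversal_ekeland_point: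
  fixes A B :: "'a::banach set"
  assumes AB: "closed A" "closed B" "xbar \<in> A \<inter> B"
    and par: "0 < \<alpha>" "\<alpha> < \<beta>" "\<beta> < 1" "0 < \<gamma>" "\<gamma> \<le> 1" "0 < \<delta>"
    and not: "\<not> subtransversal_with A B xbar \<alpha> (\<delta> / 3)"
  obtains a b x where "a \<in> A - B" "b \<in> B - A" "a \<in> ball xbar \<delta>" "b \<in> ball xbar \<delta>" "x \<in> ball xbar \<delta>"
    "norm (x - a) = norm (x - b)"
    "\<And>a' b' x'. a' \<in> A \<Longrightarrow> b' \<in> B \<Longrightarrow> max (norm (x - a)) (norm (x - b)) \<le>
      max (norm (x' - a')) (norm (x' - b')) + \<beta> * (norm (x' - x) + \<gamma> * (norm (a' - a) + norm (b' - b)))"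
proof -
  obtain x0 where x0: "norm (xbar - x0) < \<delta> / 3"
    "max (infdist x0 A) (infdist x0 B) < \<alpha> * infdist x0 (A \<inter> B)"
    using not unfolding subtransversal_with_def by (auto simp: dist_norm not_le)
  define d where "d = infdist x0 (A \<inter> B)"
  have d: "d < \<delta> / 3" using infdist_le[OF AB(3), of x0] x0(1) by (simp add: d_def dist_norm norm_minus_commute)
  obtain a0 where a0: "a0 \<in> A" "dist x0 a0 < \<alpha> * d"
    by (rule infdist_lt_obtain[of A x0 "\<alpha> * d"]) (use AB(3) x0(2) in \<open>auto simp: d_def\<close>)
  obtain b0 where b0: "b0 \<in> B" "dist x0 b0 < \<alpha> * d"
    by (rule infdist_lt_obtain[of B x0 "\<alpha> * d"]) (use AB(3) x0(2) in \<open>auto simp: d_def\<close>)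
  define S where "S = A \<times> B \<times> (UNIV :: 'a set)"
  define f where "f = (\<lambda>(a, b, x :: 'a). max (norm (x - a)) (norm (x - b)))"
  \<comment> \<open>Moves of \<open>a\<close> and \<open>b\<close> carry the separate weight
    \<open>\<gamma>\<close>; this factor later enters the bound on the distances of the multipliers
    to the normal cones.\<close>
  define N where "N = (\<lambda>(a :: 'a, b :: 'a, x :: 'a). norm x + \<gamma> * (norm a + norm b))"
  have S: "closed S" "(a0, b0, x0) \<in> S" unfolding S_def using AB a0 b0 by (auto intro: closed_Times)
  have contf: "continuous_on S f" unfolding f_def split_def by (intro continuous_intros)
  have fpos: "0 \<le> f v" for v by (simp add: f_def split_def le_max_iff_disj)
  have tri: "N (u + v) \<le> N u + N v" for u v
  proof -
    obtain u1 u2 u3 v1 v2 v3 where uv: "u = (u1, u2, u3)" "v = (v1, v2, v3)" by (cases u, cases v)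
    have "norm (u3 + v3) + \<gamma> * (norm (u1 + v1) + norm (u2 + v2))
      \<le> (norm u3 + norm v3) + \<gamma> * ((norm u1 + norm v1) + (norm u2 + norm v2))"
      using par by (intro add_mono mult_left_mono norm_triangle_ineq) auto
    then show ?thesis by (simp add: N_def uv algebra_simps)
  qed
  have sym: "N (- u) = N u" for u by (cases u) (simp add: N_def)
  have low: "\<gamma> * norm u \<le> N u" for u
  proof -
    obtain u1 u2 u3 where u: "u = (u1, u2, u3)" by (cases u)
    have "norm u \<le> norm u1 + (norm u2 + norm u3)"
      unfolding u by (intro order_trans[OF norm_Pair_le] add_left_mono order_refl)
    then have "\<gamma> * norm u \<le> \<gamma> * (norm u1 + (norm u2 + norm u3))" using par by (intro mult_left_mono) auto
    moreover have "\<gamma> * norm u3 \<le> 1 * norm u3" using par by (intro mult_right_mono) auto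
    ultimately show ?thesis by (simp add: N_def u algebra_simps)
  qed
  have up: "N u \<le> 3 * norm u" for u
  proof -
    obtain u1 u2 u3 where u: "u = (u1, u2, u3)" by (cases u)
    have n: "norm u1 \<le> norm u" "norm u2 \<le> norm u" "norm u3 \<le> norm u"
      unfolding u by (rule norm_component_le)+
    have "\<gamma> * (norm u1 + norm u2) \<le> 1 * (norm u1 + norm u2)" using par by (intro mult_right_mono) auto
    then show ?thesis using n unfolding N_def by (simp add: u)
  qed
  obtain vh where vh: "vh \<in> S" "\<And>v. v \<in> S \<Longrightarrow> f vh \<le> f v + \<beta> * N (v - vh)"
    "f vh + \<alpha> * N (vh - (a0, b0, x0)) \<le> f (a0, b0, x0)"
    by (rule ekeland[OF S contf fpos tri sym par(4) low up par(1,2)]) (rule that)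
  obtain a b x where v: "vh = (a, b, x)" by (cases vh)
  have ab: "a \<in> A" "b \<in> B" using vh(1) by (auto simp: v S_def)
  define m where "m = max (norm (x - a)) (norm (x - b))"
  have m: "m \<ge> 0" "norm (x - a) \<le> m" "norm (x - b) \<le> m" by (auto simp: m_def le_max_iff_disj)
  have slow: "m \<le> max (norm (x' - a')) (norm (x' - b')) + \<beta> * (norm (x' - x) + \<gamma> * (norm (a' - a) + norm (b' - b)))"
    if "a' \<in> A" "b' \<in> B" for a' b' x'
    using vh(2)[of "(a', b', x')"] that by (simp add: v S_def f_def N_def m_def)
  have "m + \<alpha> * norm (x - x0) \<le> m + \<alpha> * N (vh - (a0, b0, x0))"
    using par by (simp add: v N_def)
  also have "\<dots> \<le> max (norm (x0 - a0)) (norm (x0 - b0))" using vh(3) by (simp add: v f_def m_def)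
  also have "\<dots> < \<alpha> * d" using a0 b0 by (simp add: dist_norm)
  finally have "m + \<alpha> * norm (x - x0) < \<alpha> * d" .
  moreover have "\<alpha> * m \<le> 1 * m" using par m by (intro mult_right_mono) auto
  ultimately have "\<alpha> * (m + norm (x - x0)) < \<alpha> * d" by (simp add: distrib_left)
  then have close: "m + norm (x - x0) < d" using par by simp
  have x0a: "norm (x0 - a) < d" "norm (x0 - b) < d"
    using close m norm_triangle_ineq[of "x0 - x" "x - a"] norm_triangle_ineq[of "x0 - x" "x - b"]
    by (simp_all add: norm_minus_commute)
  have notin: "z \<notin> A \<inter> B" if "norm (x0 - z) < d" for z
    using infdist_le[of z "A \<inter> B" x0] that by (auto simp: d_def dist_norm)
  show ?thesis
  proof (rule that[of a b x])
    show "a \<in> A - B" "b \<in> B - A" using ab notin[OF x0a(1)] notin[OF x0a(2)] by auto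
    show "a \<in> ball xbar \<delta>" "b \<in> ball xbar \<delta>" "x \<in> ball xbar \<delta>"
      using x0(1) x0a close m(1) d par norm_triangle_ineq[of "xbar - x0" "x0 - a"]
        norm_triangle_ineq[of "xbar - x0" "x0 - b"] norm_triangle_ineq[of "xbar - x0" "x0 - x"]
        norm_minus_commute[of x x0]
      by (simp_all add: dist_norm)
    have slow': "max (norm (x - a)) (norm (x - b)) \<le> max (norm (z - a)) (norm (z - b)) + \<beta> * norm (z - x)" for z
      using slow[OF ab, of z] by (simp add: m_def)
    have "norm (x - a) \<le> norm (x - b)" by (rule equidistant_of_slow_growth[OF slow' par(3)])
    moreover have "norm (x - b) \<le> norm (x - a)"
      by (rule equidistant_of_slow_growth[OF _ par(3)]) (use slow' in \<open>simp add: max.commute\<close>)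
    ultimately show "norm (x - a) = norm (x - b)" by simp
    show "max (norm (x - a)) (norm (x - b)) \<le>
      max (norm (x' - a')) (norm (x' - b')) + \<beta> * (norm (x' - x) + \<gamma> * (norm (a' - a) + norm (b' - b)))"
      if "a' \<in> A" "b' \<in> B" for a' b' x' using slow[OF that] by (simp add: m_def)
  qed
qed

theorem theorem4:
  fixes A B :: "'a::banach set" and xbar :: 'a and \<alpha> \<delta> :: real
  assumes "asplund_space TYPE('a)"
    and "closed A" and "closed B"
    and "xbar \<in> A \<inter> B"
    and "\<alpha> \<in> {0<..<1}" and "\<delta> > 0"
    and "\<forall>a \<in> (A - B) \<inter> ball xbar \<delta>. \<forall>b \<in> (B - A) \<inter> ball xbar \<delta>. \<forall>x \<in> ball xbar \<delta>.
           norm (x - a) = norm (x - b) \<longrightarrow>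
           (\<exists>\<epsilon>>0. \<forall>a' \<in> A \<inter> ball a \<epsilon>. \<forall>b' \<in> B \<inter> ball b \<epsilon>.
              \<forall>x1' \<in> ball a \<epsilon>. \<forall>x2' \<in> ball b \<epsilon>. norm (x - x1') = norm (x - x2') \<longrightarrow>
              (\<forall>(x1s :: 'a \<Rightarrow>\<^sub>L real) (x2s :: 'a \<Rightarrow>\<^sub>L real).
                 infdist x1s (frechet_normal_cone A a') < \<delta> \<and>
                 infdist x2s (frechet_normal_cone B b') < \<delta> \<and>
                 norm x1s + norm x2s = 1 \<and>
                 blinfun_apply x1s (x - x1') = norm x1s * norm (x - x1') \<and>
                 blinfun_apply x2s (x - x2') = norm x2s * norm (x - x2') \<longrightarrow>
                 norm (x1s + x2s) > \<alpha>))"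
  shows "subtransversal A B xbar \<and> str A B xbar \<ge> \<alpha>"
proof -
  \<comment> \<open>Ekeland's principle needs room between the failing constant
    \<open>\<alpha>'\<close> and the slope \<open>\<beta>\<close>, and the multiplier error needs
    room between \<open>\<beta>\<close> and \<open>\<alpha>\<close>; the supremum recovers
    \<open>\<alpha>\<close> at the end.\<close>
  have main: "subtransversal_with A B xbar \<alpha>' (\<delta> / 3)" if \<alpha>': "0 < \<alpha>'" "\<alpha>' < \<alpha>" for \<alpha>'
  proof (rule ccontr)
    assume not: "\<not> subtransversal_with A B xbar \<alpha>' (\<delta> / 3)"
    define \<beta> where "\<beta> = (\<alpha>' + \<alpha>) / 2"
    have \<beta>: "\<alpha>' < \<beta>" "\<beta> < \<alpha>" "\<beta> < 1" "0 < \<beta>" using \<alpha>' assms(5) by (auto simp: \<beta>_def)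
    define \<gamma> where "\<gamma> = min 1 (\<delta> / 4)"
    have \<gamma>: "0 < \<gamma>" "\<gamma> \<le> 1" "\<gamma> \<le> \<delta> / 4" using \<open>\<delta> > 0\<close> by (auto simp: \<gamma>_def)
    obtain a b x where a: "a \<in> A - B" "a \<in> ball xbar \<delta>" and b: "b \<in> B - A" "b \<in> ball xbar \<delta>"
      and x: "x \<in> ball xbar \<delta>" and eq: "norm (x - a) = norm (x - b)"
      and slow: "\<And>a' b' x'. a' \<in> A \<Longrightarrow> b' \<in> B \<Longrightarrow> max (norm (x - a)) (norm (x - b)) \<le>
        max (norm (x' - a')) (norm (x' - b')) + \<beta> * (norm (x' - x) + \<gamma> * (norm (a' - a) + norm (b' - b)))"
      by (rule nonsubtransversal_ekeland_point[OF assms(2-4) \<alpha>'(1) \<beta>(1,3) \<gamma>(1,2) \<open>\<delta> > 0\<close> not]) (rule that)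
    have ab: "a \<in> (A - B) \<inter> ball xbar \<delta>" "b \<in> (B - A) \<inter> ball xbar \<delta>" using a b by auto
    obtain \<epsilon> where \<epsilon>: "\<epsilon> > 0"
      "\<forall>a' \<in> A \<inter> ball a \<epsilon>. \<forall>b' \<in> B \<inter> ball b \<epsilon>.
              \<forall>x1' \<in> ball a \<epsilon>. \<forall>x2' \<in> ball b \<epsilon>. norm (x - x1') = norm (x - x2') \<longrightarrow>
              (\<forall>(x1s :: 'a \<Rightarrow>\<^sub>L real) (x2s :: 'a \<Rightarrow>\<^sub>L real).
                 infdist x1s (frechet_normal_cone A a') < \<delta> \<and>
                 infdist x2s (frechet_normal_cone B b') < \<delta> \<and>
                 norm x1s + norm x2s = 1 \<and>
                 blinfun_apply x1s (x - x1') = norm x1s * norm (x - x1') \<and>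
                 blinfun_apply x2s (x - x2') = norm x2s * norm (x - x2') \<longrightarrow>
                 norm (x1s + x2s) > \<alpha>)"
      using assms(7)[THEN bspec, OF ab(1), THEN bspec, OF ab(2), THEN bspec, OF x, THEN mp, OF eq] by (elim exE conjE)
    have "x \<noteq> a"
    proof
      assume "x = a"
      then have "a = b" using eq by simp
      then show False using a b by simp
    qed
    then have r: "norm (x - a) > 0" by simp
    \<comment> \<open>The four bounds keep the test points within \<open>\<epsilon>\<close>, make
      \<open>p\<close> nonzero, leave \<open>\<beta> + e\<close> below \<open>\<alpha>\<close>, and,
      with \<open>\<gamma> \<le> \<delta> / 4\<close>, leave \<open>\<beta> * \<gamma> + e\<close>
      below \<open>\<delta>\<close>.\<close>
    define e where "e = min (min \<epsilon> (norm (x - a))) (min ((\<alpha> - \<beta>) / 2) (\<delta> / 4))"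
    have e: "e > 0" "e \<le> \<epsilon>" "e \<le> norm (x - a)" "e \<le> (\<alpha> - \<beta>) / 2" "e \<le> \<delta> / 4"
      using \<epsilon>(1) r \<beta> \<open>\<delta> > 0\<close> unfolding e_def by (simp, intro min.coboundedI1 min.cobounded1,
        intro min.coboundedI1 min.cobounded2, intro min.coboundedI2 min.cobounded1, intro min.coboundedI2 min.cobounded2)
    have min: "max (norm (a - x)) (norm (b - x)) \<le> max (norm (a' - x - s)) (norm (b' - x - s)) + \<beta> * norm s
        + (\<beta> * \<gamma>) * (norm (a' - a) + norm (b' - b))" if "a' \<in> A" "b' \<in> B" for a' b' s
    proof -
      have "norm ((x + s) - z) = norm (z - x - s)" for z
        using norm_minus_commute[of "x + s" z] by (simp add: diff_diff_eq)
      then show ?thesis using slow[OF that, of "x + s"]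
        by (simp add: norm_minus_commute[of x] distrib_left mult.assoc)
    qed
    have "a \<in> A" "b \<in> B" "\<beta> * \<gamma> \<ge> 0" "\<beta> \<ge> 0" using a b \<beta> \<gamma> by auto
    then obtain a' b' p q and \<nu>1 \<nu>2 y1 y2 :: "'a \<Rightarrow>\<^sub>L real" where a': "a' \<in> A" "b' \<in> B"
      and near: "norm (a' - a) < e" "norm (b' - b) < e" "norm (p - (a - x)) < e" "norm (q - (b - x)) < e"
      and nor: "\<nu>1 \<in> frechet_normal_cone A a'" "\<nu>2 \<in> frechet_normal_cone B b'"
      and sub: "\<And>h k. max (norm p) (norm q) + y1 h + y2 k \<le> max (norm (p + h)) (norm (q + k))"
      and ysum: "\<And>h. y1 h + y2 h \<le> (\<beta> + e) * norm h"
      and dist: "\<And>h. \<nu>1 h + y1 h \<le> (\<beta> * \<gamma> + e) * norm h" "\<And>h. \<nu>2 h + y2 h \<le> (\<beta> * \<gamma> + e) * norm h"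
      by (rule asplund_multipliers[OF assms(1-3) _ _ _ _ e(1) min]) (assumption, assumption, rule that)
    have "p \<noteq> 0" using near(3) e(3) by (auto simp: norm_minus_commute)
    have be: "\<beta> + e < 1" using e(4) \<beta>(2) assms(5) by (simp add: field_simps)
    note sg = max_norm_subgradient[OF sub ysum be \<open>p \<noteq> 0\<close>]
    have \<beta>\<gamma>: "\<beta> * \<gamma> + e < \<delta>" "0 \<le> \<beta> * \<gamma> + e"
    proof -
      have "\<beta> * \<gamma> \<le> 1 * \<gamma>" using \<beta> \<gamma> by (intro mult_right_mono) auto
      then show "\<beta> * \<gamma> + e < \<delta>" using \<gamma>(3) e(5) \<open>\<delta> > 0\<close> by simp
      show "0 \<le> \<beta> * \<gamma> + e" using \<beta> \<gamma> e(1) by simp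
    qed
    have infd: "infdist (- y) X < \<delta>" if "\<nu> \<in> X" "\<And>h. \<nu> h + y h \<le> (\<beta> * \<gamma> + e) * norm h"
      for \<nu> y :: "'a \<Rightarrow>\<^sub>L real" and X
    proof -
      have "norm (\<nu> + y) \<le> \<beta> * \<gamma> + e"
        by (rule norm_blinfun_le_of_norm[OF _ \<beta>\<gamma>(2)]) (simp add: blinfun.add_left that(2))
      then have "dist (- y) \<nu> < \<delta>"
        using \<beta>\<gamma>(1) norm_minus_commute[of "- y" \<nu>] by (simp add: dist_norm)
      then show ?thesis using infdist_le[OF that(1), of "- y"] by simp
    qed
    \<comment> \<open>The test points are \<open>x1' = x + p\<close> and \<open>x2' = x + q\<close>.
      Since \<open>x - x1' = - p\<close>, it is \<open>- y1\<close> that attains its norm there, and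
      the same sign places it near the normal \<open>\<nu>1\<close>, because
      \<open>\<nu>1 + y1\<close> is small; likewise for \<open>- y2\<close>.\<close>
    have "norm (- y1 + - y2) > \<alpha>"
    proof (rule \<epsilon>(2)[THEN bspec, THEN bspec, THEN bspec, THEN bspec, THEN mp, THEN spec, THEN spec, THEN mp])
      show "a' \<in> A \<inter> ball a \<epsilon>" "b' \<in> B \<inter> ball b \<epsilon>" "x + p \<in> ball a \<epsilon>" "x + q \<in> ball b \<epsilon>"
        using a' near e(2) norm_minus_commute[of a a'] norm_minus_commute[of b b']
          norm_minus_commute[of a "x + p"] norm_minus_commute[of b "x + q"]
        by (simp_all add: dist_norm algebra_simps)
      show "norm (x - (x + p)) = norm (x - (x + q))" using sg(1) by simp
      show "infdist (- y1) (frechet_normal_cone A a') < \<delta> \<and> infdist (- y2) (frechet_normal_cone B b') < \<delta> \<and>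
        norm (- y1) + norm (- y2) = 1 \<and> (- y1) (x - (x + p)) = norm (- y1) * norm (x - (x + p)) \<and>
        (- y2) (x - (x + q)) = norm (- y2) * norm (x - (x + q))"
        using infd[OF nor(1) dist(1)] infd[OF nor(2) dist(2)] sg(2-4)
        by (simp add: blinfun.minus_left blinfun.minus_right)
    qed
    moreover have "norm (y1 + y2) \<le> \<beta> + e"
      by (rule norm_blinfun_le_of_norm) (use ysum \<beta> e in \<open>simp_all add: blinfun.add_left\<close>)
    moreover have "norm (- y1 + - y2) = norm (y1 + y2)"
      using norm_minus_cancel[of "y1 + y2"] by simp
    ultimately show False using e(4) \<beta>(2) by (simp add: field_simps)
  qed
  define S where "S = {\<alpha> \<in> {0<..<1}. \<exists>\<delta>>0. subtransversal_with A B xbar \<alpha> \<delta>}"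
  have inS: "\<alpha>' \<in> S" if "0 < \<alpha>'" "\<alpha>' < \<alpha>" for \<alpha>'
    using main[OF that] that assms(5,6) by (auto simp: S_def intro!: exI[of _ "\<delta> / 3"])
  \<comment> \<open>This one member gives subtransversality and rules out the default value 0 of
    \<open>str\<close>.\<close>
  have half: "\<alpha> / 2 \<in> S" using assms(5) by (intro inS) auto
  have bdd: "bdd_above S" by (rule bdd_aboveI[of _ 1]) (auto simp: S_def)
  have "\<alpha> \<le> Sup S"
  proof (rule dense_le_bounded[of 0])
    fix \<alpha>' assume "0 < \<alpha>'" "\<alpha>' < \<alpha>"
    then show "\<alpha>' \<le> Sup S" by (intro cSup_upper inS bdd)
  qed (use assms(5) in auto)
  moreover have "str A B xbar = Sup S" using half unfolding str_def S_def[symmetric] Let_def by auto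
  moreover have "subtransversal A B xbar" using half unfolding subtransversal_def S_def by auto
  ultimately show ?thesis by simp
qed

end
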